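(* Let $(\mathrm{Spec}(B),f)$ be a ($1$-dimensional) affine Landau-Ginzburg model over $S=\mathrm{Spec}(A)$, and let $(E,d,h)$ be an object of $\mathrm{Coh}^s(B,f)$, concentrated in degrees $[m,m']$, with differentials $d_i:E_i\to E_{i+1}$ and homotopies $h_i:E_i\to E_{i-1}$. Then in $\mathbf{Sing}(B,f)$ the object $(E,d,h)$ is equivalent to the $K(B,f)$-dg module concentrated in degrees $[-1,0]$ which is $\bigoplus_{i\in\mathbb Z}E_{2i-1}$ in degree $-1$ and $\bigoplus_{i\in\mathbb Z}E_{2i}$ in degree $0$, with differential $$d+h:\bigoplus_{i\in\mathbb Z}E_{2i-1}\longrightarrow\bigoplus_{i\in\mathbb Z}E_{2i}$$ and homotopy (action of $\varepsilon$) $$d+h:\bigoplus_{i\in\mathbb Z}E_{2i}\longrightarrow\bigoplus_{i\in\mathbb Z}E_{2i-1},$$ where $d$ (resp. $h$) denotes the sum of the $d_i$'s (resp. of the $h_i$'s). Moreover, this equivalence is natural in $(E,d,h)$.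
   Context: Standing assumptions: all rings are commutative and Noetherian; $A$ is a local, Noetherian, regular ring of finite Krull dimension, $S=\mathrm{Spec}(A)$. A ($1$-dimensional) affine Landau-Ginzburg model over $S$ is a pair $(\mathrm{Spec}(B),f)$ with $B$ a flat $A$-algebra of finite type and $f\in B$ arbitrary (no regularity assumed). Koszul algebra: $K(B,f)$ is the commutative dg algebra $B[\varepsilon]$ with $\varepsilon$ in cohomological degree $-1$, $\varepsilon^2=0$, $d(\varepsilon)=f$. A $K(B,f)$-dg module is a triple $(E,d,h)$ where $(E,d)$ is a cochain complex of $B$-modules and $h$ is a $B$-linear map of degree $-1$ (the action of $\varepsilon$) such that $h^2=0$ and $dh+hd=f\cdot\mathrm{id}$. $\mathrm{Coh}^s(B,f)$ is the dg category of $K(B,f)$-dg modules whose underlying complex of $B$-modules is strictly perfect, i.e. strictly bounded and degreewise finitely generated projective. $\mathrm{Perf}^s(B,f)$ is its full sub-dg category of modules that are perfect over $K(B,f)$. dg categories: everything takes place in the $\infty$-category of $A$-linear idempotent complete triangulated dg categories (localization of dg categories at Morita equivalences), and quotients $T/T'$ are pushouts $T\amalg_{T'}0$ there. Relative singularities: let $X=\mathrm{Spec}(B)$, $X_0=X\times^h_{\mathbb A^1_S}S=\mathrm{Spec}\,K(B,f)$ (derived zero locus), $\mathfrak i:X_0\to X$, and $\mathbf{Sing}(Z)=\mathbf{Coh}^b(Z)/\mathbf{Perf}(Z)$. Then $\mathbf{Sing}(B,f)=\mathrm{Ker}(\mathfrak i_*:\mathbf{Sing}(X_0)\to\mathbf{Sing}(X))$,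 and there is an equivalence $\mathrm{Coh}^s(B,f)/\mathrm{Perf}^s(B,f)\simeq\mathbf{Sing}(B,f)$. Objects of $\mathrm{Coh}^s(B,f)$ are regarded as objects of $\mathbf{Sing}(B,f)$ via the quotient functor; two are equivalent in $\mathbf{Sing}(B,f)$ if their images are isomorphic in its homotopy category. *)

theory Defs
  imports
    "HOL-Algebra.Ring_Divisibility"
    "HOL-Algebra.Generated_Rings"
    "HOL-Algebra.Free_Abelian_Groups"
    "HOL-Library.Extended_Nat"
begin

section \<open>A universe for modules\<close>

text \<open>All modules in this development have their carrier in the type \<open>univ\<close>. It contains
  the scalars \<open>'b\<close>, an arbitrary further type \<open>'x\<close>, and is closed under families indexed by
  the integers. So it contains a copy of every finitely generated module over a ring on \<open>'b\<close>, every
  module with carrier in \<open>'x\<close>, and (countable) direct sums can be formed without leaving it.\<close>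

datatype ('b, 'x) univ =
    Scalar (scalar: 'b)
  | Atom 'x
  | Family (component: "int \<Rightarrow> ('b, 'x) univ")


section \<open>Commutative algebra\<close>

definition krull_dim :: "('a, 'c) ring_scheme \<Rightarrow> enat" where
  "krull_dim R = (SUP n \<in> {n. \<exists>P. (\<forall>i\<le>n. primeideal (P i) R) \<and> (\<forall>i<n. P i \<subset> P (Suc i))}. enat n)"

definition regular_local_ring :: "('a, 'c) ring_scheme \<Rightarrow> bool" where
  "regular_local_ring R \<longleftrightarrow> cring R \<and> noetherian_ring R \<and> (\<exists>!I. maximalideal I R) \<and>
     (\<exists>G \<subseteq> carrier R. finite G \<and> maximalideal (Idl\<^bsub>R\<^esub> G) R \<and> enat (card G) = krull_dim R)"

definition module_hom ::
  "('r, 'c) ring_scheme \<Rightarrow> ('r, 'm, 'd) module_scheme \<Rightarrow> ('r, 'n, 'e) module_scheme \<Rightarrow> ('m \<Rightarrow> 'n) set"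
  where
  "module_hom R M N = {\<phi> \<in> carrier M \<rightarrow> carrier N.
     (\<forall>x\<in>carrier M. \<forall>y\<in>carrier M. \<phi> (x \<oplus>\<^bsub>M\<^esub> y) = \<phi> x \<oplus>\<^bsub>N\<^esub> \<phi> y) \<and>
     (\<forall>r\<in>carrier R. \<forall>x\<in>carrier M. \<phi> (r \<odot>\<^bsub>M\<^esub> x) = r \<odot>\<^bsub>N\<^esub> \<phi> x)}"

definition tensor_relations ::
  "('r, 'c) ring_scheme \<Rightarrow> ('r, 'm, 'd) module_scheme \<Rightarrow> ('r, 'n, 'e) module_scheme
    \<Rightarrow> ('m \<times> 'n \<Rightarrow>\<^sub>0 int) set" where
  "tensor_relations R M N = generate (free_Abelian_group (carrier M \<times> carrier N))
     ({frag_of (x \<oplus>\<^bsub>M\<^esub> x', y) - frag_of (x, y) - frag_of (x', y) | x x' y.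
         x \<in> carrier M \<and> x' \<in> carrier M \<and> y \<in> carrier N} \<union>
      {frag_of (x, y \<oplus>\<^bsub>N\<^esub> y') - frag_of (x, y) - frag_of (x, y') | x y y'.
         x \<in> carrier M \<and> y \<in> carrier N \<and> y' \<in> carrier N} \<union>
      {frag_of (r \<odot>\<^bsub>M\<^esub> x, y) - frag_of (x, r \<odot>\<^bsub>N\<^esub> y) | r x y.
         r \<in> carrier R \<and> x \<in> carrier M \<and> y \<in> carrier N})"

definition tensor_product ::
  "('r, 'c) ring_scheme \<Rightarrow> ('r, 'm, 'd) module_scheme \<Rightarrow> ('r, 'n, 'e) module_scheme
    \<Rightarrow> ('m \<times> 'n \<Rightarrow>\<^sub>0 int) set monoid" where
  "tensor_product R M N =
     free_Abelian_group (carrier M \<times> carrier N) Mod tensor_relations R M N"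

text \<open>The map \<open>\<phi> \<otimes> id : M \<otimes> P \<rightarrow> N \<otimes> P\<close>, on cosets.\<close>

definition tensor_map ::
  "('r, 'c) ring_scheme \<Rightarrow> ('r, 'n, 'd) module_scheme \<Rightarrow> ('r, 'p, 'e) module_scheme
    \<Rightarrow> ('m \<Rightarrow> 'n) \<Rightarrow> ('m \<times> 'p \<Rightarrow>\<^sub>0 int) set \<Rightarrow> ('n \<times> 'p \<Rightarrow>\<^sub>0 int) set" where
  "tensor_map R N P \<phi> C =
     (\<Union>c\<in>C. tensor_relations R N P #>\<^bsub>free_Abelian_group (carrier N \<times> carrier P)\<^esub>
               frag_extend (\<lambda>(x, y). frag_of (\<phi> x, y)) c)"

text \<open>The test modules \<open>M\<close>, \<open>N\<close> range over a universe containing all finitely generated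
  \<open>R\<close>-modules; these suffice to test flatness.\<close>

definition flat_module :: "('r, 'c) ring_scheme \<Rightarrow> ('r, 'p, 'd) module_scheme \<Rightarrow> bool" where
  "flat_module R P \<longleftrightarrow> module R P \<and>
     (\<forall>(M :: ('r, ('r, 'p) univ) module) (N :: ('r, ('r, 'p) univ) module) \<phi>.
        module R M \<and> module R N \<and> \<phi> \<in> module_hom R M N \<and> inj_on \<phi> (carrier M) \<longrightarrow>
        inj_on (tensor_map R N P \<phi>) (carrier (tensor_product R M P)))"

definition finite_type :: "('a, 'c) ring_scheme \<Rightarrow> ('a, 'b, 'd) module_scheme \<Rightarrow> bool" where
  "finite_type A B \<longleftrightarrow> (\<exists>X \<subseteq> carrier B. finite X \<and>
     generate_ring B (X \<union> {a \<odot>\<^bsub>B\<^esub> \<one>\<^bsub>B\<^esub> | a. a \<in> carrier A}) = carrier B)"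

text \<open>\<open>B\<close> is at the same time a ring and an \<open>A\<close>-module, as in the locale \<open>algebra\<close>.\<close>

definition affine_LG_model :: "('a, 'c) ring_scheme \<Rightarrow> ('a, 'b, 'd) module_scheme \<Rightarrow> 'b \<Rightarrow> bool" where
  "affine_LG_model A B f \<longleftrightarrow>
     algebra A B \<and> noetherian_ring B \<and> flat_module A B \<and> finite_type A B \<and> f \<in> carrier B"

text \<open>The ring components \<open>mult\<close> and \<open>one\<close> of a \<open>module\<close> record play no role for modules.\<close>

definition free_module :: "('b, 'c) ring_scheme \<Rightarrow> nat \<Rightarrow> ('b, nat \<Rightarrow> 'b) module" where
  "free_module B n =
     \<lparr>carrier = (\<Pi>\<^sub>E i\<in>{..<n}. carrier B), monoid.mult = undefined, one = undefined,
      ring.zero = (\<lambda>i\<in>{..<n}. \<zero>\<^bsub>B\<^esub>), add = (\<lambda>x y. \<lambda>i\<in>{..<n}. x i \<oplus>\<^bsub>B\<^esub> y i),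
      smult = (\<lambda>b x. \<lambda>i\<in>{..<n}. b \<otimes>\<^bsub>B\<^esub> x i)\<rparr>"

text \<open>Finitely generated projective: a direct summand of some \<open>B\<^sup>n\<close>.\<close>

definition fg_projective :: "('b, 'c) ring_scheme \<Rightarrow> ('b, 'm, 'd) module_scheme \<Rightarrow> bool" where
  "fg_projective B P \<longleftrightarrow> module B P \<and>
     (\<exists>n. \<exists>s \<in> module_hom B P (free_module B n). \<exists>p \<in> module_hom B (free_module B n) P.
        \<forall>x\<in>carrier P. p (s x) = x)"

definition direct_sum ::
  "int set \<Rightarrow> (int \<Rightarrow> ('r, ('b, 'x) univ) module) \<Rightarrow> ('r, ('b, 'x) univ) module" where
  "direct_sum J M =
     \<lparr>carrier = Family ` {x \<in> \<Pi>\<^sub>E j\<in>J. carrier (M j). finite {j\<in>J. x j \<noteq> \<zero>\<^bsub>M j\<^esub>}},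
      monoid.mult = undefined, one = undefined,
      ring.zero = Family (\<lambda>j\<in>J. \<zero>\<^bsub>M j\<^esub>),
      add = (\<lambda>x y. Family (\<lambda>j\<in>J. component x j \<oplus>\<^bsub>M j\<^esub> component y j)),
      smult = (\<lambda>r x. Family (\<lambda>j\<in>J. r \<odot>\<^bsub>M j\<^esub> component x j))\<rparr>"


section \<open>Categories, localizations, idempotent completion\<close>

text \<open>\<open>Comp C X Y Z g f\<close> is the composite of \<open>f : X \<rightarrow> Y\<close> followed by \<open>g : Y \<rightarrow> Z\<close>.\<close>

record ('o, 'a) cat =
  Obj :: "'o set"
  Hom :: "'o \<Rightarrow> 'o \<Rightarrow> 'a set"
  Ident :: "'o \<Rightarrow> 'a"
  Comp :: "'o \<Rightarrow> 'o \<Rightarrow> 'o \<Rightarrow> 'a \<Rightarrow> 'a \<Rightarrow> 'a"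

definition is_isomorphism :: "('o, 'a) cat \<Rightarrow> 'o \<Rightarrow> 'o \<Rightarrow> 'a \<Rightarrow> bool" where
  "is_isomorphism C X Y g \<longleftrightarrow> X \<in> Obj C \<and> Y \<in> Obj C \<and> g \<in> Hom C X Y \<and>
     (\<exists>g' \<in> Hom C Y X. Comp C X Y X g' g = Ident C X \<and> Comp C Y X Y g g' = Ident C Y)"

definition is_retract :: "('o, 'a) cat \<Rightarrow> 'o \<Rightarrow> 'o \<Rightarrow> bool" where
  "is_retract C X Y \<longleftrightarrow> X \<in> Obj C \<and> Y \<in> Obj C \<and>
     (\<exists>s \<in> Hom C X Y. \<exists>p \<in> Hom C Y X. Comp C X Y X p s = Ident C X)"

text \<open>Localization \<open>C[S\<^sup>-\<^sup>1]\<close>: morphisms are zigzags modulo the usual relations.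
  \<open>Fwd X Y g\<close> is a morphism \<open>g : X \<rightarrow> Y\<close>, and \<open>Bwd X Y s\<close> is the formal inverse \<open>Y \<rightarrow> X\<close> of
  \<open>s : X \<rightarrow> Y\<close> in \<open>S\<close>. Zigzags are read from left to right.\<close>

datatype ('o, 'a) step = Fwd 'o 'o 'a | Bwd 'o 'o 'a

fun zigzag :: "('o, 'a) cat \<Rightarrow> ('o \<Rightarrow> 'o \<Rightarrow> 'a set) \<Rightarrow> 'o \<Rightarrow> ('o, 'a) step list \<Rightarrow> 'o \<Rightarrow> bool" where
  "zigzag C S X [] Z \<longleftrightarrow> X \<in> Obj C \<and> X = Z"
| "zigzag C S X (Fwd U V g # w) Z \<longleftrightarrow>
     U = X \<and> U \<in> Obj C \<and> V \<in> Obj C \<and> g \<in> Hom C U V \<and> zigzag C S V w Z"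
| "zigzag C S X (Bwd U V s # w) Z \<longleftrightarrow>
     V = X \<and> U \<in> Obj C \<and> V \<in> Obj C \<and> s \<in> Hom C U V \<and> s \<in> S U V \<and> zigzag C S U w Z"

inductive zigzag_eq ::
  "('o, 'a) cat \<Rightarrow> ('o \<Rightarrow> 'o \<Rightarrow> 'a set) \<Rightarrow> 'o \<Rightarrow> 'o \<Rightarrow> ('o, 'a) step list \<Rightarrow> ('o, 'a) step list \<Rightarrow> bool"
  for C S where
  refl: "zigzag C S X u Y \<Longrightarrow> zigzag_eq C S X Y u u"
| sym: "zigzag_eq C S X Y u v \<Longrightarrow> zigzag_eq C S X Y v u"
| trans: "zigzag_eq C S X Y u v \<Longrightarrow> zigzag_eq C S X Y v w \<Longrightarrow> zigzag_eq C S X Y u w"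
| append: "zigzag_eq C S X Y u u' \<Longrightarrow> zigzag_eq C S Y Z v v' \<Longrightarrow> zigzag_eq C S X Z (u @ v) (u' @ v')"
| ident: "X \<in> Obj C \<Longrightarrow> zigzag_eq C S X X [Fwd X X (Ident C X)] []"
| comp: "zigzag C S X [Fwd X Y g, Fwd Y Z g'] Z \<Longrightarrow>
     zigzag_eq C S X Z [Fwd X Y g, Fwd Y Z g'] [Fwd X Z (Comp C X Y Z g' g)]"
| inv_right: "zigzag C S X [Fwd X Y s, Bwd X Y s] X \<Longrightarrow> zigzag_eq C S X X [Fwd X Y s, Bwd X Y s] []"
| inv_left: "zigzag C S Y [Bwd X Y s, Fwd X Y s] Y \<Longrightarrow> zigzag_eq C S Y Y [Bwd X Y s, Fwd X Y s] []"

definition localization ::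
  "('o, 'a) cat \<Rightarrow> ('o \<Rightarrow> 'o \<Rightarrow> 'a set) \<Rightarrow> ('o, ('o, 'a) step list set) cat" where
  "localization C S =
     \<lparr>Obj = Obj C,
      Hom = (\<lambda>X Y. {Collect (zigzag_eq C S X Y u) | u. zigzag C S X u Y}),
      Ident = (\<lambda>X. Collect (zigzag_eq C S X X [])),
      Comp = (\<lambda>X Y Z b a. {w. \<exists>u\<in>a. \<exists>v\<in>b. zigzag_eq C S X Z (u @ v) w})\<rparr>"

definition loc_map ::
  "('o, 'a) cat \<Rightarrow> ('o \<Rightarrow> 'o \<Rightarrow> 'a set) \<Rightarrow> 'o \<Rightarrow> 'o \<Rightarrow> 'a \<Rightarrow> ('o, 'a) step list set" where
  "loc_map C S X Y g = Collect (zigzag_eq C S X Y [Fwd X Y g])"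

definition karoubi :: "('o, 'a) cat \<Rightarrow> ('o \<times> 'a, 'a) cat" where
  "karoubi C =
     \<lparr>Obj = {(X, e). X \<in> Obj C \<and> e \<in> Hom C X X \<and> Comp C X X X e e = e},
      Hom = (\<lambda>(X, e) (Y, e'). {g \<in> Hom C X Y. Comp C X Y Y e' g = g \<and> Comp C X X Y g e = g}),
      Ident = (\<lambda>(X, e). e),
      Comp = (\<lambda>(X, _) (Y, _) (Z, _). Comp C X Y Z)\<rparr>"


section \<open>Dg modules over the Koszul algebra\<close>

text \<open>\<open>cmp E i\<close> is \<open>E\<^sub>i\<close>, with \<open>dif E i : E\<^sub>i \<rightarrow> E\<^sub>i\<^sub>+\<^sub>1\<close> and \<open>hty E i : E\<^sub>i \<rightarrow> E\<^sub>i\<^sub>-\<^sub>1\<close>.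
  Maps are relevant only on the carriers.\<close>

record ('r, 'm) kdg =
  cmp :: "int \<Rightarrow> ('r, 'm) module"
  dif :: "int \<Rightarrow> 'm \<Rightarrow> 'm"
  hty :: "int \<Rightarrow> 'm \<Rightarrow> 'm"

definition kdg_mod :: "('b, 'c) ring_scheme \<Rightarrow> 'b \<Rightarrow> ('b, 'm) kdg set" where
  "kdg_mod B f = {E. \<forall>i. module B (cmp E i) \<and>
     dif E i \<in> module_hom B (cmp E i) (cmp E (i + 1)) \<and>
     hty E i \<in> module_hom B (cmp E i) (cmp E (i - 1)) \<and>
     (\<forall>x\<in>carrier (cmp E i).
        dif E (i + 1) (dif E i x) = \<zero>\<^bsub>cmp E (i + 2)\<^esub> \<and>
        hty E (i - 1) (hty E i x) = \<zero>\<^bsub>cmp E (i - 2)\<^esub> \<and>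
        dif E (i - 1) (hty E i x) \<oplus>\<^bsub>cmp E i\<^esub> hty E (i + 1) (dif E i x) = f \<odot>\<^bsub>cmp E i\<^esub> x)}"

text \<open>The sign \<open>(-1)\<^sup>n\<close>.\<close>

definition signed :: "('r, 'm) module \<Rightarrow> int \<Rightarrow> 'm \<Rightarrow> 'm" where
  "signed M n x = (if even n then x else \<ominus>\<^bsub>M\<^esub> x)"

text \<open>The complex of \<open>K(B,f)\<close>-linear maps: degree \<open>n\<close> part and differential. Since \<open>\<epsilon>\<close> has odd
  degree, a linear map of degree \<open>n\<close> commutes with it up to \<open>(-1)\<^sup>n\<close>.\<close>

definition dg_hom ::
  "('b, 'c) ring_scheme \<Rightarrow> ('b, 'm) kdg \<Rightarrow> ('b, 'm) kdg \<Rightarrow> int \<Rightarrow> (int \<Rightarrow> 'm \<Rightarrow> 'm) set" where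
  "dg_hom B E F n = {\<phi>. \<forall>i. \<phi> i \<in> module_hom B (cmp E i) (cmp F (i + n)) \<and>
     (\<forall>x\<in>carrier (cmp E i).
        \<phi> (i - 1) (hty E i x) = signed (cmp F (i + n - 1)) n (hty F (i + n) (\<phi> i x)))}"

definition dg_diff ::
  "('b, 'm) kdg \<Rightarrow> ('b, 'm) kdg \<Rightarrow> int \<Rightarrow> (int \<Rightarrow> 'm \<Rightarrow> 'm) \<Rightarrow> int \<Rightarrow> 'm \<Rightarrow> 'm" where
  "dg_diff E F n \<phi> i x =
     dif F (i + n) (\<phi> i x)
     \<ominus>\<^bsub>cmp F (i + n + 1)\<^esub> signed (cmp F (i + n + 1)) n (\<phi> (i + 1) (dif E i x))"

definition cocycles :: "('b, 'c) ring_scheme \<Rightarrow> ('b, 'm) kdg \<Rightarrow> ('b, 'm) kdg \<Rightarrow> (int \<Rightarrow> 'm \<Rightarrow> 'm) set" where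
  "cocycles B E F = {\<phi> \<in> dg_hom B E F 0.
     \<forall>i. \<forall>x\<in>carrier (cmp E i). dg_diff E F 0 \<phi> i x = \<zero>\<^bsub>cmp F (i + 1)\<^esub>}"

definition homotopic ::
  "('b, 'c) ring_scheme \<Rightarrow> ('b, 'm) kdg \<Rightarrow> ('b, 'm) kdg \<Rightarrow> (int \<Rightarrow> 'm \<Rightarrow> 'm) \<Rightarrow> (int \<Rightarrow> 'm \<Rightarrow> 'm) \<Rightarrow> bool"
  where
  "homotopic B E F \<phi> \<psi> \<longleftrightarrow> (\<exists>s \<in> dg_hom B E F (- 1). \<forall>i. \<forall>x\<in>carrier (cmp E i).
     \<phi> i x = \<psi> i x \<oplus>\<^bsub>cmp F i\<^esub> dg_diff E F (- 1) s i x)"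

definition hclass ::
  "('b, 'c) ring_scheme \<Rightarrow> ('b, 'm) kdg \<Rightarrow> ('b, 'm) kdg \<Rightarrow> (int \<Rightarrow> 'm \<Rightarrow> 'm) \<Rightarrow> (int \<Rightarrow> 'm \<Rightarrow> 'm) set"
  where
  "hclass B E F \<phi> = {\<psi> \<in> cocycles B E F. homotopic B E F \<psi> \<phi>}"

text \<open>The homotopy category \<open>H\<^sup>0\<close> of the full dg category on a class of objects.\<close>

definition H0_cat ::
  "('b, 'c) ring_scheme \<Rightarrow> ('b, 'm) kdg set \<Rightarrow> (('b, 'm) kdg, (int \<Rightarrow> 'm \<Rightarrow> 'm) set) cat" where
  "H0_cat B Os =
     \<lparr>Obj = Os,
      Hom = (\<lambda>E F. hclass B E F ` cocycles B E F),
      Ident = (\<lambda>E. hclass B E E (\<lambda>i x. x)),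
      Comp = (\<lambda>E F G b a. \<Union>\<phi>\<in>a. \<Union>\<psi>\<in>b. hclass B E G (\<lambda>i x. \<psi> i (\<phi> i x)))\<rparr>"

definition dg_shift :: "('b, 'm) kdg \<Rightarrow> int \<Rightarrow> ('b, 'm) kdg" where
  "dg_shift E n =
     \<lparr>cmp = (\<lambda>i. cmp E (i + n)),
      dif = (\<lambda>i x. signed (cmp E (i + n + 1)) n (dif E (i + n) x)),
      hty = (\<lambda>i x. signed (cmp E (i + n - 1)) n (hty E (i + n) x))\<rparr>"

definition pair :: "('b, 'x) univ \<Rightarrow> ('b, 'x) univ \<Rightarrow> ('b, 'x) univ" where
  "pair x y = Family (\<lambda>j\<in>{0, 1}. if j = 0 then x else y)"

text \<open>The cone of \<open>\<phi> : E \<rightarrow> F\<close> is \<open>E\<^sub>i\<^sub>+\<^sub>1 \<oplus> F\<^sub>i\<close> in degree \<open>i\<close>, with \<open>d(x,y) = (-dx, \<phi>x + dy)\<close>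
  and \<open>h(x,y) = (-hx, hy)\<close>.\<close>

definition dg_cone ::
  "('b, ('b, 'x) univ) kdg \<Rightarrow> ('b, ('b, 'x) univ) kdg
    \<Rightarrow> (int \<Rightarrow> ('b, 'x) univ \<Rightarrow> ('b, 'x) univ) \<Rightarrow> ('b, ('b, 'x) univ) kdg" where
  "dg_cone E F \<phi> =
     \<lparr>cmp = (\<lambda>i. direct_sum {0, 1} (\<lambda>j. if j = 0 then cmp E (i + 1) else cmp F i)),
      dif = (\<lambda>i z. pair (\<ominus>\<^bsub>cmp E (i + 2)\<^esub> dif E (i + 1) (component z 0))
                        (\<phi> (i + 1) (component z 0) \<oplus>\<^bsub>cmp F (i + 1)\<^esub> dif F i (component z 1))),
      hty = (\<lambda>i z. pair (\<ominus>\<^bsub>cmp E i\<^esub> hty E (i + 1) (component z 0))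
                        (hty F i (component z 1)))\<rparr>"

definition quasi_iso ::
  "('b, 'c) ring_scheme \<Rightarrow> ('b, 'm) kdg \<Rightarrow> ('b, 'm) kdg \<Rightarrow> (int \<Rightarrow> 'm \<Rightarrow> 'm) \<Rightarrow> bool" where
  "quasi_iso B E F \<phi> \<longleftrightarrow> \<phi> \<in> cocycles B E F \<and> (\<forall>i.
     (\<forall>x\<in>carrier (cmp E i). dif E i x = \<zero>\<^bsub>cmp E (i + 1)\<^esub> \<and>
        \<phi> i x \<in> dif F (i - 1) ` carrier (cmp F (i - 1)) \<longrightarrow>
        x \<in> dif E (i - 1) ` carrier (cmp E (i - 1))) \<and>
     (\<forall>y\<in>carrier (cmp F i). dif F i y = \<zero>\<^bsub>cmp F (i + 1)\<^esub> \<longrightarrow>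
        (\<exists>x\<in>carrier (cmp E i). dif E i x = \<zero>\<^bsub>cmp E (i + 1)\<^esub> \<and>
           (\<exists>z\<in>carrier (cmp F (i - 1)). y = \<phi> i x \<oplus>\<^bsub>cmp F i\<^esub> dif F (i - 1) z))))"

text \<open>The derived category of \<open>K(B,f)\<close>.\<close>

definition derived_cat where
  "derived_cat B f =
     localization (H0_cat B (kdg_mod B f)) (\<lambda>E F. hclass B E F ` {\<phi>. quasi_iso B E F \<phi>})"

definition scalar_module :: "('b, 'c) ring_scheme \<Rightarrow> 'b set \<Rightarrow> ('b, ('b, 'x) univ) module" where
  "scalar_module B I =
     \<lparr>carrier = Scalar ` I, monoid.mult = undefined, one = undefined, ring.zero = Scalar \<zero>\<^bsub>B\<^esub>,
      add = (\<lambda>x y. Scalar (scalar x \<oplus>\<^bsub>B\<^esub> scalar y)),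
      smult = (\<lambda>b x. Scalar (b \<otimes>\<^bsub>B\<^esub> scalar x))\<rparr>"

text \<open>\<open>K(B,f)\<close> as a module over itself: \<open>B\<epsilon>\<close> in degree \<open>-1\<close> and \<open>B\<close> in degree \<open>0\<close>.\<close>

definition koszul :: "('b, 'c) ring_scheme \<Rightarrow> 'b \<Rightarrow> ('b, ('b, 'x) univ) kdg" where
  "koszul B f =
     \<lparr>cmp = (\<lambda>i. scalar_module B (if i = - 1 \<or> i = 0 then carrier B else {\<zero>\<^bsub>B\<^esub>})),
      dif = (\<lambda>i x. Scalar (if i = - 1 then f \<otimes>\<^bsub>B\<^esub> scalar x else \<zero>\<^bsub>B\<^esub>)),
      hty = (\<lambda>i x. Scalar (if i = 0 then scalar x else \<zero>\<^bsub>B\<^esub>))\<rparr>"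

text \<open>Perfect modules: the thick triangulated subcategory of the derived category generated by
  \<open>K(B,f)\<close>. Being closed under retracts in the derived category, it is closed under
  quasi-isomorphism.\<close>

inductive_set perf :: "('b, 'c) ring_scheme \<Rightarrow> 'b \<Rightarrow> ('b, ('b, 'x) univ) kdg set"
  for B f where
  unit: "koszul B f \<in> perf B f"
| shift: "E \<in> perf B f \<Longrightarrow> dg_shift E n \<in> perf B f"
| cone: "E \<in> perf B f \<Longrightarrow> F \<in> perf B f \<Longrightarrow> \<phi> \<in> cocycles B E F \<Longrightarrow> dg_cone E F \<phi> \<in> perf B f"
| retract: "F \<in> perf B f \<Longrightarrow> is_retract (derived_cat B f) E F \<Longrightarrow> E \<in> perf B f"


section \<open>The dg category of relative singularities\<close>

definition coh_s :: "('b, 'c) ring_scheme \<Rightarrow> 'b \<Rightarrow> ('b, 'm) kdg set" where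
  "coh_s B f = {E \<in> kdg_mod B f. (\<forall>i. fg_projective B (cmp E i)) \<and>
     (\<exists>m m'. \<forall>i. i < m \<or> m' < i \<longrightarrow> carrier (cmp E i) = {\<zero>\<^bsub>cmp E i\<^esub>})}"

definition perf_s :: "('b, 'c) ring_scheme \<Rightarrow> 'b \<Rightarrow> ('b, ('b, 'x) univ) kdg set" where
  "perf_s B f = coh_s B f \<inter> perf B f"

text \<open>The Verdier quotient of the homotopy categories of \<open>Coh\<^sup>s(B,f)\<close> and \<open>Perf\<^sup>s(B,f)\<close>: the
  localization at the morphisms with cone in \<open>Perf\<^sup>s(B,f)\<close>.\<close>

definition perf_equivs ::
  "('b, 'c) ring_scheme \<Rightarrow> 'b \<Rightarrow> ('b, ('b, 'x) univ) kdg \<Rightarrow> ('b, ('b, 'x) univ) kdg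
    \<Rightarrow> (int \<Rightarrow> ('b, 'x) univ \<Rightarrow> ('b, 'x) univ) set set" where
  "perf_equivs B f E F = hclass B E F ` {\<phi> \<in> cocycles B E F. dg_cone E F \<phi> \<in> perf_s B f}"

definition verdier_quotient where
  "verdier_quotient B f = localization (H0_cat B (coh_s B f)) (perf_equivs B f)"

text \<open>The homotopy category of \<open>Sing(B,f)\<close>, the quotient of \<open>Coh\<^sup>s(B,f)\<close> by \<open>Perf\<^sup>s(B,f)\<close> among
  idempotent complete triangulated dg categories, together with the quotient functor on objects
  and on closed morphisms of degree \<open>0\<close>.\<close>

definition sing where
  "sing B f = karoubi (verdier_quotient B f)"

definition sing_obj where
  "sing_obj B f E = (E, Ident (verdier_quotient B f) E)"

definition sing_map where
  "sing_map B f E F \<phi> = loc_map (H0_cat B (coh_s B f)) (perf_equivs B f) E F (hclass B E F \<phi>)"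


section \<open>Folding a dg module into degrees -1 and 0\<close>

definition folded_indices :: "int \<Rightarrow> int set" where
  "folded_indices i = (if i = - 1 then {j. odd j} else if i = 0 then {j. even j} else {})"

text \<open>\<open>d + h\<close>, with values in the sum of the \<open>E\<^sub>j\<close> for \<open>j \<in> J\<close>.\<close>

definition dif_plus_hty ::
  "('b, ('b, 'x) univ) kdg \<Rightarrow> int set \<Rightarrow> ('b, 'x) univ \<Rightarrow> ('b, 'x) univ" where
  "dif_plus_hty E J x = Family (\<lambda>j\<in>J.
     dif E (j - 1) (component x (j - 1)) \<oplus>\<^bsub>cmp E j\<^esub> hty E (j + 1) (component x (j + 1)))"

definition folded :: "('b, ('b, 'x) univ) kdg \<Rightarrow> ('b, ('b, 'x) univ) kdg" where
  "folded E =
     \<lparr>cmp = (\<lambda>i. direct_sum (folded_indices i) (cmp E)),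
      dif = (\<lambda>i x. if i = - 1 then dif_plus_hty E {j. even j} x
                   else \<zero>\<^bsub>direct_sum (folded_indices (i + 1)) (cmp E)\<^esub>),
      hty = (\<lambda>i x. if i = 0 then dif_plus_hty E {j. odd j} x
                   else \<zero>\<^bsub>direct_sum (folded_indices (i - 1)) (cmp E)\<^esub>)\<rparr>"

definition folded_map ::
  "(int \<Rightarrow> ('b, 'x) univ \<Rightarrow> ('b, 'x) univ) \<Rightarrow> int \<Rightarrow> ('b, 'x) univ \<Rightarrow> ('b, 'x) univ" where
  "folded_map \<phi> i x = Family (\<lambda>j\<in>folded_indices i. \<phi> j (component x j))"

end

theory Submission
  imports Defs
begin

text \<open>Let \<open>D = d + h\<close> on \<open>\<Oplus> E\<^sub>j\<close>, so that \<open>D\<^sup>2 = f\<close>. For \<open>\<gamma> : \<int> \<rightarrow> \<int>\<close> with \<open>\<gamma>(j) \<equiv> j\<close> modulo 2 and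
  \<open>\<gamma>(j + 1) = \<gamma>(j) \<plusminus> 1\<close>, put \<open>E\<^sub>j\<close> in degree \<open>\<gamma>(j)\<close> and split \<open>D\<close> into the part raising the degree, which is
  the differential, and the part lowering it, which is the action of \<open>\<epsilon>\<close>. This gives a dg module
  \<open>E\<^sup>\<gamma>\<close>, which is \<open>E\<close> for \<open>\<gamma> = id\<close> and the folded module for \<open>\<gamma>\<close> with values in \<open>{-1, 0}\<close>.

  If \<open>\<gamma> \<le> \<gamma>'\<close>, there is a roof \<open>E\<^sup>\<gamma> \<leftarrow> M \<rightarrow> E\<^sup>\<gamma>'\<close> of surjections, with one copy of \<open>E\<^sub>j\<close> in every degree of
  \<open>M\<close> from \<open>\<gamma>(j)\<close> to \<open>\<gamma>'(j)\<close>. The kernel of the first map is bounded and projective over \<open>B[\<epsilon>]\<close>, hence perfect;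
  the kernel of the second is acyclic. So both maps become invertible in \<open>Sing(B, f)\<close>. The equivalence is
  obtained from the two roofs joining the identity and the folding shape to their maximum. Nothing in
  the construction depends on the degree bounds of \<open>E\<close>, so it is strictly natural.\<close>

text \<open>The matrix of the roof comes from \<open>D\<^sup>2 = f\<close> alone. On pairs (a, b),
  where a collects the copies of E_j in degrees of the parity of j and b the other copies, the
  differential has rows (D, -f) and (1, -D), and this squares to zero. The generator \<epsilon> acts
  by -1 from a to b, as on a module extended from B to B[\<epsilon>]. The two ends of the range
  dictate their own repair. A bottom copy has no b below it, so \<epsilon> acts on it through D. A
  top copy has no b above it, and the missing component x - D x of the differential becomes the
  projection to the upper lattice module. No roof joins the identity directly to the folding shape:
  folding raises degrees below -1 and lowers degrees above 0, so the two shapes are incomparable. A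
  morphism is inverted when its cone lies in a class generated from K(B,f) by shifts, cones and
  retracts in the derived category. Quasi-isomorphism invariance and acyclic modules have to be
  extracted from the closure under retracts before the kernels can be used.\<close>

section \<open>Modules and additive identities\<close>

text \<open>Identities in an abelian group are checked in the free abelian group on its elements.\<close>

definition lin_eval :: "('m, 'd) ring_scheme \<Rightarrow> ('m \<Rightarrow>\<^sub>0 int) \<Rightarrow> 'm" where
  "lin_eval M = (SOME h. h \<in> hom (free_Abelian_group (carrier M)) (add_monoid M) \<and>
     (\<forall>y\<in>carrier M. h (frag_of y) = y))"

text \<open>The group hypothesis sits inside the predicate, so that the rules below are purely
  syntax-directed; it is supplied once, in \<open>lin_eqI\<close>.\<close>

definition lin_rep :: "('m, 'd) ring_scheme \<Rightarrow> 'm \<Rightarrow> ('m \<Rightarrow>\<^sub>0 int) \<Rightarrow> bool" where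
  "lin_rep M x X \<longleftrightarrow>
     (abelian_group M \<longrightarrow> X \<in> carrier (free_Abelian_group (carrier M)) \<and> lin_eval M X = x)"

lemma lin_eval:
  assumes "abelian_group M"
  shows "group_hom (free_Abelian_group (carrier M)) (add_monoid M) (lin_eval M)"
    and "y \<in> carrier M \<Longrightarrow> lin_eval M (frag_of y) = y"
proof -
  have G: "comm_group (add_monoid M)"
    using assms by (simp add: abelian_group.a_comm_group)
  obtain h where "h \<in> hom (free_Abelian_group (carrier M)) (add_monoid M)"
      "\<And>y. y \<in> carrier M \<Longrightarrow> h (frag_of y) = y"
    using comm_group.free_Abelian_group_universal[OF G, of "\<lambda>x. x" "carrier M"] by auto
  then have "\<exists>h. h \<in> hom (free_Abelian_group (carrier M)) (add_monoid M) \<and>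
      (\<forall>y\<in>carrier M. h (frag_of y) = y)" by blast
  from someI_ex[OF this] G
  show "group_hom (free_Abelian_group (carrier M)) (add_monoid M) (lin_eval M)"
    and "y \<in> carrier M \<Longrightarrow> lin_eval M (frag_of y) = y"
    by (auto simp: lin_eval_def group_hom_def group_hom_axioms_def comm_group_def)
qed

text \<open>Evaluation sends equal formal sums to equal elements. The remaining goal
  \<open>X = Y\<close> lives in a type that is an additive group, where simplification settles it,
  and membership is checked at the atoms only.\<close>

lemma lin_eqI:
  assumes "abelian_group M" and "lin_rep M x X" and "lin_rep M y Y" and "X = Y"
  shows "x = y"
  using assms by (simp add: lin_rep_def)

lemma lin_add: "lin_rep M x X \<Longrightarrow> lin_rep M y Y \<Longrightarrow> lin_rep M (x \<oplus>\<^bsub>M\<^esub> y) (X + Y)"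
  using group_hom.hom_mult[OF lin_eval(1), of M X Y]
  by (auto simp: lin_rep_def dest: keys_add[THEN subsetD])

lemma lin_zero: "lin_rep M \<zero>\<^bsub>M\<^esub> 0"
  using group_hom.hom_one[OF lin_eval(1), of M] by (auto simp: lin_rep_def)

lemma lin_minus: "lin_rep M x X \<Longrightarrow> lin_rep M (\<ominus>\<^bsub>M\<^esub> x) (- X)"
  using group_hom.hom_inv[OF lin_eval(1), of M X] by (auto simp: lin_rep_def a_inv_def)

lemma lin_diff: "lin_rep M x X \<Longrightarrow> lin_rep M y Y \<Longrightarrow> lin_rep M (x \<ominus>\<^bsub>M\<^esub> y) (X - Y)"
  using lin_add[OF _ lin_minus, of M x X y Y] by (simp add: a_minus_def)

lemma lin_atom: "x \<in> carrier M \<Longrightarrow> lin_rep M x (frag_of x)"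
  by (auto simp: lin_rep_def lin_eval(2))

lemmas lin_rules = lin_add lin_zero lin_minus lin_diff

section \<open>Linear maps between modules\<close>

lemma module_homD:
  assumes "\<phi> \<in> module_hom B M N"
  shows "x \<in> carrier M \<Longrightarrow> \<phi> x \<in> carrier N"
    and "x \<in> carrier M \<Longrightarrow> y \<in> carrier M \<Longrightarrow> \<phi> (x \<oplus>\<^bsub>M\<^esub> y) = \<phi> x \<oplus>\<^bsub>N\<^esub> \<phi> y"
    and "r \<in> carrier B \<Longrightarrow> x \<in> carrier M \<Longrightarrow> \<phi> (r \<odot>\<^bsub>M\<^esub> x) = r \<odot>\<^bsub>N\<^esub> \<phi> x"
  using assms by (auto simp: module_hom_def)

lemma module_homI:
  assumes "\<And>x. x \<in> carrier M \<Longrightarrow> \<phi> x \<in> carrier N"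
    and "\<And>x y. x \<in> carrier M \<Longrightarrow> y \<in> carrier M \<Longrightarrow> \<phi> (x \<oplus>\<^bsub>M\<^esub> y) = \<phi> x \<oplus>\<^bsub>N\<^esub> \<phi> y"
    and "\<And>r x. r \<in> carrier B \<Longrightarrow> x \<in> carrier M \<Longrightarrow> \<phi> (r \<odot>\<^bsub>M\<^esub> x) = r \<odot>\<^bsub>N\<^esub> \<phi> x"
  shows "\<phi> \<in> module_hom B M N"
  using assms by (auto simp: module_hom_def)

lemma module_abelian_group: "Module.module B M \<Longrightarrow> abelian_group M"
  by (simp add: module_def)

lemma (in module) module_arith:
  "abelian_group M" "\<zero>\<^bsub>M\<^esub> \<in> carrier M"
    "x \<in> carrier M \<Longrightarrow> y \<in> carrier M \<Longrightarrow> x \<oplus>\<^bsub>M\<^esub> y \<in> carrier M"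
    "x \<in> carrier M \<Longrightarrow> y \<in> carrier M \<Longrightarrow> x \<ominus>\<^bsub>M\<^esub> y \<in> carrier M"
    "x \<in> carrier M \<Longrightarrow> \<ominus>\<^bsub>M\<^esub> x \<in> carrier M"
    "x \<in> carrier M \<Longrightarrow> \<zero>\<^bsub>M\<^esub> \<oplus>\<^bsub>M\<^esub> x = x"
    "x \<in> carrier M \<Longrightarrow> x \<oplus>\<^bsub>M\<^esub> \<zero>\<^bsub>M\<^esub> = x"
    "x \<in> carrier M \<Longrightarrow> x \<ominus>\<^bsub>M\<^esub> \<zero>\<^bsub>M\<^esub> = x"
    "x \<in> carrier M \<Longrightarrow> \<ominus>\<^bsub>M\<^esub> (\<ominus>\<^bsub>M\<^esub> x) = x"
    "\<ominus>\<^bsub>M\<^esub> \<zero>\<^bsub>M\<^esub> = \<zero>\<^bsub>M\<^esub>"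
    "r \<in> carrier R \<Longrightarrow> x \<in> carrier M \<Longrightarrow> r \<odot>\<^bsub>M\<^esub> x \<in> carrier M"
    "r \<in> carrier R \<Longrightarrow> r \<odot>\<^bsub>M\<^esub> \<zero>\<^bsub>M\<^esub> = \<zero>\<^bsub>M\<^esub>"
    "r \<in> carrier R \<Longrightarrow> x \<in> carrier M \<Longrightarrow> y \<in> carrier M \<Longrightarrow>
       r \<odot>\<^bsub>M\<^esub> (x \<oplus>\<^bsub>M\<^esub> y) = r \<odot>\<^bsub>M\<^esub> x \<oplus>\<^bsub>M\<^esub> r \<odot>\<^bsub>M\<^esub> y"
    "r \<in> carrier R \<Longrightarrow> x \<in> carrier M \<Longrightarrow> r \<odot>\<^bsub>M\<^esub> (\<ominus>\<^bsub>M\<^esub> x) = \<ominus>\<^bsub>M\<^esub> (r \<odot>\<^bsub>M\<^esub> x)"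
    "r \<in> carrier R \<Longrightarrow> x \<in> carrier M \<Longrightarrow> y \<in> carrier M \<Longrightarrow>
       r \<odot>\<^bsub>M\<^esub> (x \<ominus>\<^bsub>M\<^esub> y) = r \<odot>\<^bsub>M\<^esub> x \<ominus>\<^bsub>M\<^esub> r \<odot>\<^bsub>M\<^esub> y"
  by (auto simp: smult_r_distr smult_r_minus a_minus_def M.abelian_group_axioms)

lemmas module_simps = module.module_arith

lemma module_hom_simps:
  assumes "\<phi> \<in> module_hom B M N" "Module.module B M" "Module.module B N"
  shows "\<phi> \<zero>\<^bsub>M\<^esub> = \<zero>\<^bsub>N\<^esub>"
    and "x \<in> carrier M \<Longrightarrow> \<phi> (\<ominus>\<^bsub>M\<^esub> x) = \<ominus>\<^bsub>N\<^esub> \<phi> x"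
    and "x \<in> carrier M \<Longrightarrow> y \<in> carrier M \<Longrightarrow> \<phi> (x \<ominus>\<^bsub>M\<^esub> y) = \<phi> x \<ominus>\<^bsub>N\<^esub> \<phi> y"
proof -
  interpret M: abelian_group M using assms by (simp add: module_def)
  interpret N: abelian_group N using assms by (simp add: module_def)
  interpret abelian_group_hom M N \<phi>
    by (rule abelian_group_homI)
      (use assms M.abelian_group_axioms N.abelian_group_axioms in
        \<open>auto simp: module_hom_def group_hom_def group_hom_axioms_def hom_def M.a_group N.a_group\<close>)
  show "\<phi> \<zero>\<^bsub>M\<^esub> = \<zero>\<^bsub>N\<^esub>" by simp
  show *: "\<phi> (\<ominus>\<^bsub>M\<^esub> x) = \<ominus>\<^bsub>N\<^esub> \<phi> x" if "x \<in> carrier M" for x using that by simp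
  show "x \<in> carrier M \<Longrightarrow> y \<in> carrier M \<Longrightarrow> \<phi> (x \<ominus>\<^bsub>M\<^esub> y) = \<phi> x \<ominus>\<^bsub>N\<^esub> \<phi> y"
    by (simp add: a_minus_def *)
qed

lemma module_hom_comp:
  "\<phi> \<in> module_hom B M N \<Longrightarrow> \<psi> \<in> module_hom B N P \<Longrightarrow> (\<lambda>x. \<psi> (\<phi> x)) \<in> module_hom B M P"
  by (auto simp: module_hom_def Pi_iff)

lemma module_hom_id: "(\<lambda>x. x) \<in> module_hom B M M"
  by (auto simp: module_hom_def)

lemma module_hom_zero: "Module.module B N \<Longrightarrow> (\<lambda>x. \<zero>\<^bsub>N\<^esub>) \<in> module_hom B M N"
  by (auto simp: module_hom_def module_simps)

lemma module_hom_add: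
  assumes "\<phi> \<in> module_hom B M N" "\<psi> \<in> module_hom B M N" "Module.module B N"
  shows "(\<lambda>x. \<phi> x \<oplus>\<^bsub>N\<^esub> \<psi> x) \<in> module_hom B M N"
proof -
  interpret Module.module B N by fact
  show ?thesis using assms(1,2)
    by (auto intro!: module_homI simp: module_homD smult_r_distr M.add.m_ac)
qed

lemma module_hom_minus:
  assumes "\<phi> \<in> module_hom B M N" "Module.module B N"
  shows "(\<lambda>x. \<ominus>\<^bsub>N\<^esub> \<phi> x) \<in> module_hom B M N"
proof -
  interpret Module.module B N by fact
  show ?thesis using assms(1)
    by (auto intro!: module_homI simp: module_homD smult_r_minus M.minus_add)
qed

lemma module_hom_diff:
  assumes "\<phi> \<in> module_hom B M N" "\<psi> \<in> module_hom B M N" "Module.module B N"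
  shows "(\<lambda>x. \<phi> x \<ominus>\<^bsub>N\<^esub> \<psi> x) \<in> module_hom B M N"
  unfolding a_minus_def by (intro module_hom_add module_hom_minus assms)

lemma module_hom_smult:
  assumes "\<phi> \<in> module_hom B M N" "Module.module B N" "r \<in> carrier B"
  shows "(\<lambda>x. r \<odot>\<^bsub>N\<^esub> \<phi> x) \<in> module_hom B M N"
proof -
  interpret Module.module B N by fact
  show ?thesis using assms(1,3)
    by (auto intro!: module_homI simp: module_homD smult_r_distr smult_assoc1[symmetric] R.m_comm)
qed

lemma module_hom_signed:
  "\<phi> \<in> module_hom B M N \<Longrightarrow> Module.module B N \<Longrightarrow> (\<lambda>x. signed N n (\<phi> x)) \<in> module_hom B M N"
  by (cases "even n") (auto simp: signed_def intro: module_hom_minus)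

section \<open>Finitely generated projective modules\<close>

text \<open>The values lie in the ring \<open>B\<close>, which carries no scalar multiplication as a
  record, so \<open>module_hom\<close> cannot express this.\<close>

definition functional :: "('b, 'c) ring_scheme \<Rightarrow> ('b, 'm, 'd) module_scheme \<Rightarrow> ('m \<Rightarrow> 'b) \<Rightarrow> bool" where
  "functional B M \<xi> \<longleftrightarrow> \<xi> \<in> carrier M \<rightarrow> carrier B \<and>
     (\<forall>x\<in>carrier M. \<forall>y\<in>carrier M. \<xi> (x \<oplus>\<^bsub>M\<^esub> y) = \<xi> x \<oplus>\<^bsub>B\<^esub> \<xi> y) \<and>
     (\<forall>r\<in>carrier B. \<forall>x\<in>carrier M. \<xi> (r \<odot>\<^bsub>M\<^esub> x) = r \<otimes>\<^bsub>B\<^esub> \<xi> x)"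

fun lin_comb :: "('b, 'n, 'e) module_scheme \<Rightarrow> (('m \<Rightarrow> 'b) \<times> 'n) list \<Rightarrow> 'm \<Rightarrow> 'n" where
  "lin_comb N [] x = \<zero>\<^bsub>N\<^esub>"
| "lin_comb N (p # l) x = fst p x \<odot>\<^bsub>N\<^esub> snd p \<oplus>\<^bsub>N\<^esub> lin_comb N l x"

text \<open>The data of a dual basis: a list of pairs of a functional and a vector, encoding a map
  that factors through a free module of finite rank. Finitely generated projective modules are those
  whose identity arises in this way. A list can be concatenated for direct sums and consumed entry
  by entry in inductions.\<close>

definition dual_system ::
  "('b, 'c) ring_scheme \<Rightarrow> ('b, 'm, 'd) module_scheme \<Rightarrow> ('b, 'n, 'e) module_scheme
    \<Rightarrow> (('m \<Rightarrow> 'b) \<times> 'n) list \<Rightarrow> bool" where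
  "dual_system B M N l \<longleftrightarrow> (\<forall>p\<in>set l. functional B M (fst p) \<and> snd p \<in> carrier N)"

lemma dual_system_simps [simp]:
  "dual_system B M N []"
  "dual_system B M N (p # l) \<longleftrightarrow> functional B M (fst p) \<and> snd p \<in> carrier N \<and> dual_system B M N l"
  "dual_system B M N (l @ l') \<longleftrightarrow> dual_system B M N l \<and> dual_system B M N l'"
  by (auto simp: dual_system_def)

lemma functionalD:
  assumes "functional B M \<xi>" "x \<in> carrier M"
  shows "\<xi> x \<in> carrier B"
    and "y \<in> carrier M \<Longrightarrow> \<xi> (x \<oplus>\<^bsub>M\<^esub> y) = \<xi> x \<oplus>\<^bsub>B\<^esub> \<xi> y"
    and "r \<in> carrier B \<Longrightarrow> \<xi> (r \<odot>\<^bsub>M\<^esub> x) = r \<otimes>\<^bsub>B\<^esub> \<xi> x"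
  using assms by (auto simp: functional_def)

lemma module_hom_functional:
  assumes "functional B M \<xi>" "Module.module B N" "e \<in> carrier N"
  shows "(\<lambda>x. \<xi> x \<odot>\<^bsub>N\<^esub> e) \<in> module_hom B M N"
proof -
  interpret Module.module B N by fact
  show ?thesis using assms(1,3)
    by (auto intro!: module_homI simp: functionalD smult_l_distr smult_assoc1)
qed

lemma lin_comb_hom:
  assumes "dual_system B M N l" "Module.module B N"
  shows "lin_comb N l \<in> module_hom B M N"
  using assms
proof (induction l)
  case Nil
  then show ?case by (auto intro!: module_homI simp: module_simps)
next
  case (Cons p l)
  then have "(\<lambda>x. fst p x \<odot>\<^bsub>N\<^esub> snd p \<oplus>\<^bsub>N\<^esub> lin_comb N l x) \<in> module_hom B M N"
    by (intro module_hom_add module_hom_functional) auto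
  moreover have "lin_comb N (p # l) = (\<lambda>x. fst p x \<odot>\<^bsub>N\<^esub> snd p \<oplus>\<^bsub>N\<^esub> lin_comb N l x)"
    by (rule ext) simp
  ultimately show ?case by simp
qed

lemma lin_comb_append:
  assumes "dual_system B M N l" "dual_system B M N l'" "Module.module B N" "x \<in> carrier M"
  shows "lin_comb N (l @ l') x = lin_comb N l x \<oplus>\<^bsub>N\<^esub> lin_comb N l' x"
  using assms(1)
proof (induction l)
  case Nil
  then show ?case using module_homD(1)[OF lin_comb_hom[OF assms(2,3)] assms(4)] assms(3)
    by (simp add: module_simps)
next
  case (Cons p l)
  interpret Module.module B N by fact
  show ?case
    using Cons.IH Cons.prems module_homD(1)[OF lin_comb_hom[OF _ assms(3)] assms(4), of l]
      module_homD(1)[OF lin_comb_hom[OF assms(2,3)] assms(4)] functionalD(1)[OF _ assms(4), of B "fst p"]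
    by (simp add: M.add.m_assoc)
qed

lemma lin_comb_map:
  assumes "dual_system B M N l" "Module.module B N" "Module.module B P" "\<psi> \<in> module_hom B N P" "\<phi> x \<in> carrier M"
  shows "\<psi> (lin_comb N l (\<phi> x)) = lin_comb P (map (\<lambda>p. (\<lambda>x. fst p (\<phi> x), \<psi> (snd p))) l) x"
  using assms(1)
proof (induction l)
  case Nil
  then show ?case using assms by (simp add: module_hom_simps)
next
  case (Cons p l)
  then show ?case
    using assms module_homD(1)[OF lin_comb_hom[OF _ assms(2)] assms(5)]
    by (auto simp: module_homD functionalD module_simps)
qed

lemma dual_system_map:
  assumes "dual_system B M N l" "\<psi> \<in> module_hom B N P" "\<phi> \<in> module_hom B M' M"
  shows "dual_system B M' P (map (\<lambda>p. (\<lambda>x. fst p (\<phi> x), \<psi> (snd p))) l)"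
  using assms by (auto simp: dual_system_def functional_def module_homD Pi_iff)

section \<open>Coordinates on free modules and the dual basis criterion\<close>

lemma free_module_module:
  assumes "cring B"
  shows "Module.module B (free_module B n)"
proof -
  interpret cring B by fact
  show ?thesis
  proof (rule moduleI)
    show "abelian_group (free_module B n)"
    proof (rule abelian_groupI)
      fix x assume x: "x \<in> carrier (free_module B n)"
      show "\<exists>y\<in>carrier (free_module B n). y \<oplus>\<^bsub>free_module B n\<^esub> x = \<zero>\<^bsub>free_module B n\<^esub>"
        using x by (intro bexI[of _ "\<lambda>i\<in>{..<n}. \<ominus>\<^bsub>B\<^esub> x i"])
          (auto simp: free_module_def PiE_iff l_neg intro!: restrict_ext)
      show "\<zero>\<^bsub>free_module B n\<^esub> \<oplus>\<^bsub>free_module B n\<^esub> x = x"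
        using x by (auto simp: free_module_def PiE_iff extensional_def fun_eq_iff)
    qed (auto simp: free_module_def PiE_iff a_ac intro!: restrict_ext)
    fix x assume "x \<in> carrier (free_module B n)"
    then show "\<one>\<^bsub>B\<^esub> \<odot>\<^bsub>free_module B n\<^esub> x = x"
      by (auto simp: free_module_def PiE_iff extensional_def fun_eq_iff)
  qed (auto simp: free_module_def PiE_iff l_distr r_distr m_assoc intro!: restrict_ext assms)
qed

lemma functional_coordinate:
  "i < n \<Longrightarrow> functional B (free_module B n) (\<lambda>y. y i)"
  by (auto simp: functional_def free_module_def)

text \<open>The functionals are the coordinates of the section into the free module, and the vectors
  are the images of the unit vectors under the retraction.\<close>

lemma fg_projectiveI:
  assumes "cring B" "Module.module B P" "dual_system B P P l" "\<And>x. x \<in> carrier P \<Longrightarrow> lin_comb P l x = x"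
  shows "fg_projective B P"
proof -
  define n where "n = length l"
  define s where "s x = (\<lambda>i\<in>{..<n}. fst (l ! i) x)" for x
  define l' :: "(((nat \<Rightarrow> 'a) \<Rightarrow> 'a) \<times> 'c) list" where "l' = map (\<lambda>i. (\<lambda>y. y i, snd (l ! i))) [0..<n]"
  have \<xi>: "functional B P (fst (l ! i))" if "i < n" for i
    using assms(3) that unfolding dual_system_def n_def by simp
  have "s \<in> module_hom B P (free_module B n)"
    by (rule module_homI) (auto simp: s_def free_module_def functionalD[OF \<xi>] intro!: restrict_ext)
  moreover have "lin_comb P l' \<in> module_hom B (free_module B n) P"
    using assms(2,3) by (intro lin_comb_hom)
      (auto simp: l'_def dual_system_def n_def functional_coordinate)
  moreover have "lin_comb P l' (s x) = x" if "x \<in> carrier P" for x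
  proof -
    \<comment> \<open>Stated for an arbitrary list of indices so that induction applies; the list
      \<open>[0..<n]\<close> gives the claim.\<close>
    have "lin_comb P (map (\<lambda>i. (\<lambda>y. y i, snd (l ! i))) is) (s x) = lin_comb P (map ((!) l) is) x"
      if "set is \<subseteq> {..<n}" for "is"
      using that by (induction "is") (auto simp: s_def)
    from this[of "[0..<n]"] show ?thesis
      using assms(4)[OF that] by (simp add: l'_def n_def map_nth atLeast0LessThan)
  qed
  ultimately show ?thesis
    using assms(2) by (auto simp: fg_projective_def)
qed

definition unit_vector :: "('b, 'c) ring_scheme \<Rightarrow> nat \<Rightarrow> nat \<Rightarrow> nat \<Rightarrow> 'b" where
  "unit_vector B n i = (\<lambda>j\<in>{..<n}. if j = i then \<one>\<^bsub>B\<^esub> else \<zero>\<^bsub>B\<^esub>)"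

definition coordinates :: "((nat \<Rightarrow> 'b) \<Rightarrow> 'm) \<Rightarrow> ('b, 'c) ring_scheme \<Rightarrow> nat \<Rightarrow> nat \<Rightarrow> (((nat \<Rightarrow> 'b) \<Rightarrow> 'b) \<times> 'm) list" where
  "coordinates p B n k = map (\<lambda>i. (\<lambda>y. y i, p (unit_vector B n i))) [0..<k]"

text \<open>The k-th partial sum of the expansion of \<open>y\<close> in unit vectors. It makes that
  expansion accessible to induction on \<open>k\<close> at fixed rank \<open>n\<close>; for
  \<open>k = n\<close> it is \<open>y\<close>.\<close>

definition truncated :: "('b, 'c) ring_scheme \<Rightarrow> nat \<Rightarrow> nat \<Rightarrow> (nat \<Rightarrow> 'b) \<Rightarrow> nat \<Rightarrow> 'b" where
  "truncated B n k y = (\<lambda>i\<in>{..<n}. if i < k then y i else \<zero>\<^bsub>B\<^esub>)"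

lemma unit_vector_closed: "cring B \<Longrightarrow> unit_vector B n i \<in> carrier (free_module B n)"
  using ring.ring_simprules(2,6)[of B] by (auto simp: unit_vector_def free_module_def cring_def)

lemma truncated_closed:
  assumes "cring B" "y \<in> carrier (free_module B n)"
  shows "truncated B n k y \<in> carrier (free_module B n)"
proof -
  interpret R: cring B by fact
  have "y i \<in> carrier B" if "i < n" for i using assms(2) that by (auto simp: free_module_def)
  then show ?thesis by (simp add: truncated_def free_module_def restrict_PiE_iff)
qed

lemma dual_system_coordinates:
  assumes "cring B" "p \<in> module_hom B (free_module B n) P" "k \<le> n"
  shows "dual_system B (free_module B n) P (coordinates p B n k)"
  using assms module_homD(1)[OF assms(2) unit_vector_closed[OF assms(1)]]
  by (auto simp: coordinates_def dual_system_def functional_coordinate)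

lemma truncated_Suc:
  assumes "cring B" "k < n" "y \<in> carrier (free_module B n)"
  shows "truncated B n k y \<oplus>\<^bsub>free_module B n\<^esub> y k \<odot>\<^bsub>free_module B n\<^esub> unit_vector B n k
     = truncated B n (Suc k) y"
proof (rule ext)
  fix i
  interpret R: cring B by fact
  have "i < n \<Longrightarrow> y i \<in> carrier B" "y k \<in> carrier B"
    using assms(2,3) by (auto simp: free_module_def)
  then show "(truncated B n k y \<oplus>\<^bsub>free_module B n\<^esub> y k \<odot>\<^bsub>free_module B n\<^esub> unit_vector B n k) i
     = truncated B n (Suc k) y i"
    using assms(2) by (cases "i = k") (auto simp: truncated_def unit_vector_def free_module_def)
qed

lemma lin_comb_coordinates:
  assumes "cring B" "Module.module B P" "p \<in> module_hom B (free_module B n) P" "y \<in> carrier (free_module B n)"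
    and "k \<le> n"
  shows "lin_comb P (coordinates p B n k) y = p (truncated B n k y)"
  using assms(5)
proof (induction k)
  case 0
  have "truncated B n 0 y = \<zero>\<^bsub>free_module B n\<^esub>"
    by (simp add: free_module_def truncated_def)
  then show ?case
    using module_hom_simps(1)[OF assms(3) free_module_module[OF assms(1)] assms(2)]
    by (simp add: coordinates_def)
next
  case (Suc k)
  note dual = dual_system_coordinates[OF assms(1,3)]
  note u = unit_vector_closed[OF assms(1), of n k]
  have yk: "y k \<in> carrier B" using assms(4) Suc.prems by (simp add: free_module_def PiE_iff)
  have Suc_k: "coordinates p B n (Suc k) = coordinates p B n k @ [(\<lambda>y. y k, p (unit_vector B n k))]"
    by (simp add: coordinates_def)
  have "lin_comb P (coordinates p B n (Suc k)) y =
      lin_comb P (coordinates p B n k) y \<oplus>\<^bsub>P\<^esub> lin_comb P [(\<lambda>y. y k, p (unit_vector B n k))] y"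
    using dual[OF Suc.prems] assms(2,4) unfolding Suc_k dual_system_simps(3)
    by (intro lin_comb_append) blast+
  also have "lin_comb P [(\<lambda>y. y k, p (unit_vector B n k))] y
      = p (y k \<odot>\<^bsub>free_module B n\<^esub> unit_vector B n k)"
    unfolding module_homD(3)[OF assms(3) yk u]
    using yk assms(2) module_homD(1)[OF assms(3) u] by (simp add: module_simps)
  also have "lin_comb P (coordinates p B n k) y = p (truncated B n k y)"
    by (rule Suc.IH) (use Suc.prems in simp)
  also have "p (truncated B n k y) \<oplus>\<^bsub>P\<^esub> p (y k \<odot>\<^bsub>free_module B n\<^esub> unit_vector B n k)
      = p (truncated B n (Suc k) y)"
    using module_homD(2)[OF assms(3) truncated_closed[OF assms(1,4)]
        module.smult_closed[OF free_module_module[OF assms(1)] yk u], of k]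
      truncated_Suc[OF assms(1) _ assms(4)] Suc.prems by simp
  finally show ?case .
qed

text \<open>The standard dual basis of the free module, pulled back along the section and pushed
  forward along the retraction.\<close>

lemma fg_projectiveD:
  assumes "cring B" "fg_projective B P"
  obtains l where "dual_system B P P l" "\<And>x. x \<in> carrier P \<Longrightarrow> lin_comb P l x = x"
proof -
  from assms(2) obtain n s p where P: "Module.module B P" and s: "s \<in> module_hom B P (free_module B n)"
    and p: "p \<in> module_hom B (free_module B n) P" and ps: "\<And>x. x \<in> carrier P \<Longrightarrow> p (s x) = x"
    by (auto simp: fg_projective_def)
  let ?l' = "map (\<lambda>p. (\<lambda>x. fst p (s x), snd p)) (coordinates p B n n)"
  note d = dual_system_coordinates[OF assms(1) p order_refl]
  show thesis
  proof
    show "dual_system B P P ?l'"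
      by (rule dual_system_map[OF d module_hom_id s])
    fix x assume x: "x \<in> carrier P"
    note sx = module_homD(1)[OF s x]
    have "truncated B n n (s x) = s x"
      using sx by (auto simp: truncated_def free_module_def PiE_iff extensional_def fun_eq_iff)
    then show "lin_comb P ?l' x = x"
      using lin_comb_map[of B "free_module B n" P _ P "\<lambda>x. x" s x, OF d P P module_hom_id sx]
        lin_comb_coordinates[OF assms(1) P p sx order_refl] ps[OF x] by simp
  qed
qed

lemma fg_projective_retract:
  assumes "cring B" "fg_projective B P" "Module.module B Q"
    and "s \<in> module_hom B Q P" "p \<in> module_hom B P Q" "\<And>x. x \<in> carrier Q \<Longrightarrow> p (s x) = x"
  shows "fg_projective B Q"
proof -
  have P: "Module.module B P" using assms(2) by (simp add: fg_projective_def)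
  obtain n s' p' where "s' \<in> module_hom B P (free_module B n)"
    "p' \<in> module_hom B (free_module B n) P" "\<And>x. x \<in> carrier P \<Longrightarrow> p' (s' x) = x"
    using assms(2) by (auto simp: fg_projective_def)
  then show ?thesis
    unfolding fg_projective_def using assms(3)
      module_hom_comp[OF assms(4), of s'] module_hom_comp[OF _ assms(5), of p'] assms(6)
      module_homD(1)[OF assms(4)]
    by (auto intro!: exI[of _ n] bexI[of _ "\<lambda>x. s' (s x)"] bexI[of _ "\<lambda>y. p (p' y)"])
qed

section \<open>Direct sums\<close>

lemma direct_sum_carrierI:
  assumes "\<And>j. j \<in> J \<Longrightarrow> g j \<in> carrier (M j)" "finite {j\<in>J. g j \<noteq> \<zero>\<^bsub>M j\<^esub>}"
  shows "Family (\<lambda>j\<in>J. g j) \<in> carrier (direct_sum J M)"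
proof -
  have "{j\<in>J. (\<lambda>j\<in>J. g j) j \<noteq> \<zero>\<^bsub>M j\<^esub>} = {j\<in>J. g j \<noteq> \<zero>\<^bsub>M j\<^esub>}" by auto
  then show ?thesis using assms by (simp add: direct_sum_def restrict_PiE_iff)
qed

lemma direct_sum_carrierE:
  assumes "z \<in> carrier (direct_sum J M)"
  obtains x where "z = Family x" "x \<in> extensional J" "\<And>j. j \<in> J \<Longrightarrow> x j \<in> carrier (M j)"
    "finite {j\<in>J. x j \<noteq> \<zero>\<^bsub>M j\<^esub>}"
  using assms by (auto simp: direct_sum_def PiE_def)

lemma direct_sum_closed:
  "z \<in> carrier (direct_sum J M) \<Longrightarrow> j \<in> J \<Longrightarrow> component z j \<in> carrier (M j)"
  by (elim direct_sum_carrierE) auto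

lemma direct_sum_finite:
  "z \<in> carrier (direct_sum J M) \<Longrightarrow> finite {j\<in>J. component z j \<noteq> \<zero>\<^bsub>M j\<^esub>}"
  by (elim direct_sum_carrierE) auto

lemma direct_sum_eqI:
  assumes "z \<in> carrier (direct_sum J M)" "w \<in> carrier (direct_sum J M)"
    and "\<And>j. j \<in> J \<Longrightarrow> component z j = component w j"
  shows "z = w"
proof -
  obtain x where "z = Family x" "x \<in> extensional J" using assms(1) by (rule direct_sum_carrierE)
  moreover obtain y where "w = Family y" "y \<in> extensional J" using assms(2) by (rule direct_sum_carrierE)
  ultimately show ?thesis using assms(3) by (auto intro: extensionalityI)
qed

lemma direct_sum_simps:
  "component (z \<oplus>\<^bsub>direct_sum J M\<^esub> w) = (\<lambda>j\<in>J. component z j \<oplus>\<^bsub>M j\<^esub> component w j)"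
  "component \<zero>\<^bsub>direct_sum J M\<^esub> = (\<lambda>j\<in>J. \<zero>\<^bsub>M j\<^esub>)"
  "component (r \<odot>\<^bsub>direct_sum J M\<^esub> z) = (\<lambda>j\<in>J. r \<odot>\<^bsub>M j\<^esub> component z j)"
  by (auto simp: direct_sum_def)

lemma direct_sum_module:
  assumes "cring B" "\<And>j. j \<in> J \<Longrightarrow> Module.module B (M j)"
  shows "Module.module B (direct_sum J M)"
proof -
  note ms = module_simps[OF assms(2)]
  note closed = direct_sum_closed[of _ J M]
  have add: "z \<oplus>\<^bsub>direct_sum J M\<^esub> w \<in> carrier (direct_sum J M)"
    if "z \<in> carrier (direct_sum J M)" "w \<in> carrier (direct_sum J M)" for z w
  proof -
    have "{j\<in>J. component z j \<oplus>\<^bsub>M j\<^esub> component w j \<noteq> \<zero>\<^bsub>M j\<^esub>}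
       \<subseteq> {j\<in>J. component z j \<noteq> \<zero>\<^bsub>M j\<^esub>} \<union> {j\<in>J. component w j \<noteq> \<zero>\<^bsub>M j\<^esub>}"
      using ms(2,6) by auto
    then have "Family (\<lambda>j\<in>J. component z j \<oplus>\<^bsub>M j\<^esub> component w j) \<in> carrier (direct_sum J M)"
      using that ms(3) closed
      by (intro direct_sum_carrierI) (auto intro: finite_subset direct_sum_finite)
    then show ?thesis by (simp add: direct_sum_def)
  qed
  have zero: "\<zero>\<^bsub>direct_sum J M\<^esub> \<in> carrier (direct_sum J M)"
    using direct_sum_carrierI[of J "\<lambda>j. \<zero>\<^bsub>M j\<^esub>" M] ms(2) by (simp add: direct_sum_def)
  have smult: "r \<odot>\<^bsub>direct_sum J M\<^esub> z \<in> carrier (direct_sum J M)"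
    if "r \<in> carrier B" "z \<in> carrier (direct_sum J M)" for r z
  proof -
    have "{j\<in>J. r \<odot>\<^bsub>M j\<^esub> component z j \<noteq> \<zero>\<^bsub>M j\<^esub>} \<subseteq> {j\<in>J. component z j \<noteq> \<zero>\<^bsub>M j\<^esub>}"
      using ms(12) that by auto
    then have "Family (\<lambda>j\<in>J. r \<odot>\<^bsub>M j\<^esub> component z j) \<in> carrier (direct_sum J M)"
      using that ms(11) closed
      by (intro direct_sum_carrierI) (auto intro: finite_subset direct_sum_finite)
    then show ?thesis by (simp add: direct_sum_def)
  qed
  show ?thesis
  proof (rule moduleI)
    show "abelian_group (direct_sum J M)"
    proof (rule abelian_groupI)
      fix x assume x: "x \<in> carrier (direct_sum J M)"
      let ?y = "Family (\<lambda>j\<in>J. \<ominus>\<^bsub>M j\<^esub> component x j)"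
      have "{j\<in>J. \<ominus>\<^bsub>M j\<^esub> component x j \<noteq> \<zero>\<^bsub>M j\<^esub>} \<subseteq> {j\<in>J. component x j \<noteq> \<zero>\<^bsub>M j\<^esub>}"
        using ms(10) by auto
      then have y: "?y \<in> carrier (direct_sum J M)"
        using x ms(5) closed
        by (intro direct_sum_carrierI) (auto intro: finite_subset direct_sum_finite)
      moreover have "?y \<oplus>\<^bsub>direct_sum J M\<^esub> x = \<zero>\<^bsub>direct_sum J M\<^esub>"
        by (rule direct_sum_eqI[OF add[OF y x] zero])
          (simp add: direct_sum_simps abelian_group.l_neg[OF ms(1)] closed[OF x])
      ultimately show "\<exists>y\<in>carrier (direct_sum J M). y \<oplus>\<^bsub>direct_sum J M\<^esub> x = \<zero>\<^bsub>direct_sum J M\<^esub>"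
        by blast
    next
      fix x y z assume xyz: "x \<in> carrier (direct_sum J M)" "y \<in> carrier (direct_sum J M)"
        "z \<in> carrier (direct_sum J M)"
      show "x \<oplus>\<^bsub>direct_sum J M\<^esub> y \<oplus>\<^bsub>direct_sum J M\<^esub> z = x \<oplus>\<^bsub>direct_sum J M\<^esub> (y \<oplus>\<^bsub>direct_sum J M\<^esub> z)"
        by (rule direct_sum_eqI[of _ J M])
          (auto simp: direct_sum_simps abelian_groupE(3)[OF ms(1)] closed add xyz)
    next
      fix x y assume xy: "x \<in> carrier (direct_sum J M)" "y \<in> carrier (direct_sum J M)"
      show "x \<oplus>\<^bsub>direct_sum J M\<^esub> y = y \<oplus>\<^bsub>direct_sum J M\<^esub> x"
        by (rule direct_sum_eqI[OF add[OF xy] add[OF xy(2,1)]])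
          (simp add: direct_sum_simps abelian_groupE(4)[OF ms(1)] closed xy)
    next
      fix x assume x: "x \<in> carrier (direct_sum J M)"
      show "\<zero>\<^bsub>direct_sum J M\<^esub> \<oplus>\<^bsub>direct_sum J M\<^esub> x = x"
        by (rule direct_sum_eqI[OF add[OF zero x] x])
          (simp add: direct_sum_simps closed[OF x] ms)
    qed (use add zero in auto)
  next
    fix a b x assume abx: "a \<in> carrier B" "b \<in> carrier B" "x \<in> carrier (direct_sum J M)"
    have ab: "a \<oplus>\<^bsub>B\<^esub> b \<in> carrier B" "a \<otimes>\<^bsub>B\<^esub> b \<in> carrier B"
      using abx assms(1) by (auto simp: cring_def ring.ring_simprules(1,5))
    show "(a \<oplus>\<^bsub>B\<^esub> b) \<odot>\<^bsub>direct_sum J M\<^esub> x = a \<odot>\<^bsub>direct_sum J M\<^esub> x \<oplus>\<^bsub>direct_sum J M\<^esub> b \<odot>\<^bsub>direct_sum J M\<^esub> x"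
      by (rule direct_sum_eqI[OF smult[OF ab(1) abx(3)] add[OF smult[OF abx(1,3)] smult[OF abx(2,3)]]])
        (simp add: direct_sum_simps module.smult_l_distr[OF assms(2)] abx closed)
    show "(a \<otimes>\<^bsub>B\<^esub> b) \<odot>\<^bsub>direct_sum J M\<^esub> x = a \<odot>\<^bsub>direct_sum J M\<^esub> (b \<odot>\<^bsub>direct_sum J M\<^esub> x)"
      by (rule direct_sum_eqI[OF smult[OF ab(2) abx(3)] smult[OF abx(1) smult[OF abx(2,3)]]])
        (simp add: direct_sum_simps module.smult_assoc1[OF assms(2)] abx closed)
  next
    fix a x y assume axy: "a \<in> carrier B" "x \<in> carrier (direct_sum J M)" "y \<in> carrier (direct_sum J M)"
    show "a \<odot>\<^bsub>direct_sum J M\<^esub> (x \<oplus>\<^bsub>direct_sum J M\<^esub> y)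
        = a \<odot>\<^bsub>direct_sum J M\<^esub> x \<oplus>\<^bsub>direct_sum J M\<^esub> a \<odot>\<^bsub>direct_sum J M\<^esub> y"
      by (rule direct_sum_eqI[OF smult[OF axy(1) add[OF axy(2,3)]] add[OF smult[OF axy(1,2)] smult[OF axy(1,3)]]])
        (simp add: direct_sum_simps module.smult_r_distr[OF assms(2)] axy closed)
  next
    fix x assume x: "x \<in> carrier (direct_sum J M)"
    have one: "\<one>\<^bsub>B\<^esub> \<in> carrier B" using assms(1) by (simp add: cring_def ring.ring_simprules(6))
    show "\<one>\<^bsub>B\<^esub> \<odot>\<^bsub>direct_sum J M\<^esub> x = x"
      by (rule direct_sum_eqI[OF smult[OF one x] x])
        (simp add: direct_sum_simps module.smult_one[OF assms(2)] x closed)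
  qed (use assms(1) smult in auto)
qed

lemma component_hom: "j \<in> J \<Longrightarrow> (\<lambda>z. component z j) \<in> module_hom B (direct_sum J M) (M j)"
  by (auto intro!: module_homI simp: direct_sum_closed direct_sum_simps)

lemma direct_sum_homI:
  assumes "\<And>j. j \<in> J \<Longrightarrow> g j \<in> module_hom B N (M j)"
    and "\<And>x. x \<in> carrier N \<Longrightarrow> finite {j\<in>J. g j x \<noteq> \<zero>\<^bsub>M j\<^esub>}"
  shows "(\<lambda>x. Family (\<lambda>j\<in>J. g j x)) \<in> module_hom B N (direct_sum J M)"
  using assms
  by (intro module_homI direct_sum_carrierI)
    (auto simp: module_homD[OF assms(1)] direct_sum_def intro!: restrict_ext)

text \<open>The index set may be infinite, but only finitely many summands are nonzero. Their dual
  bases, transported along projections and inclusions, are concatenated.\<close>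

lemma fg_projective_direct_sum:
  assumes "cring B" "\<And>j. j \<in> J \<Longrightarrow> fg_projective B (M j)"
    and "finite {j\<in>J. carrier (M j) \<noteq> {\<zero>\<^bsub>M j\<^esub>}}"
  shows "fg_projective B (direct_sum J M)"
proof -
  define F where "F = {j\<in>J. carrier (M j) \<noteq> {\<zero>\<^bsub>M j\<^esub>}}"
  have mod: "Module.module B (M j)" if "j \<in> J" for j
    using assms(2)[OF that] by (simp add: fg_projective_def)
  have modS: "Module.module B (direct_sum J M)" by (rule direct_sum_module[OF assms(1) mod])
  define inc where "inc j x = Family (\<lambda>i\<in>J. if i = j then x else \<zero>\<^bsub>M i\<^esub>)" for j x
  have inc: "inc j \<in> module_hom B (M j) (direct_sum J M)" if "j \<in> J" for j
    unfolding inc_def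
  proof (rule direct_sum_homI)
    fix i assume "i \<in> J"
    then show "(\<lambda>x. if i = j then x else \<zero>\<^bsub>M i\<^esub>) \<in> module_hom B (M j) (M i)"
      using mod by (cases "i = j") (auto intro: module_hom_id module_hom_zero)
  next
    fix x
    have "{i\<in>J. (if i = j then x else \<zero>\<^bsub>M i\<^esub>) \<noteq> \<zero>\<^bsub>M i\<^esub>} \<subseteq> {j}" by auto
    then show "finite {i\<in>J. (if i = j then x else \<zero>\<^bsub>M i\<^esub>) \<noteq> \<zero>\<^bsub>M i\<^esub>}"
      by (rule finite_subset) simp
  qed
  have "\<exists>l. dual_system B (M j) (M j) l \<and> (\<forall>x\<in>carrier (M j). lin_comb (M j) l x = x)" if "j \<in> J" for j
    using fg_projectiveD[OF assms(1) assms(2)[OF that]] by metis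
  then obtain l where l: "\<And>j. j \<in> J \<Longrightarrow> dual_system B (M j) (M j) (l j)"
    "\<And>j x. j \<in> J \<Longrightarrow> x \<in> carrier (M j) \<Longrightarrow> lin_comb (M j) (l j) x = x"
    by metis
  \<comment> \<open>The system collected for \<open>G\<close> realises the operator that keeps the
    components in \<open>G\<close> and kills the others. On the set of nonzero summands this
    operator is the identity.\<close>
  have "\<exists>L. dual_system B (direct_sum J M) (direct_sum J M) L \<and>
     (\<forall>z\<in>carrier (direct_sum J M). lin_comb (direct_sum J M) L z
        = Family (\<lambda>i\<in>J. if i \<in> G then component z i else \<zero>\<^bsub>M i\<^esub>))" if "finite G" "G \<subseteq> J" for G
    using that
  proof (induction G)
    case empty
    show ?case by (rule exI[of _ "[]"]) (auto simp: direct_sum_def restrict_def)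
  next
    case (insert j G)
    have "G \<subseteq> J" using insert.prems by simp
    then obtain L where L: "dual_system B (direct_sum J M) (direct_sum J M) L"
      "\<And>z. z\<in>carrier (direct_sum J M) \<Longrightarrow> lin_comb (direct_sum J M) L z
        = Family (\<lambda>i\<in>J. if i \<in> G then component z i else \<zero>\<^bsub>M i\<^esub>)" using insert.IH by blast
    have j: "j \<in> J" using insert by simp
    let ?L = "map (\<lambda>p. (\<lambda>x. fst p (component x j), inc j (snd p))) (l j)"
    have D: "dual_system B (direct_sum J M) (direct_sum J M) ?L"
      by (rule dual_system_map[OF l(1)[OF j] inc[OF j], where \<phi> = "\<lambda>x. component x j"])
        (rule component_hom[OF j])
    have "lin_comb (direct_sum J M) (?L @ L) z
        = Family (\<lambda>i\<in>J. if i \<in> insert j G then component z i else \<zero>\<^bsub>M i\<^esub>)"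
      if z: "z \<in> carrier (direct_sum J M)" for z
    proof -
      have "lin_comb (direct_sum J M) ?L z = inc j (component z j)"
        using lin_comb_map[of B "M j" "M j" "l j" "direct_sum J M" "inc j" "\<lambda>z. component z j" z]
          l[OF j] mod[OF j] modS inc[OF j] direct_sum_closed[OF z j] by simp
      then have "lin_comb (direct_sum J M) (?L @ L) z = inc j (component z j)
          \<oplus>\<^bsub>direct_sum J M\<^esub> Family (\<lambda>i\<in>J. if i \<in> G then component z i else \<zero>\<^bsub>M i\<^esub>)"
        using lin_comb_append[OF D L(1) modS z] L(2)[OF z] by simp
      also have "\<dots> = Family (\<lambda>i\<in>J. if i \<in> insert j G then component z i else \<zero>\<^bsub>M i\<^esub>)"
        using insert(2) direct_sum_closed[OF z] module_simps[OF mod]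
        by (auto simp: direct_sum_def inc_def intro!: restrict_ext)
      finally show ?thesis .
    qed
    then show ?case using D L(1) by (intro exI[of _ "?L @ L"]) auto
  qed
  from this[OF assms(3)[folded F_def]] obtain L where L: "dual_system B (direct_sum J M) (direct_sum J M) L"
    "\<And>z. z\<in>carrier (direct_sum J M) \<Longrightarrow> lin_comb (direct_sum J M) L z
        = Family (\<lambda>i\<in>J. if i \<in> F then component z i else \<zero>\<^bsub>M i\<^esub>)"
    unfolding F_def by blast
  show ?thesis
  proof (rule fg_projectiveI[OF assms(1) modS L(1)])
    fix z assume z: "z \<in> carrier (direct_sum J M)"
    have fin: "finite {i\<in>J. (if i \<in> F then component z i else \<zero>\<^bsub>M i\<^esub>) \<noteq> \<zero>\<^bsub>M i\<^esub>}"
      by (rule finite_subset[OF _ assms(3)]) (auto simp: F_def)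
    have z0: "component z i = \<zero>\<^bsub>M i\<^esub>" if "i \<in> J" "i \<notin> F" for i
      using direct_sum_closed[OF z that(1)] that by (auto simp: F_def)
    have "Family (\<lambda>i\<in>J. if i \<in> F then component z i else \<zero>\<^bsub>M i\<^esub>) = z"
      by (rule direct_sum_eqI[OF direct_sum_carrierI[OF _ fin] z])
        (simp_all add: z0 direct_sum_closed[OF z] module_simps(2)[OF mod])
    then show "lin_comb (direct_sum J M) L z = z" using L(2)[OF z] by simp
  qed
qed

lemma direct_sum_trivial:
  assumes "\<And>j. j \<in> J \<Longrightarrow> carrier (M j) = {\<zero>\<^bsub>M j\<^esub>}"
  shows "carrier (direct_sum J M) = {\<zero>\<^bsub>direct_sum J M\<^esub>}"
proof -
  have "\<zero>\<^bsub>direct_sum J M\<^esub> \<in> carrier (direct_sum J M)"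
    using direct_sum_carrierI[of J "\<lambda>j. \<zero>\<^bsub>M j\<^esub>" M] assms by (simp add: direct_sum_def)
  moreover have "z = \<zero>\<^bsub>direct_sum J M\<^esub>" if "z \<in> carrier (direct_sum J M)" for z
    by (rule direct_sum_eqI[OF that calculation]) (use direct_sum_closed[OF that] assms in \<open>simp add: direct_sum_simps\<close>)
  ultimately show ?thesis by blast
qed

section \<open>The homotopy category of dg modules\<close>

lemma kdg_modD:
  assumes "E \<in> kdg_mod B f"
  shows "Module.module B (cmp E i)"
    and "dif E i \<in> module_hom B (cmp E i) (cmp E (i + 1))"
    and "hty E i \<in> module_hom B (cmp E i) (cmp E (i - 1))"
    and "x \<in> carrier (cmp E i) \<Longrightarrow> dif E (i + 1) (dif E i x) = \<zero>\<^bsub>cmp E (i + 2)\<^esub>"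
    and "x \<in> carrier (cmp E i) \<Longrightarrow> hty E (i - 1) (hty E i x) = \<zero>\<^bsub>cmp E (i - 2)\<^esub>"
    and "x \<in> carrier (cmp E i) \<Longrightarrow>
      dif E (i - 1) (hty E i x) \<oplus>\<^bsub>cmp E i\<^esub> hty E (i + 1) (dif E i x) = f \<odot>\<^bsub>cmp E i\<^esub> x"
  using assms by (auto simp: kdg_mod_def)

lemma kdg_modI:
  assumes "\<And>i. Module.module B (cmp E i)"
    and "\<And>i. dif E i \<in> module_hom B (cmp E i) (cmp E (i + 1))"
    and "\<And>i. hty E i \<in> module_hom B (cmp E i) (cmp E (i - 1))"
    and "\<And>i x. x \<in> carrier (cmp E i) \<Longrightarrow> dif E (i + 1) (dif E i x) = \<zero>\<^bsub>cmp E (i + 2)\<^esub>"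
    and "\<And>i x. x \<in> carrier (cmp E i) \<Longrightarrow> hty E (i - 1) (hty E i x) = \<zero>\<^bsub>cmp E (i - 2)\<^esub>"
    and "\<And>i x. x \<in> carrier (cmp E i) \<Longrightarrow>
      dif E (i - 1) (hty E i x) \<oplus>\<^bsub>cmp E i\<^esub> hty E (i + 1) (dif E i x) = f \<odot>\<^bsub>cmp E i\<^esub> x"
  shows "E \<in> kdg_mod B f"
  using assms by (auto simp: kdg_mod_def)

text \<open>In the last two clauses the degree is a variable with an equation, so that they match
  whatever form an index such as \<open>i - 1 + 1\<close> takes. The same device recurs in later
  lemmas.\<close>

lemma kdg_closed:
  assumes "E \<in> kdg_mod B f" "x \<in> carrier (cmp E i)"
  shows "dif E i x \<in> carrier (cmp E (i + 1))" "hty E i x \<in> carrier (cmp E (i - 1))"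
    "j = i - 1 \<Longrightarrow> dif E j (hty E i x) \<in> carrier (cmp E i)"
    "j = i + 1 \<Longrightarrow> hty E j (dif E i x) \<in> carrier (cmp E i)"
  using module_homD(1)[OF kdg_modD(2)[OF assms(1)]] module_homD(1)[OF kdg_modD(3)[OF assms(1)]] assms(2)
  by (fastforce, fastforce, force, force)

lemma kdg_simps:
  assumes "E \<in> kdg_mod B f"
  shows "dif E i \<zero>\<^bsub>cmp E i\<^esub> = \<zero>\<^bsub>cmp E (i + 1)\<^esub>" "hty E i \<zero>\<^bsub>cmp E i\<^esub> = \<zero>\<^bsub>cmp E (i - 1)\<^esub>"
    "x \<in> carrier (cmp E i) \<Longrightarrow> dif E i (\<ominus>\<^bsub>cmp E i\<^esub> x) = \<ominus>\<^bsub>cmp E (i + 1)\<^esub> dif E i x"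
    "x \<in> carrier (cmp E i) \<Longrightarrow> hty E i (\<ominus>\<^bsub>cmp E i\<^esub> x) = \<ominus>\<^bsub>cmp E (i - 1)\<^esub> hty E i x"
    "x \<in> carrier (cmp E i) \<Longrightarrow> y \<in> carrier (cmp E i) \<Longrightarrow>
       dif E i (x \<oplus>\<^bsub>cmp E i\<^esub> y) = dif E i x \<oplus>\<^bsub>cmp E (i + 1)\<^esub> dif E i y"
    "x \<in> carrier (cmp E i) \<Longrightarrow> y \<in> carrier (cmp E i) \<Longrightarrow>
       hty E i (x \<oplus>\<^bsub>cmp E i\<^esub> y) = hty E i x \<oplus>\<^bsub>cmp E (i - 1)\<^esub> hty E i y"
    "x \<in> carrier (cmp E i) \<Longrightarrow> y \<in> carrier (cmp E i) \<Longrightarrow>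
       dif E i (x \<ominus>\<^bsub>cmp E i\<^esub> y) = dif E i x \<ominus>\<^bsub>cmp E (i + 1)\<^esub> dif E i y"
    "x \<in> carrier (cmp E i) \<Longrightarrow> y \<in> carrier (cmp E i) \<Longrightarrow>
       hty E i (x \<ominus>\<^bsub>cmp E i\<^esub> y) = hty E i x \<ominus>\<^bsub>cmp E (i - 1)\<^esub> hty E i y"
    "r \<in> carrier B \<Longrightarrow> x \<in> carrier (cmp E i) \<Longrightarrow> dif E i (r \<odot>\<^bsub>cmp E i\<^esub> x) = r \<odot>\<^bsub>cmp E (i + 1)\<^esub> dif E i x"
    "r \<in> carrier B \<Longrightarrow> x \<in> carrier (cmp E i) \<Longrightarrow> hty E i (r \<odot>\<^bsub>cmp E i\<^esub> x) = r \<odot>\<^bsub>cmp E (i - 1)\<^esub> hty E i x"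
proof -
  note d = module_hom_simps[OF kdg_modD(2,1,1)[OF assms]] module_homD[OF kdg_modD(2)[OF assms]]
  note h = module_hom_simps[OF kdg_modD(3,1,1)[OF assms]] module_homD[OF kdg_modD(3)[OF assms]]
  show "dif E i \<zero>\<^bsub>cmp E i\<^esub> = \<zero>\<^bsub>cmp E (i + 1)\<^esub>" "hty E i \<zero>\<^bsub>cmp E i\<^esub> = \<zero>\<^bsub>cmp E (i - 1)\<^esub>"
    "x \<in> carrier (cmp E i) \<Longrightarrow> dif E i (\<ominus>\<^bsub>cmp E i\<^esub> x) = \<ominus>\<^bsub>cmp E (i + 1)\<^esub> dif E i x"
    "x \<in> carrier (cmp E i) \<Longrightarrow> hty E i (\<ominus>\<^bsub>cmp E i\<^esub> x) = \<ominus>\<^bsub>cmp E (i - 1)\<^esub> hty E i x"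
    "x \<in> carrier (cmp E i) \<Longrightarrow> y \<in> carrier (cmp E i) \<Longrightarrow>
       dif E i (x \<oplus>\<^bsub>cmp E i\<^esub> y) = dif E i x \<oplus>\<^bsub>cmp E (i + 1)\<^esub> dif E i y"
    "x \<in> carrier (cmp E i) \<Longrightarrow> y \<in> carrier (cmp E i) \<Longrightarrow>
       hty E i (x \<oplus>\<^bsub>cmp E i\<^esub> y) = hty E i x \<oplus>\<^bsub>cmp E (i - 1)\<^esub> hty E i y"
    "x \<in> carrier (cmp E i) \<Longrightarrow> y \<in> carrier (cmp E i) \<Longrightarrow>
       dif E i (x \<ominus>\<^bsub>cmp E i\<^esub> y) = dif E i x \<ominus>\<^bsub>cmp E (i + 1)\<^esub> dif E i y"
    "x \<in> carrier (cmp E i) \<Longrightarrow> y \<in> carrier (cmp E i) \<Longrightarrow>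
       hty E i (x \<ominus>\<^bsub>cmp E i\<^esub> y) = hty E i x \<ominus>\<^bsub>cmp E (i - 1)\<^esub> hty E i y"
    "r \<in> carrier B \<Longrightarrow> x \<in> carrier (cmp E i) \<Longrightarrow> dif E i (r \<odot>\<^bsub>cmp E i\<^esub> x) = r \<odot>\<^bsub>cmp E (i + 1)\<^esub> dif E i x"
    "r \<in> carrier B \<Longrightarrow> x \<in> carrier (cmp E i) \<Longrightarrow> hty E i (r \<odot>\<^bsub>cmp E i\<^esub> x) = r \<odot>\<^bsub>cmp E (i - 1)\<^esub> hty E i x"
    by (rule d(1), rule h(1), erule d(2), erule h(2), erule (1) d(5), erule (1) h(5),
        erule (1) d(3), erule (1) h(3), erule (1) d(6), erule (1) h(6))
qed

lemma kdg_square: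
  assumes "E \<in> kdg_mod B f" "x \<in> carrier (cmp E i)"
  shows "j = i + 1 \<Longrightarrow> dif E j (dif E i x) = \<zero>\<^bsub>cmp E (j + 1)\<^esub>"
    and "j = i - 1 \<Longrightarrow> hty E j (hty E i x) = \<zero>\<^bsub>cmp E (j - 1)\<^esub>"
  using kdg_modD(4,5)[OF assms] by (simp_all add: add.commute)

section \<open>Closed morphisms of degree zero\<close>

lemma minus_eq_zero_iff:
  assumes "Module.module B M" "a \<in> carrier M" "b \<in> carrier M"
  shows "a \<ominus>\<^bsub>M\<^esub> b = \<zero>\<^bsub>M\<^esub> \<longleftrightarrow> a = b"
proof -
  note M = module_abelian_group[OF assms(1)]
  have 1: "a = b \<oplus>\<^bsub>M\<^esub> (a \<ominus>\<^bsub>M\<^esub> b)"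
    by (rule lin_eqI[OF M], (rule lin_rules | (rule lin_atom, (simp add: assms; fail)))+, simp)
  have 2: "b \<ominus>\<^bsub>M\<^esub> b = \<zero>\<^bsub>M\<^esub>"
    by (rule lin_eqI[OF M], (rule lin_rules | (rule lin_atom, (simp add: assms; fail)))+, simp)
  show ?thesis using 1 2 module_simps(7)[OF assms(1,3)] by auto
qed

text \<open>In degree 0 all signs disappear, and a cocycle is a family of linear maps commuting with
  both d and h.\<close>

lemma cocyclesI:
  assumes F: "F \<in> kdg_mod B f" and \<phi>: "\<And>i. \<phi> i \<in> module_hom B (cmp E i) (cmp F i)"
    and "\<And>i x. x \<in> carrier (cmp E i) \<Longrightarrow> \<phi> (i - 1) (hty E i x) = hty F i (\<phi> i x)"
    and "\<And>i x. x \<in> carrier (cmp E i) \<Longrightarrow> \<phi> (i + 1) (dif E i x) = dif F i (\<phi> i x)"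
  shows "\<phi> \<in> cocycles B E F"
  unfolding cocycles_def dg_hom_def dg_diff_def signed_def
  using assms(2-) minus_eq_zero_iff[OF kdg_modD(1)[OF F]]
    kdg_closed(1)[OF F module_homD(1)[OF \<phi>]] by simp

lemma cocyclesD:
  assumes "E \<in> kdg_mod B f" "F \<in> kdg_mod B f" "\<phi> \<in> cocycles B E F"
  shows "\<phi> i \<in> module_hom B (cmp E i) (cmp F i)"
    and "x \<in> carrier (cmp E i) \<Longrightarrow> j = i - 1 \<Longrightarrow> \<phi> j (hty E i x) = hty F i (\<phi> i x)"
    and "x \<in> carrier (cmp E i) \<Longrightarrow> j = i + 1 \<Longrightarrow> \<phi> j (dif E i x) = dif F i (\<phi> i x)"
proof -
  show 1: "\<phi> i \<in> module_hom B (cmp E i) (cmp F i)" for i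
    using assms(3) by (simp add: cocycles_def dg_hom_def)
  show "x \<in> carrier (cmp E i) \<Longrightarrow> j = i - 1 \<Longrightarrow> \<phi> j (hty E i x) = hty F i (\<phi> i x)"
    using assms(3) by (simp add: cocycles_def dg_hom_def signed_def)
  assume x: "x \<in> carrier (cmp E i)" and j: "j = i + 1"
  have "dif F i (\<phi> i x) \<ominus>\<^bsub>cmp F (i + 1)\<^esub> \<phi> (i + 1) (dif E i x) = \<zero>\<^bsub>cmp F (i + 1)\<^esub>"
    using assms(3) x by (simp add: cocycles_def dg_diff_def signed_def)
  then show "\<phi> j (dif E i x) = dif F i (\<phi> i x)"
    using minus_eq_zero_iff[OF kdg_modD(1)[OF assms(2)] kdg_closed(1)[OF assms(2) module_homD(1)[OF 1 x]]
        module_homD(1)[OF 1 kdg_closed(1)[OF assms(1) x]]] j by simp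
qed

lemma cocycles_closed:
  "E \<in> kdg_mod B f \<Longrightarrow> F \<in> kdg_mod B f \<Longrightarrow> \<phi> \<in> cocycles B E F \<Longrightarrow> x \<in> carrier (cmp E i)
    \<Longrightarrow> \<phi> i x \<in> carrier (cmp F i)"
  by (rule module_homD(1)[OF cocyclesD(1)])

lemma cocycles_id: "E \<in> kdg_mod B f \<Longrightarrow> (\<lambda>i x. x) \<in> cocycles B E E"
  by (rule cocyclesI) (auto intro: module_hom_id)

lemma cocycles_comp:
  assumes "E \<in> kdg_mod B f" "F \<in> kdg_mod B f" "G \<in> kdg_mod B f"
    and "\<phi> \<in> cocycles B E F" "\<psi> \<in> cocycles B F G"
  shows "(\<lambda>i x. \<psi> i (\<phi> i x)) \<in> cocycles B E G"
  by (rule cocyclesI[OF assms(3) module_hom_comp[OF cocyclesD(1)[OF assms(1,2,4)] cocyclesD(1)[OF assms(2,3,5)]]])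
    (simp_all add: cocyclesD(2,3)[OF assms(1,2,4)] cocyclesD(2,3)[OF assms(2,3,5)]
      cocycles_closed[OF assms(1,2,4)])

lemma cocycles_zero:
  assumes "E \<in> kdg_mod B f" "F \<in> kdg_mod B f"
  shows "(\<lambda>i x. \<zero>\<^bsub>cmp F i\<^esub>) \<in> cocycles B E F"
  by (rule cocyclesI[OF assms(2)])
    (auto simp: kdg_simps[OF assms(2)] intro!: module_hom_zero kdg_modD(1)[OF assms(2)])

text \<open>The degree -1 part of the complex \<open>dg_hom\<close> with its sign resolved:
  \<epsilon> and the map are both odd, so they anticommute.\<close>

definition graded_hom ::
  "('b, 'c) ring_scheme \<Rightarrow> ('b, 'm) kdg \<Rightarrow> ('b, 'm) kdg \<Rightarrow> (int \<Rightarrow> 'm \<Rightarrow> 'm) \<Rightarrow> bool" where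
  "graded_hom B E F s \<longleftrightarrow> (\<forall>i. s i \<in> module_hom B (cmp E i) (cmp F (i - 1)) \<and>
     (\<forall>x\<in>carrier (cmp E i). s (i - 1) (hty E i x) = \<ominus>\<^bsub>cmp F (i - 2)\<^esub> hty F (i - 1) (s i x)))"

text \<open>For degree -1 the sign in \<open>dg_diff\<close> turns the commutator with the
  differential into the familiar d s + s d.\<close>

lemma homotopic_iff:
  assumes "E \<in> kdg_mod B f" "F \<in> kdg_mod B f"
  shows "homotopic B E F \<phi> \<psi> \<longleftrightarrow> (\<exists>s. graded_hom B E F s \<and> (\<forall>i. \<forall>x\<in>carrier (cmp E i).
    \<phi> i x = \<psi> i x \<oplus>\<^bsub>cmp F i\<^esub> (dif F (i - 1) (s i x) \<oplus>\<^bsub>cmp F i\<^esub> s (i + 1) (dif E i x))))"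
proof -
  have 1: "s \<in> dg_hom B E F (- 1) \<longleftrightarrow> graded_hom B E F s" for s
    by (simp add: dg_hom_def graded_hom_def signed_def)
  have "dg_diff E F (- 1) s i x = dif F (i - 1) (s i x) \<oplus>\<^bsub>cmp F i\<^esub> s (i + 1) (dif E i x)"
    if "graded_hom B E F s" "x \<in> carrier (cmp E i)" for s i x
  proof -
    have "s (i + 1) \<in> module_hom B (cmp E (i + 1)) (cmp F (i + 1 - 1))"
      using that(1) unfolding graded_hom_def by blast
    from module_homD(1)[OF this kdg_closed(1)[OF assms(1) that(2)]]
    show ?thesis
      using module_simps(9)[OF kdg_modD(1)[OF assms(2)]] by (simp add: dg_diff_def signed_def a_minus_def)
  qed
  then show ?thesis
    unfolding homotopic_def 1 Bex_def by (metis (no_types, lifting))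
qed

lemma homotopicE:
  assumes "E \<in> kdg_mod B f" "F \<in> kdg_mod B f" "homotopic B E F \<phi> \<psi>"
  obtains s where "graded_hom B E F s" "\<forall>i. \<forall>x\<in>carrier (cmp E i).
    \<phi> i x = \<psi> i x \<oplus>\<^bsub>cmp F i\<^esub> (dif F (i - 1) (s i x) \<oplus>\<^bsub>cmp F i\<^esub> s (i + 1) (dif E i x))"
proof -
  from assms(3)[unfolded homotopic_iff[OF assms(1,2)]]
  obtain s where s: "graded_hom B E F s \<and> (\<forall>i. \<forall>x\<in>carrier (cmp E i).
    \<phi> i x = \<psi> i x \<oplus>\<^bsub>cmp F i\<^esub> (dif F (i - 1) (s i x) \<oplus>\<^bsub>cmp F i\<^esub> s (i + 1) (dif E i x)))"
    by (rule exE)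
  show thesis by (rule that[of s]) (use s in simp_all)
qed

lemma homotopic_refl:
  assumes "E \<in> kdg_mod B f" "F \<in> kdg_mod B f" "\<phi> \<in> cocycles B E F"
  shows "homotopic B E F \<phi> \<phi>"
  unfolding homotopic_iff[OF assms(1,2)]
proof (intro exI conjI allI ballI)
  show "graded_hom B E F (\<lambda>i x. \<zero>\<^bsub>cmp F (i - 1)\<^esub>)"
    using module_simps(10)[OF kdg_modD(1)[OF assms(2)]] kdg_simps(2)[OF assms(2)]
    by (auto simp: graded_hom_def intro!: module_hom_zero kdg_modD(1)[OF assms(2)])
  fix i x assume "x \<in> carrier (cmp E i)"
  then show "\<phi> i x = \<phi> i x \<oplus>\<^bsub>cmp F i\<^esub> (dif F (i - 1) \<zero>\<^bsub>cmp F (i - 1)\<^esub> \<oplus>\<^bsub>cmp F i\<^esub> \<zero>\<^bsub>cmp F (i + 1 - 1)\<^esub>)"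
    using kdg_simps(1)[OF assms(2), of "i - 1"] module_simps(2,6,7)[OF kdg_modD(1)[OF assms(2), of i]]
      cocycles_closed[OF assms] by simp
qed

lemma graded_homD:
  assumes "E \<in> kdg_mod B f" "F \<in> kdg_mod B f" "graded_hom B E F s"
  shows "s i \<in> module_hom B (cmp E i) (cmp F (i - 1))"
    and "x \<in> carrier (cmp E i) \<Longrightarrow> j = i - 1 \<Longrightarrow> s j (hty E i x) = \<ominus>\<^bsub>cmp F (i - 2)\<^esub> hty F (i - 1) (s i x)"
    and "x \<in> carrier (cmp E i) \<Longrightarrow> dif F (i - 1) (s i x) \<in> carrier (cmp F i)"
    and "x \<in> carrier (cmp E i) \<Longrightarrow> s (i + 1) (dif E i x) \<in> carrier (cmp F i)"
    and "x \<in> carrier (cmp E i) \<Longrightarrow> s i x \<in> carrier (cmp F (i - 1))"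
proof -
  show 1: "s i \<in> module_hom B (cmp E i) (cmp F (i - 1))" for i
    using assms(3) by (simp add: graded_hom_def)
  show "x \<in> carrier (cmp E i) \<Longrightarrow> j = i - 1 \<Longrightarrow> s j (hty E i x) = \<ominus>\<^bsub>cmp F (i - 2)\<^esub> hty F (i - 1) (s i x)"
    using assms(3) by (simp add: graded_hom_def)
  show c: "x \<in> carrier (cmp E i) \<Longrightarrow> s i x \<in> carrier (cmp F (i - 1))"
    by (rule module_homD(1)[OF 1])
  then show "x \<in> carrier (cmp E i) \<Longrightarrow> dif F (i - 1) (s i x) \<in> carrier (cmp F i)"
    using kdg_closed(1)[OF assms(2), of "s i x" "i - 1"] by simp
  show "x \<in> carrier (cmp E i) \<Longrightarrow> s (i + 1) (dif E i x) \<in> carrier (cmp F i)"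
    using module_homD(1)[OF 1 kdg_closed(1)[OF assms(1)]] by simp
qed

lemma homotopic_sym:
  assumes "E \<in> kdg_mod B f" "F \<in> kdg_mod B f" "\<phi> \<in> cocycles B E F" "\<psi> \<in> cocycles B E F"
    and "homotopic B E F \<phi> \<psi>"
  shows "homotopic B E F \<psi> \<phi>"
proof -
  obtain s where s: "graded_hom B E F s" and eq0: "\<forall>i. \<forall>x\<in>carrier (cmp E i).
    \<phi> i x = \<psi> i x \<oplus>\<^bsub>cmp F i\<^esub> (dif F (i - 1) (s i x) \<oplus>\<^bsub>cmp F i\<^esub> s (i + 1) (dif E i x))"
    by (rule homotopicE[OF assms(1,2,5)])
  note eq = eq0[rule_format]
  note sD = graded_homD[OF assms(1,2) s]
  note mF = kdg_modD(1)[OF assms(2)]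
  show ?thesis
    unfolding homotopic_iff[OF assms(1,2)]
  proof (intro exI conjI allI ballI)
    show "graded_hom B E F (\<lambda>i x. \<ominus>\<^bsub>cmp F (i - 1)\<^esub> s i x)"
      using sD(2) kdg_simps(4)[OF assms(2) sD(5)]
      by (auto simp: graded_hom_def intro!: module_hom_minus sD(1) mF)
    fix i x assume x: "x \<in> carrier (cmp E i)"
    have "dif F (i - 1) (\<ominus>\<^bsub>cmp F (i - 1)\<^esub> s i x) = \<ominus>\<^bsub>cmp F i\<^esub> dif F (i - 1) (s i x)"
      using kdg_simps(3)[OF assms(2) sD(5)[OF x]] by simp
    then show "\<psi> i x = \<phi> i x \<oplus>\<^bsub>cmp F i\<^esub> (dif F (i - 1) (\<ominus>\<^bsub>cmp F (i - 1)\<^esub> s i x)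
        \<oplus>\<^bsub>cmp F i\<^esub> \<ominus>\<^bsub>cmp F (i + 1 - 1)\<^esub> s (i + 1) (dif E i x))"
      unfolding eq[OF x] using sD(3,4)[OF x] cocycles_closed[OF assms(1,2,4) x]
      by simp (rule lin_eqI[OF module_abelian_group[OF mF]],
          (rule lin_rules | (rule lin_atom, (simp; fail)))+, simp)
  qed
qed

lemma homotopic_trans:
  assumes "E \<in> kdg_mod B f" "F \<in> kdg_mod B f" "\<chi> \<in> cocycles B E F"
    and "homotopic B E F \<phi> \<psi>" "homotopic B E F \<psi> \<chi>"
  shows "homotopic B E F \<phi> \<chi>"
proof -
  obtain s where s: "graded_hom B E F s" and eq0: "\<forall>i. \<forall>x\<in>carrier (cmp E i).
    \<phi> i x = \<psi> i x \<oplus>\<^bsub>cmp F i\<^esub> (dif F (i - 1) (s i x) \<oplus>\<^bsub>cmp F i\<^esub> s (i + 1) (dif E i x))"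
    by (rule homotopicE[OF assms(1,2,4)])
  note eq = eq0[rule_format]
  obtain t where t: "graded_hom B E F t" and eq'0: "\<forall>i. \<forall>x\<in>carrier (cmp E i).
    \<psi> i x = \<chi> i x \<oplus>\<^bsub>cmp F i\<^esub> (dif F (i - 1) (t i x) \<oplus>\<^bsub>cmp F i\<^esub> t (i + 1) (dif E i x))"
    by (rule homotopicE[OF assms(1,2,5)])
  note eq' = eq'0[rule_format]
  note sD = graded_homD[OF assms(1,2) s] and tD = graded_homD[OF assms(1,2) t]
  note mF = kdg_modD(1)[OF assms(2)]
  show ?thesis
    unfolding homotopic_iff[OF assms(1,2)]
  proof (intro exI conjI allI ballI)
    have "\<ominus>\<^bsub>cmp F i\<^esub> a \<oplus>\<^bsub>cmp F i\<^esub> \<ominus>\<^bsub>cmp F i\<^esub> b = \<ominus>\<^bsub>cmp F i\<^esub> (a \<oplus>\<^bsub>cmp F i\<^esub> b)"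
      if "a \<in> carrier (cmp F i)" "b \<in> carrier (cmp F i)" for a b i
      using abelian_group.minus_add[OF module_abelian_group[OF mF] that] by simp
    then show "graded_hom B E F (\<lambda>i x. s i x \<oplus>\<^bsub>cmp F (i - 1)\<^esub> t i x)"
      using sD(2) tD(2) kdg_simps(6)[OF assms(2) sD(5) tD(5)]
        kdg_closed(2)[OF assms(2) sD(5)] kdg_closed(2)[OF assms(2) tD(5)]
      by (auto simp: graded_hom_def intro!: module_hom_add sD(1) tD(1) mF)
    fix i x assume x: "x \<in> carrier (cmp E i)"
    have "dif F (i - 1) (s i x \<oplus>\<^bsub>cmp F (i - 1)\<^esub> t i x) = dif F (i - 1) (s i x) \<oplus>\<^bsub>cmp F i\<^esub> dif F (i - 1) (t i x)"
      using kdg_simps(5)[OF assms(2) sD(5)[OF x] tD(5)[OF x]] by simp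
    then show "\<phi> i x = \<chi> i x \<oplus>\<^bsub>cmp F i\<^esub> (dif F (i - 1) (s i x \<oplus>\<^bsub>cmp F (i - 1)\<^esub> t i x)
        \<oplus>\<^bsub>cmp F i\<^esub> (s (i + 1) (dif E i x) \<oplus>\<^bsub>cmp F (i + 1 - 1)\<^esub> t (i + 1) (dif E i x)))"
      unfolding eq[OF x] eq'[OF x] using sD(3,4)[OF x] tD(3,4)[OF x] cocycles_closed[OF assms(1,2,3) x]
      by simp (rule lin_eqI[OF module_abelian_group[OF mF]],
          (rule lin_rules | (rule lin_atom, (simp; fail)))+, simp)
  qed
qed

lemma homotopic_comp_left:
  assumes "E \<in> kdg_mod B f" "F \<in> kdg_mod B f" "G \<in> kdg_mod B f"
    and \<psi>: "\<psi> \<in> cocycles B E F" and \<chi>: "\<chi> \<in> cocycles B F G" and "homotopic B E F \<phi> \<psi>"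
  shows "homotopic B E G (\<lambda>i x. \<chi> i (\<phi> i x)) (\<lambda>i x. \<chi> i (\<psi> i x))"
proof -
  obtain s where s: "graded_hom B E F s" and eq0: "\<forall>i. \<forall>x\<in>carrier (cmp E i).
    \<phi> i x = \<psi> i x \<oplus>\<^bsub>cmp F i\<^esub> (dif F (i - 1) (s i x) \<oplus>\<^bsub>cmp F i\<^esub> s (i + 1) (dif E i x))"
    by (rule homotopicE[OF assms(1,2,6)])
  note eq = eq0[rule_format]
  note sD = graded_homD[OF assms(1,2) s]
  note \<chi>D = cocyclesD[OF assms(2,3) \<chi>]
  note mF = kdg_modD(1)[OF assms(2)] and mG = kdg_modD(1)[OF assms(3)]
  show ?thesis
    unfolding homotopic_iff[OF assms(1,3)]
  proof (intro exI conjI allI ballI)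
    show "graded_hom B E G (\<lambda>i x. \<chi> (i - 1) (s i x))"
      unfolding graded_hom_def
    proof (intro allI conjI ballI)
      fix i x assume x: "x \<in> carrier (cmp E i)"
      have "hty F (i - 1) (s i x) \<in> carrier (cmp F (i - 2))"
        using kdg_closed(2)[OF assms(2) sD(5)[OF x]] by simp
      then show "\<chi> (i - 1 - 1) (s (i - 1) (hty E i x)) = \<ominus>\<^bsub>cmp G (i - 2)\<^esub> hty G (i - 1) (\<chi> (i - 1) (s i x))"
        using sD(2)[OF x] \<chi>D(2)[OF sD(5)[OF x]] module_hom_simps(2)[OF \<chi>D(1) mF mG] by simp
    qed (rule module_hom_comp[OF sD(1) \<chi>D(1)])
    fix i x assume x: "x \<in> carrier (cmp E i)"
    show "\<chi> i (\<phi> i x) = \<chi> i (\<psi> i x) \<oplus>\<^bsub>cmp G i\<^esub> (dif G (i - 1) (\<chi> (i - 1) (s i x))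
        \<oplus>\<^bsub>cmp G i\<^esub> \<chi> (i + 1 - 1) (s (i + 1) (dif E i x)))"
      unfolding eq[OF x] using sD(3,4)[OF x] cocycles_closed[OF assms(1,2,4) x]
        \<chi>D(3)[OF sD(5)[OF x], of i] module_homD(2)[OF \<chi>D(1)] module_simps(3)[OF mF]
      by simp
  qed
qed

lemma homotopic_comp_right:
  assumes "E \<in> kdg_mod B f" "F \<in> kdg_mod B f" "G \<in> kdg_mod B f"
    and \<chi>: "\<chi> \<in> cocycles B E F" and "homotopic B F G \<phi> \<psi>"
  shows "homotopic B E G (\<lambda>i x. \<phi> i (\<chi> i x)) (\<lambda>i x. \<psi> i (\<chi> i x))"
proof -
  obtain s where s: "graded_hom B F G s" and eq0: "\<forall>i. \<forall>x\<in>carrier (cmp F i).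
    \<phi> i x = \<psi> i x \<oplus>\<^bsub>cmp G i\<^esub> (dif G (i - 1) (s i x) \<oplus>\<^bsub>cmp G i\<^esub> s (i + 1) (dif F i x))"
    by (rule homotopicE[OF assms(2,3,5)])
  note eq = eq0[rule_format]
  note sD = graded_homD[OF assms(2,3) s]
  note \<chi>D = cocyclesD[OF assms(1,2) \<chi>] and \<chi>c = cocycles_closed[OF assms(1,2) \<chi>]
  show ?thesis
    unfolding homotopic_iff[OF assms(1,3)]
  proof (intro exI conjI allI ballI)
    show "graded_hom B E G (\<lambda>i x. s i (\<chi> i x))"
      unfolding graded_hom_def
      by (intro allI conjI ballI, rule module_hom_comp[OF \<chi>D(1) sD(1)]) (simp add: sD(2) \<chi>D(2) \<chi>c)
    fix i x assume x: "x \<in> carrier (cmp E i)"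
    show "\<phi> i (\<chi> i x) = \<psi> i (\<chi> i x) \<oplus>\<^bsub>cmp G i\<^esub> (dif G (i - 1) (s i (\<chi> i x))
        \<oplus>\<^bsub>cmp G i\<^esub> s (i + 1) (\<chi> (i + 1) (dif E i x)))"
      using eq[OF \<chi>c[OF x]] \<chi>D(3)[OF x, of "i + 1"] by simp
  qed
qed

section \<open>Homotopy classes and their composition\<close>

lemma hclass_eqI:
  assumes "E \<in> kdg_mod B f" "F \<in> kdg_mod B f" "\<phi> \<in> cocycles B E F" "\<psi> \<in> cocycles B E F"
    and "homotopic B E F \<phi> \<psi>"
  shows "hclass B E F \<phi> = hclass B E F \<psi>"
  using homotopic_trans[OF assms(1,2)] homotopic_sym[OF assms(1,2)] assms(3-)
  unfolding hclass_def by blast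

lemma hclass_self:
  "E \<in> kdg_mod B f \<Longrightarrow> F \<in> kdg_mod B f \<Longrightarrow> \<phi> \<in> cocycles B E F \<Longrightarrow> \<phi> \<in> hclass B E F \<phi>"
  by (simp add: hclass_def homotopic_refl)

lemma hclass_cong:
  assumes "E \<in> kdg_mod B f" "F \<in> kdg_mod B f" "\<phi> \<in> cocycles B E F" "\<psi> \<in> cocycles B E F"
    and "\<And>i x. x \<in> carrier (cmp E i) \<Longrightarrow> \<phi> i x = \<psi> i x"
  shows "hclass B E F \<phi> = hclass B E F \<psi>"
proof (rule hclass_eqI[OF assms(1-4)])
  have "homotopic B E F \<psi> \<psi>" by (rule homotopic_refl[OF assms(1,2,4)])
  then show "homotopic B E F \<phi> \<psi>"
    unfolding homotopic_iff[OF assms(1,2)] using assms(5) by simp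
qed

text \<open>Homotopy is a congruence for composition, so the union over all representatives in the
  definition of \<open>H0_cat\<close> is a union of equal classes.\<close>

lemma hclass_comp:
  assumes "E \<in> kdg_mod B f" "F \<in> kdg_mod B f" "G \<in> kdg_mod B f"
    and "\<phi> \<in> cocycles B E F" "\<psi> \<in> cocycles B F G"
  shows "(\<Union>\<phi>\<in>hclass B E F \<phi>. \<Union>\<psi>\<in>hclass B F G \<psi>. hclass B E G (\<lambda>i x. \<psi> i (\<phi> i x)))
    = hclass B E G (\<lambda>i x. \<psi> i (\<phi> i x))"
proof -
  have "hclass B E G (\<lambda>i x. \<psi>' i (\<phi>' i x)) = hclass B E G (\<lambda>i x. \<psi> i (\<phi> i x))"
    if "\<phi>' \<in> hclass B E F \<phi>" "\<psi>' \<in> hclass B F G \<psi>" for \<phi>' \<psi>'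
  proof (rule hclass_eqI[OF assms(1,3)])
    have *: "\<phi>' \<in> cocycles B E F" "homotopic B E F \<phi>' \<phi>" "\<psi>' \<in> cocycles B F G" "homotopic B F G \<psi>' \<psi>"
      using that by (auto simp: hclass_def)
    then show "(\<lambda>i x. \<psi>' i (\<phi>' i x)) \<in> cocycles B E G" "(\<lambda>i x. \<psi> i (\<phi> i x)) \<in> cocycles B E G"
      using assms cocycles_comp[OF assms(1-3)] by auto
    show "homotopic B E G (\<lambda>i x. \<psi>' i (\<phi>' i x)) (\<lambda>i x. \<psi> i (\<phi> i x))"
      by (rule homotopic_trans[OF assms(1,3) cocycles_comp[OF assms]
            homotopic_comp_right[OF assms(1-3) *(1,4)] homotopic_comp_left[OF assms *(2)]])
  qed
  then show ?thesis
    using hclass_self[OF assms(1,2,4)] hclass_self[OF assms(2,3,5)] by blast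
qed

section \<open>Localizations\<close>

lemma zigzag_append:
  "zigzag C S X u Y \<Longrightarrow> zigzag C S Y v Z \<Longrightarrow> zigzag C S X (u @ v) Z"
  by (induction C S X u Y rule: zigzag.induct) auto

lemma zigzag_Obj: "zigzag C S X u Y \<Longrightarrow> X \<in> Obj C \<and> Y \<in> Obj C"
  by (induction C S X u Y rule: zigzag.induct) auto

lemma zigzag_eq_class:
  assumes "zigzag_eq C S X Y u v"
  shows "Collect (zigzag_eq C S X Y u) = Collect (zigzag_eq C S X Y v)"
  using zigzag_eq.sym[OF assms] assms by (blast intro: zigzag_eq.trans)

text \<open>The rule \<open>append\<close> makes the relation a congruence for concatenation, so one
  pair of representatives computes the composite.\<close>

lemma localization_Comp:
  assumes "zigzag C S X u Y" "zigzag C S Y v Z"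
  shows "Comp (localization C S) X Y Z (Collect (zigzag_eq C S Y Z v)) (Collect (zigzag_eq C S X Y u))
    = Collect (zigzag_eq C S X Z (u @ v))"
proof -
  have "zigzag_eq C S X Z (u' @ v') w \<longleftrightarrow> zigzag_eq C S X Z (u @ v) w"
    if "zigzag_eq C S X Y u u'" "zigzag_eq C S Y Z v v'" for u' v' w
    using zigzag_eq_class[OF zigzag_eq.append[OF that]] by blast
  moreover have "zigzag_eq C S X Y u u" "zigzag_eq C S Y Z v v"
    using assms by (auto intro: zigzag_eq.refl)
  ultimately show ?thesis unfolding localization_def by auto
qed

text \<open>With identities as idempotents, the conditions defining morphisms of the idempotent
  completion say that concatenation with the empty zigzag changes nothing. Inverse zigzags therefore
  stay inverse there.\<close>

lemma karoubi_localization_iso: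
  assumes u: "zigzag C S X u Y" and v: "zigzag C S Y v X"
    and uv: "zigzag_eq C S X X (u @ v) []" and vu: "zigzag_eq C S Y Y (v @ u) []"
  shows "is_isomorphism (karoubi (localization C S)) (X, Ident (localization C S) X)
     (Y, Ident (localization C S) Y) (Collect (zigzag_eq C S X Y u))"
proof -
  define L where "L = localization C S"
  define cls where "cls X Y u = Collect (zigzag_eq C S X Y u)" for X Y u
  have XY: "X \<in> Obj L" "Y \<in> Obj L" using zigzag_Obj[OF u] by (auto simp: L_def localization_def)
  have nil: "zigzag C S X [] X" "zigzag C S Y [] Y" using zigzag_Obj[OF u] by auto
  have comp: "Comp L U V W (cls V W w') (cls U V w) = cls U W (w @ w')"
    if "zigzag C S U w V" "zigzag C S V w' W" for U V W w w'
    using localization_Comp[OF that] by (simp add: L_def cls_def)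
  have ident: "Ident L Z = cls Z Z []" for Z
    by (simp add: L_def cls_def localization_def)
  have hom: "cls Z W w \<in> Hom L Z W" if "zigzag C S Z w W" for Z W w
    using that by (auto simp: L_def cls_def localization_def)
  have "cls X X (u @ v) = cls X X []" "cls Y Y (v @ u) = cls Y Y []"
    using zigzag_eq_class[OF uv] zigzag_eq_class[OF vu] by (simp_all add: cls_def)
  then have "is_isomorphism (karoubi L) (X, Ident L X) (Y, Ident L Y) (cls X Y u)"
    unfolding is_isomorphism_def
    using XY comp[OF nil(1) nil(1)] comp[OF nil(2) nil(2)] comp[OF u nil(2)] comp[OF nil(1) u]
      comp[OF v nil(1)] comp[OF nil(2) v] comp[OF u v] comp[OF v u]
      hom[OF u] hom[OF v] hom[OF nil(1)] hom[OF nil(2)]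
    by (auto simp: karoubi_def ident intro!: bexI[of _ "cls Y X v"])
  then show ?thesis by (simp add: L_def cls_def)
qed

lemma zigzag_eq_assoc_cancel:
  assumes "zigzag_eq C S Y Y v []" "zigzag C S X u Y" "zigzag C S Y w Z"
  shows "zigzag_eq C S X Z (u @ v @ w) (u @ w)"
  using zigzag_eq.append[OF zigzag_eq.refl[OF assms(2)] zigzag_eq.append[OF assms(1) zigzag_eq.refl[OF assms(3)]]]
  by simp

section \<open>Inverting zigzags and commuting squares\<close>

fun flip_step :: "('o, 'a) step \<Rightarrow> ('o, 'a) step" where
  "flip_step (Fwd X Y g) = Bwd X Y g"
| "flip_step (Bwd X Y g) = Fwd X Y g"

fun inverted :: "('o \<Rightarrow> 'o \<Rightarrow> 'a set) \<Rightarrow> ('o, 'a) step \<Rightarrow> bool" where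
  "inverted S (Fwd X Y g) = (g \<in> S X Y)"
| "inverted S (Bwd X Y g) = (g \<in> S X Y)"

text \<open>Induction on the first step. In one order the inner loop cancels by induction and then
  the outer pair is left; in the other order the new pair stands in the middle and cancels
  first.\<close>

lemma zigzag_flip:
  assumes "zigzag C S X u Y" "\<forall>s\<in>set u. inverted S s"
  shows "zigzag C S Y (rev (map flip_step u)) X"
    and "zigzag_eq C S X X (u @ rev (map flip_step u)) []"
    and "zigzag_eq C S Y Y (rev (map flip_step u) @ u) []"
proof -
  have "zigzag C S Y (rev (map flip_step u)) X \<and>
    zigzag_eq C S X X (u @ rev (map flip_step u)) [] \<and>
    zigzag_eq C S Y Y (rev (map flip_step u) @ u) []"
    using assms
  proof (induction C S X u Y rule: zigzag.induct)
    case (1 C S X Z)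
    then show ?case by (auto intro: zigzag_eq.refl)
  next
    case (2 C S X U V g w Z)
    then have h: "U = X" "X \<in> Obj C" "V \<in> Obj C" "g \<in> Hom C X V" "g \<in> S X V" "zigzag C S V w Z" by auto
    let ?w = "rev (map flip_step w)"
    have IH: "zigzag C S Z ?w V" "zigzag_eq C S V V (w @ ?w) []" "zigzag_eq C S Z Z (?w @ w) []"
      using 2 by auto
    have f: "zigzag C S X [Fwd X V g] V" "zigzag C S V [Bwd X V g] X"
      "zigzag C S X [Fwd X V g, Bwd X V g] X" "zigzag C S V [Bwd X V g, Fwd X V g] V" using h by auto
    have "zigzag_eq C S X X ([Fwd X V g] @ (w @ ?w) @ [Bwd X V g]) ([Fwd X V g] @ [Bwd X V g])"
      by (rule zigzag_eq_assoc_cancel[OF IH(2) f(1,2)])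
    then have 1: "zigzag_eq C S X X ([Fwd X V g] @ (w @ ?w) @ [Bwd X V g]) []"
      using zigzag_eq.inv_right[OF f(3)] by (auto intro: zigzag_eq.trans)
    have "zigzag_eq C S Z Z (?w @ [Bwd X V g, Fwd X V g] @ w) (?w @ w)"
      by (rule zigzag_eq_assoc_cancel[OF zigzag_eq.inv_left[OF f(4)] IH(1) h(6)])
    then have 2: "zigzag_eq C S Z Z (?w @ [Bwd X V g, Fwd X V g] @ w) []"
      using IH(3) by (rule zigzag_eq.trans)
    show ?case using 1 2 zigzag_append[OF IH(1) f(2)] h(1) by simp
  next
    case (3 C S X U V g w Z)
    then have h: "V = X" "X \<in> Obj C" "U \<in> Obj C" "g \<in> Hom C U X" "g \<in> S U X" "zigzag C S U w Z" by auto
    let ?w = "rev (map flip_step w)"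
    have IH: "zigzag C S Z ?w U" "zigzag_eq C S U U (w @ ?w) []" "zigzag_eq C S Z Z (?w @ w) []"
      using 3 by auto
    have f: "zigzag C S X [Bwd U X g] U" "zigzag C S U [Fwd U X g] X"
      "zigzag C S X [Bwd U X g, Fwd U X g] X" "zigzag C S U [Fwd U X g, Bwd U X g] U" using h by auto
    have "zigzag_eq C S X X ([Bwd U X g] @ (w @ ?w) @ [Fwd U X g]) ([Bwd U X g] @ [Fwd U X g])"
      by (rule zigzag_eq_assoc_cancel[OF IH(2) f(1,2)])
    then have 1: "zigzag_eq C S X X ([Bwd U X g] @ (w @ ?w) @ [Fwd U X g]) []"
      using zigzag_eq.inv_left[OF f(3)] by (auto intro: zigzag_eq.trans)
    have "zigzag_eq C S Z Z (?w @ [Fwd U X g, Bwd U X g] @ w) (?w @ w)"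
      by (rule zigzag_eq_assoc_cancel[OF zigzag_eq.inv_right[OF f(4)] IH(1) h(6)])
    then have 2: "zigzag_eq C S Z Z (?w @ [Fwd U X g, Bwd U X g] @ w) []"
      using IH(3) by (rule zigzag_eq.trans)
    show ?case using 1 2 zigzag_append[OF IH(1) f(2)] h(1) by simp
  qed
  then show "zigzag C S Y (rev (map flip_step u)) X"
    and "zigzag_eq C S X X (u @ rev (map flip_step u)) []"
    and "zigzag_eq C S Y Y (rev (map flip_step u) @ u) []" by auto
qed

lemma zigzag_eq_square_Fwd:
  assumes "zigzag C S X1 [Fwd X1 X2 s, Fwd X2 Y2 b] Y2" "zigzag C S X1 [Fwd X1 Y1 a, Fwd Y1 Y2 t] Y2"
    and "Comp C X1 X2 Y2 b s = Comp C X1 Y1 Y2 t a"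
  shows "zigzag_eq C S X1 Y2 ([Fwd X1 X2 s] @ [Fwd X2 Y2 b]) ([Fwd X1 Y1 a] @ [Fwd Y1 Y2 t])"
  using zigzag_eq.comp[OF assms(1)] zigzag_eq.sym[OF zigzag_eq.comp[OF assms(2)]] assms(3)
  by (auto intro: zigzag_eq.trans)

text \<open>The equation \<open>b s = t a\<close> can be reversed horizontally: insert
  \<open>t\<close> followed by its inverse after \<open>a\<close>, use the square, then cancel the
  inverse of \<open>s\<close> followed by \<open>s\<close>.\<close>

lemma zigzag_eq_square_Bwd:
  assumes "zigzag C S X1 [Fwd X1 X2 s, Fwd X2 Y2 b] Y2" "zigzag C S X1 [Fwd X1 Y1 a, Fwd Y1 Y2 t] Y2"
    and "Comp C X1 X2 Y2 b s = Comp C X1 Y1 Y2 t a" "s \<in> S X1 X2" "t \<in> S Y1 Y2"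
  shows "zigzag_eq C S X2 Y1 ([Bwd X1 X2 s] @ [Fwd X1 Y1 a]) ([Fwd X2 Y2 b] @ [Bwd Y1 Y2 t])"
proof -
  have z: "zigzag C S X2 [Bwd X1 X2 s] X1" "zigzag C S X2 [Bwd X1 X2 s, Fwd X1 X2 s] X2"
    "zigzag C S Y2 [Bwd Y1 Y2 t] Y1" "zigzag C S Y1 [Fwd Y1 Y2 t, Bwd Y1 Y2 t] Y1"
    "zigzag C S X1 [Fwd X1 Y1 a] Y1" "zigzag C S X2 [Fwd X2 Y2 b] Y2"
    "zigzag C S X2 ([Fwd X2 Y2 b] @ [Bwd Y1 Y2 t]) Y1" "zigzag C S X2 [] X2" "zigzag C S Y1 [] Y1"
    "zigzag C S X2 ([Bwd X1 X2 s] @ [Fwd X1 Y1 a]) Y1"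
    using assms(1,2,4,5) by auto
  have 1: "zigzag_eq C S X2 Y1 (([Bwd X1 X2 s] @ [Fwd X1 Y1 a]) @ [Fwd Y1 Y2 t, Bwd Y1 Y2 t] @ [])
      (([Bwd X1 X2 s] @ [Fwd X1 Y1 a]) @ [])"
    by (rule zigzag_eq_assoc_cancel[OF zigzag_eq.inv_right[OF z(4)] z(10,9)])
  have 2: "zigzag_eq C S X2 Y1 ([] @ [Bwd X1 X2 s, Fwd X1 X2 s] @ ([Fwd X2 Y2 b] @ [Bwd Y1 Y2 t]))
      ([] @ ([Fwd X2 Y2 b] @ [Bwd Y1 Y2 t]))"
    by (rule zigzag_eq_assoc_cancel[OF zigzag_eq.inv_left[OF z(2)] z(8,7)])
  have 3: "zigzag_eq C S X2 Y1 ([Bwd X1 X2 s] @ ([Fwd X1 X2 s] @ [Fwd X2 Y2 b]) @ [Bwd Y1 Y2 t])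
     ([Bwd X1 X2 s] @ ([Fwd X1 Y1 a] @ [Fwd Y1 Y2 t]) @ [Bwd Y1 Y2 t])"
    by (rule zigzag_eq.append[OF zigzag_eq.refl[OF z(1)]
          zigzag_eq.append[OF zigzag_eq_square_Fwd[OF assms(1-3)] zigzag_eq.refl[OF z(3)]]])
  show ?thesis
    using zigzag_eq.trans[OF zigzag_eq.sym[OF 1[simplified]]
        zigzag_eq.trans[OF zigzag_eq.sym[OF 3[simplified]] 2[simplified]]]
    by simp
qed

lemma zigzag_eq_paste:
  assumes "zigzag_eq C S X1 Y2 (u @ [Fwd X2 Y2 b]) ([Fwd X1 Y1 a] @ v)"
    and "zigzag_eq C S X2 Y3 (u' @ [Fwd X3 Y3 c]) ([Fwd X2 Y2 b] @ v')"
    and "zigzag C S X1 u X2" "zigzag C S Y2 v' Y3"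
  shows "zigzag_eq C S X1 Y3 ((u @ u') @ [Fwd X3 Y3 c]) ([Fwd X1 Y1 a] @ (v @ v'))"
proof -
  have 1: "zigzag_eq C S X1 Y3 (u @ (u' @ [Fwd X3 Y3 c])) (u @ ([Fwd X2 Y2 b] @ v'))"
    by (rule zigzag_eq.append[OF zigzag_eq.refl[OF assms(3)] assms(2)])
  have 2: "zigzag_eq C S X1 Y3 ((u @ [Fwd X2 Y2 b]) @ v') (([Fwd X1 Y1 a] @ v) @ v')"
    by (rule zigzag_eq.append[OF assms(1) zigzag_eq.refl[OF assms(4)]])
  show ?thesis
    using zigzag_eq.trans[OF 1 2[unfolded append_assoc]] by simp
qed

lemma H0_simps:
  "Obj (H0_cat B Os) = Os" "Hom (H0_cat B Os) E F = hclass B E F ` cocycles B E F"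
  "Ident (H0_cat B Os) E = hclass B E E (\<lambda>i x. x)"
  by (simp_all add: H0_cat_def)

lemma H0_Comp:
  assumes "E \<in> kdg_mod B f" "F \<in> kdg_mod B f" "G \<in> kdg_mod B f"
    and "\<phi> \<in> cocycles B E F" "\<psi> \<in> cocycles B F G"
  shows "Comp (H0_cat B Os) E F G (hclass B F G \<psi>) (hclass B E F \<phi>) = hclass B E G (\<lambda>i x. \<psi> i (\<phi> i x))"
  using hclass_comp[OF assms] by (simp add: H0_cat_def)

section \<open>Perfect modules and quasi-isomorphisms\<close>

abbreviation qis :: "('b, 'c) ring_scheme \<Rightarrow> ('b, 'm) kdg \<Rightarrow> ('b, 'm) kdg \<Rightarrow> (int \<Rightarrow> 'm \<Rightarrow> 'm) set set" where
  "qis B E F \<equiv> hclass B E F ` {\<phi>. quasi_iso B E F \<phi>}"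

lemma derived_retractI:
  assumes "zigzag (H0_cat B (kdg_mod B f)) (qis B) E u F"
    and "zigzag (H0_cat B (kdg_mod B f)) (qis B) F v E"
    and "zigzag_eq (H0_cat B (kdg_mod B f)) (qis B) E E (u @ v) []"
  shows "is_retract (derived_cat B f) E F"
proof -
  let ?L = "localization (H0_cat B (kdg_mod B f)) (qis B)"
  let ?u = "Collect (zigzag_eq (H0_cat B (kdg_mod B f)) (qis B) E F u)"
  let ?v = "Collect (zigzag_eq (H0_cat B (kdg_mod B f)) (qis B) F E v)"
  have EF: "E \<in> Obj ?L" "F \<in> Obj ?L"
    using zigzag_Obj[OF assms(1)] by (auto simp: localization_def)
  have "Comp ?L E F E ?v ?u = Ident ?L E"
    unfolding localization_Comp[OF assms(1,2)] zigzag_eq_class[OF assms(3)]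
    by (simp add: localization_def)
  moreover have "?u \<in> Hom ?L E F" "?v \<in> Hom ?L F E"
    using assms(1,2) by (auto simp: localization_def)
  ultimately show ?thesis
    using EF unfolding is_retract_def derived_cat_def by blast
qed

text \<open>A splitting that holds on the nose survives in the homotopy category and in its
  localization.\<close>

lemma perf_retract:
  assumes "F \<in> perf B f" "E \<in> kdg_mod B f" "F \<in> kdg_mod B f"
    and \<phi>: "\<phi> \<in> cocycles B E F" and \<psi>: "\<psi> \<in> cocycles B F E"
    and "\<And>i x. x \<in> carrier (cmp E i) \<Longrightarrow> \<psi> i (\<phi> i x) = x"
  shows "E \<in> perf B f"
proof (rule perf.retract[OF assms(1) derived_retractI])
  let ?C = "H0_cat B (kdg_mod B f)"
  let ?u = "[Fwd E F (hclass B E F \<phi>)]" and ?v = "[Fwd F E (hclass B F E \<psi>)]"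
  show "zigzag ?C (qis B) E ?u F" "zigzag ?C (qis B) F ?v E"
    using assms by (auto simp: H0_simps)
  have "zigzag_eq ?C (qis B) E E (?u @ ?v) [Fwd E E (Comp ?C E F E (hclass B F E \<psi>) (hclass B E F \<phi>))]"
    using assms by (simp, intro zigzag_eq.comp) (auto simp: H0_simps)
  also have "Comp ?C E F E (hclass B F E \<psi>) (hclass B E F \<phi>) = Ident ?C E"
    unfolding H0_Comp[OF assms(2,3,2) \<phi> \<psi>] H0_simps
    by (rule hclass_cong[OF assms(2,2) cocycles_comp[OF assms(2,3,2) \<phi> \<psi>] cocycles_id[OF assms(2)] assms(6)])
  finally show "zigzag_eq ?C (qis B) E E (?u @ ?v) []"
    using zigzag_eq.ident[of E ?C "qis B"] assms(2) by (auto simp: H0_simps intro: zigzag_eq.trans)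
qed

text \<open>A quasi-isomorphism is invertible in the derived category, so its target is a retract of
  its source there; the section is the formal inverse.\<close>

lemma perf_quasi_iso:
  assumes "E \<in> kdg_mod B f" "F \<in> kdg_mod B f" "quasi_iso B E F \<phi>" "E \<in> perf B f"
  shows "F \<in> perf B f"
proof (rule perf.retract[OF assms(4) derived_retractI])
  let ?C = "H0_cat B (kdg_mod B f)"
  let ?u = "[Bwd E F (hclass B E F \<phi>)]" and ?v = "[Fwd E F (hclass B E F \<phi>)]"
  show "zigzag ?C (qis B) F ?u E" "zigzag ?C (qis B) E ?v F"
    using assms by (auto simp: H0_simps quasi_iso_def)
  show "zigzag_eq ?C (qis B) F F (?u @ ?v) []"
    using assms by (simp, intro zigzag_eq.inv_left) (auto simp: H0_simps quasi_iso_def)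
qed

text \<open>On an acyclic module the zero endomorphism is a quasi-isomorphism; being idempotent and invertible
  in the derived category it is the identity there.\<close>

lemma perf_acyclic_retract:
  fixes E P :: "('b, ('b, 'x) univ) kdg"
  assumes "E \<in> kdg_mod B f" "P \<in> kdg_mod B f" "P \<in> perf B f"
    and acyclic: "\<And>i x. x \<in> carrier (cmp E i) \<Longrightarrow> dif E i x = \<zero>\<^bsub>cmp E (i + 1)\<^esub> \<Longrightarrow>
      x \<in> dif E (i - 1) ` carrier (cmp E (i - 1))"
  shows "E \<in> perf B f"
proof (rule perf.retract[OF assms(3) derived_retractI])
  let ?C = "H0_cat B (kdg_mod B f)"
  let ?z = "\<lambda>E F :: ('b, ('b, 'x) univ) kdg. hclass B E F (\<lambda>i x. \<zero>\<^bsub>cmp F i\<^esub>)"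
  note k = assms(1,2)
  note z = cocycles_zero
  let ?s = "Fwd E E (?z E E)"
  show u: "zigzag ?C (qis B) E [Fwd E P (?z E P)] P" "zigzag ?C (qis B) P [Fwd P E (?z P E)] E"
    using k z[OF k] z[OF k(2,1)] by (auto simp: H0_simps)
  have c: "Comp ?C E X E (?z X E) (?z E X) = ?z E E" if "X \<in> kdg_mod B f" for X
    unfolding H0_Comp[OF k(1) that k(1) z[OF k(1) that] z[OF that k(1)]] ..
  have q: "quasi_iso B E E (\<lambda>i x. \<zero>\<^bsub>cmp E i\<^esub>)"
    unfolding quasi_iso_def
  proof (intro conjI allI ballI impI)
    fix i y assume y: "y \<in> carrier (cmp E i)" "dif E i y = \<zero>\<^bsub>cmp E (i + 1)\<^esub>"
    then obtain w where w: "w \<in> carrier (cmp E (i - 1))" "y = dif E (i - 1) w" using acyclic by blast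
    then show "\<exists>x\<in>carrier (cmp E i). dif E i x = \<zero>\<^bsub>cmp E (i + 1)\<^esub> \<and>
       (\<exists>z\<in>carrier (cmp E (i - 1)). y = \<zero>\<^bsub>cmp E i\<^esub> \<oplus>\<^bsub>cmp E i\<^esub> dif E (i - 1) z)"
      using y module_simps(6)[OF kdg_modD(1)[OF k(1)] y(1)] by (intro bexI[of _ y] conjI bexI[of _ w]) simp_all
  qed (use z[OF k(1,1)] acyclic in auto)
  have zz: "zigzag ?C (qis B) E [?s] E" "zigzag ?C (qis B) E [?s, ?s] E"
    "zigzag ?C (qis B) E [?s, Bwd E E (?z E E)] E" "zigzag ?C (qis B) E [Bwd E E (?z E E)] E" "zigzag ?C (qis B) E [] E"
    using k z[OF k(1,1)] q by (auto simp: H0_simps)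
  have "zigzag_eq ?C (qis B) E E [?s, ?s] [?s]"
    using zigzag_eq.comp[OF zz(2)] c[OF k(1)] by simp
  then have 1: "zigzag_eq ?C (qis B) E E ([?s, ?s] @ [Bwd E E (?z E E)]) ([?s] @ [Bwd E E (?z E E)])"
    by (rule zigzag_eq.append[OF _ zigzag_eq.refl[OF zz(4)]])
  have 2: "zigzag_eq ?C (qis B) E E ([?s] @ [?s, Bwd E E (?z E E)] @ []) ([?s] @ [])"
    by (rule zigzag_eq_assoc_cancel[OF zigzag_eq.inv_right[OF zz(3)] zz(1,5)])
  have "zigzag_eq ?C (qis B) E E [?s] []"
    using zigzag_eq.trans[OF zigzag_eq.trans[OF zigzag_eq.sym[OF 2[simplified]] 1[simplified]]
        zigzag_eq.inv_right[OF zz(3)]] .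
  \<comment> \<open>Factoring the zero endomorphism through \<open>P\<close> is what exhibits
    \<open>E\<close> as a retract of a module already known to be perfect.\<close>
  moreover have "zigzag_eq ?C (qis B) E E [Fwd E P (?z E P), Fwd P E (?z P E)] [?s]"
    using zigzag_eq.comp[of ?C "qis B" E P "?z E P" E "?z P E"] u c[OF k(2)] by simp
  ultimately show "zigzag_eq ?C (qis B) E E ([Fwd E P (?z E P)] @ [Fwd P E (?z P E)]) []"
    by (auto intro: zigzag_eq.trans)
qed

section \<open>Shifts, cones and kernels\<close>

lemma dg_shift_simps [simp]:
  "cmp (dg_shift E n) i = cmp E (i + n)"
  "dif (dg_shift E n) i x = signed (cmp E (i + n + 1)) n (dif E (i + n) x)"
  "hty (dg_shift E n) i x = signed (cmp E (i + n - 1)) n (hty E (i + n) x)"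
  by (simp_all add: dg_shift_def)

lemma dg_shift_kdg_mod:
  assumes E: "E \<in> kdg_mod B f"
  shows "dg_shift E n \<in> kdg_mod B f"
proof (rule kdg_modI)
  fix i :: int
  note m = kdg_modD(1)[OF E]
  have ix: "i + 1 + n = i + n + 1" "i - 1 + n = i + n - 1" "i + 2 + n = i + n + 1 + 1" "i - 2 + n = i + n - 1 - 1"
    by simp_all
  note d = kdg_modD(2)[OF E, of "i + n"] and h = kdg_modD(3)[OF E, of "i + n"]
  show "Module.module B (cmp (dg_shift E n) i)" by (simp add: m)
  show "dif (dg_shift E n) i \<in> module_hom B (cmp (dg_shift E n) i) (cmp (dg_shift E n) (i + 1))"
    using module_hom_signed[OF d m] by (simp add: ix dg_shift_def)
  show "hty (dg_shift E n) i \<in> module_hom B (cmp (dg_shift E n) i) (cmp (dg_shift E n) (i - 1))"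
    using module_hom_signed[OF h m] by (simp add: ix dg_shift_def)
  fix x assume "x \<in> carrier (cmp (dg_shift E n) i)"
  then have x: "x \<in> carrier (cmp E (i + n))" by simp
  note c = kdg_closed[OF E x]
  note dd = kdg_square[OF E x]
  show "dif (dg_shift E n) (i + 1) (dif (dg_shift E n) i x) = \<zero>\<^bsub>cmp (dg_shift E n) (i + 2)\<^esub>"
    using dd(1)[of "i + n + 1"] c(1) kdg_simps(3)[OF E c(1)] module_simps(10)[OF m]
    by (simp add: signed_def ix)
  show "hty (dg_shift E n) (i - 1) (hty (dg_shift E n) i x) = \<zero>\<^bsub>cmp (dg_shift E n) (i - 2)\<^esub>"
    using dd(2)[of "i + n - 1"] c(2) kdg_simps(4)[OF E c(2)] module_simps(10)[OF m]
    by (simp add: signed_def ix)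
  show "dif (dg_shift E n) (i - 1) (hty (dg_shift E n) i x) \<oplus>\<^bsub>cmp (dg_shift E n) i\<^esub>
      hty (dg_shift E n) (i + 1) (dif (dg_shift E n) i x) = f \<odot>\<^bsub>cmp (dg_shift E n) i\<^esub> x"
    using kdg_modD(6)[OF E x] c kdg_simps(4)[OF E c(1)] kdg_simps(3)[OF E c(2)] module_simps(9)[OF m]
    by (simp add: signed_def ix)
qed

abbreviation pair_module ::
  "('r, ('b, 'x) univ) module \<Rightarrow> ('r, ('b, 'x) univ) module \<Rightarrow> ('r, ('b, 'x) univ) module" where
  "pair_module M N \<equiv> direct_sum {0, 1} (\<lambda>j. if j = 0 then M else N)"

lemma component_pair [simp]: "component (pair x y) 0 = x" "component (pair x y) 1 = y"
  by (simp_all add: pair_def)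

lemma pair_inject [simp]: "pair x y = pair x' y' \<longleftrightarrow> x = x' \<and> y = y'"
  by (metis component_pair)

lemma pair_closed: "x \<in> carrier M \<Longrightarrow> y \<in> carrier N \<Longrightarrow> pair x y \<in> carrier (pair_module M N)"
  unfolding pair_def by (rule direct_sum_carrierI) auto

lemma pair_module_closed:
  "z \<in> carrier (pair_module M N) \<Longrightarrow> component z 0 \<in> carrier M"
  "z \<in> carrier (pair_module M N) \<Longrightarrow> component z 1 \<in> carrier N"
  using direct_sum_closed[of z "{0, 1}" "\<lambda>j. if j = 0 then M else N" 0]
    direct_sum_closed[of z "{0, 1}" "\<lambda>j. if j = 0 then M else N" 1] by auto

lemma pair_component:
  assumes "z \<in> carrier (pair_module M N)"
  shows "pair (component z 0) (component z 1) = z"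
  by (rule direct_sum_eqI[OF pair_closed[OF pair_module_closed[OF assms]] assms]) auto

lemma pair_moduleE:
  assumes "z \<in> carrier (pair_module M N)"
  obtains x y where "x \<in> carrier M" "y \<in> carrier N" "z = pair x y"
  using pair_module_closed[OF assms] pair_component[OF assms, symmetric] by (rule that)

lemma pair_module_simps [simp]:
  "pair x y \<oplus>\<^bsub>pair_module M N\<^esub> pair x' y' = pair (x \<oplus>\<^bsub>M\<^esub> x') (y \<oplus>\<^bsub>N\<^esub> y')"
  "\<zero>\<^bsub>pair_module M N\<^esub> = pair \<zero>\<^bsub>M\<^esub> \<zero>\<^bsub>N\<^esub>"
  "r \<odot>\<^bsub>pair_module M N\<^esub> pair x y = pair (r \<odot>\<^bsub>M\<^esub> x) (r \<odot>\<^bsub>N\<^esub> y)"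
  by (auto simp: direct_sum_def pair_def fun_eq_iff)

lemma pair_module_module:
  assumes "Module.module B M" "Module.module B N"
  shows "Module.module B (pair_module M N)"
proof -
  have "cring B" using assms(1) by (simp add: module_def)
  then show ?thesis using assms by (intro direct_sum_module) auto
qed

lemma pair_hom:
  assumes "g \<in> module_hom B P M" "h \<in> module_hom B P N"
  shows "(\<lambda>z. pair (g z) (h z)) \<in> module_hom B P (pair_module M N)"
  using module_homD[OF assms(1)] module_homD[OF assms(2)]
  by (intro module_homI pair_closed) simp_all

lemma component_pair_hom:
  "(\<lambda>z. component z 0) \<in> module_hom B (pair_module M N) M"
  "(\<lambda>z. component z 1) \<in> module_hom B (pair_module M N) N"
  using component_hom[of 0 "{0, 1}" B "\<lambda>j. if j = 0 then M else N"]
    component_hom[of 1 "{0, 1}" B "\<lambda>j. if j = 0 then M else N"] by simp_all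

lemma dg_cone_simps [simp]:
  "cmp (dg_cone E F \<phi>) i = pair_module (cmp E (i + 1)) (cmp F i)"
  "dif (dg_cone E F \<phi>) i (pair x y) =
     pair (\<ominus>\<^bsub>cmp E (i + 2)\<^esub> dif E (i + 1) x) (\<phi> (i + 1) x \<oplus>\<^bsub>cmp F (i + 1)\<^esub> dif F i y)"
  "hty (dg_cone E F \<phi>) i (pair x y) = pair (\<ominus>\<^bsub>cmp E i\<^esub> hty E (i + 1) x) (hty F i y)"
  by (simp_all add: dg_cone_def)

lemma dg_cone_kdg_mod:
  assumes E: "E \<in> kdg_mod B f" and F: "F \<in> kdg_mod B f" and \<phi>: "\<phi> \<in> cocycles B E F"
  shows "dg_cone E F \<phi> \<in> kdg_mod B f"
proof (rule kdg_modI)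
  fix i :: int
  note mE = kdg_modD(1)[OF E] and mF = kdg_modD(1)[OF F]
  note \<phi>D = cocyclesD[OF E F \<phi>]
  have ix: "i + 1 + 1 = i + 2" "i - 1 + 1 = i" "i + 1 - 1 = i" "i + 2 + 1 = i + 3" "i + 1 + 2 = i + 3" "i - 1 + 2 = i + 1"
    "i - 2 + 1 = i - 1" "i + 2 - 1 = i + 1"
    by simp_all
  show "Module.module B (cmp (dg_cone E F \<phi>) i)"
    by (simp add: pair_module_module mE mF)
  show "dif (dg_cone E F \<phi>) i \<in> module_hom B (cmp (dg_cone E F \<phi>) i) (cmp (dg_cone E F \<phi>) (i + 1))"
    unfolding dg_cone_def kdg.select_convs ix
    by (intro pair_hom module_hom_minus module_hom_add mE mF,
        rule module_hom_comp[OF component_pair_hom(1) kdg_modD(2)[OF E, of "i + 1"], unfolded ix],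
        rule module_hom_comp[OF component_pair_hom(1) \<phi>D(1)[of "i + 1"]],
        rule module_hom_comp[OF component_pair_hom(2) kdg_modD(2)[OF F, of "i"]])
  show "hty (dg_cone E F \<phi>) i \<in> module_hom B (cmp (dg_cone E F \<phi>) i) (cmp (dg_cone E F \<phi>) (i - 1))"
    unfolding dg_cone_def kdg.select_convs ix
    by (intro pair_hom module_hom_minus mE mF,
        rule module_hom_comp[OF component_pair_hom(1) kdg_modD(3)[OF E, of "i + 1"], unfolded ix],
        rule module_hom_comp[OF component_pair_hom(2) kdg_modD(3)[OF F, of "i"]])
  fix z assume "z \<in> carrier (cmp (dg_cone E F \<phi>) i)"
  then obtain x y where x: "x \<in> carrier (cmp E (i + 1))" and y: "y \<in> carrier (cmp F i)" and z: "z = pair x y"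
    by (auto elim: pair_moduleE)
  note cx = kdg_closed[OF E x, unfolded ix] and cy = kdg_closed[OF F y]
  note \<phi>c = cocycles_closed[OF E F \<phi>]
  note px = \<phi>c[OF x]
  have d1: "dif E (i + 2) (dif E (i + 1) x) = \<zero>\<^bsub>cmp E (i + 3)\<^esub>"
    using kdg_square(1)[OF E x, of "i + 2"] by (simp add: ix)
  have h1: "hty E i (hty E (i + 1) x) = \<zero>\<^bsub>cmp E (i - 1)\<^esub>"
    using kdg_square(2)[OF E x, of "i"] by simp
  have d2: "dif F (i + 1) (dif F i y) = \<zero>\<^bsub>cmp F (i + 2)\<^esub>"
    using kdg_square(1)[OF F y, of "i + 1"] by (simp add: ix)
  have h2: "hty F (i - 1) (hty F i y) = \<zero>\<^bsub>cmp F (i - 2)\<^esub>"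
    using kdg_square(2)[OF F y, of "i - 1"] by simp
  have \<phi>d: "\<phi> (i + 2) (dif E (i + 1) x) = dif F (i + 1) (\<phi> (i + 1) x)"
    using \<phi>D(3)[OF x, of "i + 2"] by (simp add: ix)
  have \<phi>h: "\<phi> i (hty E (i + 1) x) = hty F (i + 1) (\<phi> (i + 1) x)"
    using \<phi>D(2)[OF x, of "i"] by simp
  note pdx = kdg_closed[OF F px, unfolded ix]
  have "\<phi> (i + 2) (\<ominus>\<^bsub>cmp E (i + 2)\<^esub> dif E (i + 1) x) \<oplus>\<^bsub>cmp F (i + 2)\<^esub>
      dif F (i + 1) (\<phi> (i + 1) x \<oplus>\<^bsub>cmp F (i + 1)\<^esub> dif F i y) = \<zero>\<^bsub>cmp F (i + 2)\<^esub>"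
    using module_hom_simps(2)[OF \<phi>D(1) mE mF cx(1)] kdg_simps(5)[OF F px cy(1)]
    by (simp add: ix d2 \<phi>d module_simps[OF mF] pdx)
      (rule lin_eqI[OF module_abelian_group[OF mF]],
        (rule lin_rules | (rule lin_atom, (simp add: pdx; fail)))+, simp)
  then show "dif (dg_cone E F \<phi>) (i + 1) (dif (dg_cone E F \<phi>) i z) = \<zero>\<^bsub>cmp (dg_cone E F \<phi>) (i + 2)\<^esub>"
    using kdg_simps(3)[OF E cx(1)] by (simp add: z ix d1 module_simps[OF mE])
  show "hty (dg_cone E F \<phi>) (i - 1) (hty (dg_cone E F \<phi>) i z) = \<zero>\<^bsub>cmp (dg_cone E F \<phi>) (i - 2)\<^esub>"
    using kdg_simps(4)[OF E cx(2)] by (simp add: z ix h1 h2 module_simps[OF mE])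
  have "dif E i (hty E (i + 1) x) \<oplus>\<^bsub>cmp E (i + 1)\<^esub> hty E (i + 2) (dif E (i + 1) x) = f \<odot>\<^bsub>cmp E (i + 1)\<^esub> x"
    using kdg_modD(6)[OF E x] by (simp add: ix)
  moreover have "\<phi> i (\<ominus>\<^bsub>cmp E i\<^esub> hty E (i + 1) x) \<oplus>\<^bsub>cmp F i\<^esub> dif F (i - 1) (hty F i y)
     \<oplus>\<^bsub>cmp F i\<^esub> hty F (i + 1) (\<phi> (i + 1) x \<oplus>\<^bsub>cmp F (i + 1)\<^esub> dif F i y)
     = dif F (i - 1) (hty F i y) \<oplus>\<^bsub>cmp F i\<^esub> hty F (i + 1) (dif F i y)"
    using module_hom_simps(2)[OF \<phi>D(1) mE mF cx(2)] kdg_simps(6)[OF F px cy(1)] cy(3,4)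
    by (simp add: ix \<phi>h)
      (rule lin_eqI[OF module_abelian_group[OF mF]],
        (rule lin_rules | (rule lin_atom, (simp add: pdx cy; fail)))+, simp)
  ultimately show "dif (dg_cone E F \<phi>) (i - 1) (hty (dg_cone E F \<phi>) i z) \<oplus>\<^bsub>cmp (dg_cone E F \<phi>) i\<^esub>
      hty (dg_cone E F \<phi>) (i + 1) (dif (dg_cone E F \<phi>) i z) = f \<odot>\<^bsub>cmp (dg_cone E F \<phi>) i\<^esub> z"
    using kdg_simps(3)[OF E cx(2)] kdg_simps(4)[OF E cx(1), unfolded ix] kdg_modD(6)[OF F y]
      kdg_closed(3,4)[OF E x]
    by (simp add: z ix module_simps[OF mE])
qed

section \<open>Submodules and kernels of dg modules\<close>

definition sub_kdg :: "('b, 'm) kdg \<Rightarrow> (int \<Rightarrow> 'm set) \<Rightarrow> ('b, 'm) kdg" where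
  "sub_kdg E S = E\<lparr>cmp := \<lambda>i. (cmp E i)\<lparr>carrier := S i\<rparr>\<rparr>"

lemma sub_kdg_simps [simp]:
  "cmp (sub_kdg E S) i = (cmp E i)\<lparr>carrier := S i\<rparr>"
  "dif (sub_kdg E S) = dif E" "hty (sub_kdg E S) = hty E"
  by (simp_all add: sub_kdg_def)

lemma sub_module_module:
  assumes M: "Module.module B M" and "S \<subseteq> carrier M" "\<zero>\<^bsub>M\<^esub> \<in> S"
    and "\<And>x y. x \<in> S \<Longrightarrow> y \<in> S \<Longrightarrow> x \<oplus>\<^bsub>M\<^esub> y \<in> S"
    and "\<And>r x. r \<in> carrier B \<Longrightarrow> x \<in> S \<Longrightarrow> r \<odot>\<^bsub>M\<^esub> x \<in> S"
  shows "Module.module B (M\<lparr>carrier := S\<rparr>)"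
proof -
  interpret module B M by fact
  have S: "x \<in> carrier M" if "x \<in> S" for x using that assms(2) by blast
  show ?thesis
  proof (rule moduleI)
    show "abelian_group (M\<lparr>carrier := S\<rparr>)"
    proof (rule abelian_groupI)
      fix x assume "x \<in> carrier (M\<lparr>carrier := S\<rparr>)"
      then have "x \<in> S" by simp
      \<comment> \<open>Negatives are obtained as multiples by -1, which keeps them in
        \<open>S\<close>.\<close>
      moreover from this have "(\<ominus>\<^bsub>B\<^esub> \<one>\<^bsub>B\<^esub>) \<odot>\<^bsub>M\<^esub> x \<in> S"
        by (intro assms(5)) simp
      moreover from calculation(1) have "(\<ominus>\<^bsub>B\<^esub> \<one>\<^bsub>B\<^esub>) \<odot>\<^bsub>M\<^esub> x \<oplus>\<^bsub>M\<^esub> x = \<zero>\<^bsub>M\<^esub>"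
        using S by (simp add: smult_l_minus M.l_neg)
      ultimately show "\<exists>y\<in>carrier (M\<lparr>carrier := S\<rparr>). y \<oplus>\<^bsub>M\<lparr>carrier := S\<rparr>\<^esub> x = \<zero>\<^bsub>M\<lparr>carrier := S\<rparr>\<^esub>" by auto
    qed (use assms S in \<open>auto simp: M.a_ac\<close>)
  qed (use assms S R.is_cring in \<open>auto simp: smult_l_distr smult_r_distr smult_assoc1\<close>)
qed

lemma sub_kdg_mod:
  assumes E: "E \<in> kdg_mod B f" and S: "\<And>i. S i \<subseteq> carrier (cmp E i)" "\<And>i. \<zero>\<^bsub>cmp E i\<^esub> \<in> S i"
    and "\<And>i x y. x \<in> S i \<Longrightarrow> y \<in> S i \<Longrightarrow> x \<oplus>\<^bsub>cmp E i\<^esub> y \<in> S i"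
    and "\<And>i r x. r \<in> carrier B \<Longrightarrow> x \<in> S i \<Longrightarrow> r \<odot>\<^bsub>cmp E i\<^esub> x \<in> S i"
    and d: "\<And>i x. x \<in> S i \<Longrightarrow> dif E i x \<in> S (i + 1)"
    and h: "\<And>i x. x \<in> S i \<Longrightarrow> hty E i x \<in> S (i - 1)"
  shows "sub_kdg E S \<in> kdg_mod B f"
proof (rule kdg_modI)
  fix i :: int
  have c: "x \<in> carrier (cmp E i)" if "x \<in> S i" for x using that S(1) by blast
  show "Module.module B (cmp (sub_kdg E S) i)"
    using sub_module_module[OF kdg_modD(1)[OF E] S assms(4,5)] by simp
  show "dif (sub_kdg E S) i \<in> module_hom B (cmp (sub_kdg E S) i) (cmp (sub_kdg E S) (i + 1))"
    using kdg_modD(2)[OF E, of i] c d by (intro module_homI) (auto simp: module_homD)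
  show "hty (sub_kdg E S) i \<in> module_hom B (cmp (sub_kdg E S) i) (cmp (sub_kdg E S) (i - 1))"
    using kdg_modD(3)[OF E, of i] c h by (intro module_homI) (auto simp: module_homD)
qed (use kdg_modD(4-6)[OF E subsetD[OF S(1)]] in auto)

text \<open>Sum and zero of a submodule are inherited definitionally, but the additive inverse is
  chosen inside the carrier. It agrees with the ambient one because the inclusion is a
  homomorphism.\<close>

lemma sub_minus:
  assumes "Module.module B M" "Module.module B (M\<lparr>carrier := S\<rparr>)" "S \<subseteq> carrier M" "x \<in> S"
  shows "\<ominus>\<^bsub>M\<lparr>carrier := S\<rparr>\<^esub> x = \<ominus>\<^bsub>M\<^esub> x"
proof -
  have "(\<lambda>x. x) \<in> module_hom B (M\<lparr>carrier := S\<rparr>) M"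
    using assms(3) by (auto simp: module_hom_def)
  from module_hom_simps(2)[OF this assms(2,1)] assms(4) show ?thesis by simp
qed

definition kernel_set :: "('b, 'm) kdg \<Rightarrow> ('b, 'm) kdg \<Rightarrow> (int \<Rightarrow> 'm \<Rightarrow> 'm) \<Rightarrow> int \<Rightarrow> 'm set" where
  "kernel_set E F \<phi> i = {x \<in> carrier (cmp E i). \<phi> i x = \<zero>\<^bsub>cmp F i\<^esub>}"

lemma kernel_kdg_mod:
  assumes E: "E \<in> kdg_mod B f" and F: "F \<in> kdg_mod B f" and \<phi>: "\<phi> \<in> cocycles B E F"
  shows "sub_kdg E (kernel_set E F \<phi>) \<in> kdg_mod B f"
proof (rule sub_kdg_mod[OF E])
  note mE = kdg_modD(1)[OF E] and mF = kdg_modD(1)[OF F]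
  note \<phi>D = cocyclesD[OF E F \<phi>]
  show "\<zero>\<^bsub>cmp E i\<^esub> \<in> kernel_set E F \<phi> i" for i
    using module_hom_simps(1)[OF \<phi>D(1) mE mF] by (simp add: kernel_set_def module_simps(2)[OF mE])
  show "x \<oplus>\<^bsub>cmp E i\<^esub> y \<in> kernel_set E F \<phi> i" if "x \<in> kernel_set E F \<phi> i" "y \<in> kernel_set E F \<phi> i" for i x y
    using that module_homD(2)[OF \<phi>D(1)] module_simps(2,3,6)[OF mF]
    by (simp add: kernel_set_def module_simps(3)[OF mE])
  show "r \<odot>\<^bsub>cmp E i\<^esub> x \<in> kernel_set E F \<phi> i" if "r \<in> carrier B" "x \<in> kernel_set E F \<phi> i" for i r x
    using that module_homD(3)[OF \<phi>D(1)] module_simps(12)[OF mF]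
    by (simp add: kernel_set_def module_simps(11)[OF mE])
  show "dif E i x \<in> kernel_set E F \<phi> (i + 1)" if "x \<in> kernel_set E F \<phi> i" for i x
    using that \<phi>D(3) kdg_closed(1)[OF E] kdg_simps(1)[OF F] by (simp add: kernel_set_def)
  show "hty E i x \<in> kernel_set E F \<phi> (i - 1)" if "x \<in> kernel_set E F \<phi> i" for i x
    using that \<phi>D(2) kdg_closed(2)[OF E] kdg_simps(2)[OF F] by (simp add: kernel_set_def)
qed (auto simp: kernel_set_def)

text \<open>The cone of a surjection is quasi-isomorphic to the shifted kernel.\<close>

lemma perf_cone_of_surjection:
  fixes E F :: "('b, ('b, 'x) univ) kdg"
  assumes E: "E \<in> kdg_mod B f" and F: "F \<in> kdg_mod B f" and \<phi>: "\<phi> \<in> cocycles B E F"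
    and surj: "\<And>i y. y \<in> carrier (cmp F i) \<Longrightarrow> \<exists>x\<in>carrier (cmp E i). \<phi> i x = y"
    and ker: "sub_kdg E (kernel_set E F \<phi>) \<in> perf B f"
  shows "dg_cone E F \<phi> \<in> perf B f"
proof (rule perf_quasi_iso)
  define N where "N = sub_kdg E (kernel_set E F \<phi>)"
  let ?C = "dg_cone E F \<phi>"
  let ?\<iota> = "\<lambda>i n. pair n \<zero>\<^bsub>cmp F i\<^esub>"
  have N: "N \<in> kdg_mod B f" unfolding N_def by (rule kernel_kdg_mod[OF E F \<phi>])
  show sN: "dg_shift N 1 \<in> kdg_mod B f" by (rule dg_shift_kdg_mod[OF N])
  show C: "?C \<in> kdg_mod B f" by (rule dg_cone_kdg_mod[OF E F \<phi>])
  show "dg_shift N 1 \<in> perf B f" using ker unfolding N_def by (rule perf.shift)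
  note mE = kdg_modD(1)[OF E] and mF = kdg_modD(1)[OF F] and mN = kdg_modD(1)[OF N]
  note \<phi>D = cocyclesD[OF E F \<phi>] and \<phi>c = cocycles_closed[OF E F \<phi>]
  have ix: "i + 1 + 1 = i + 2" "i - 1 + 1 = i" "i + 1 - 1 = i" "i - 1 + 2 = i + 1" for i :: int by simp_all
  have Nc: "carrier (cmp N i) = {x \<in> carrier (cmp E i). \<phi> i x = \<zero>\<^bsub>cmp F i\<^esub>}" for i
    by (simp add: N_def kernel_set_def)
  have Nm: "\<ominus>\<^bsub>cmp N i\<^esub> x = \<ominus>\<^bsub>cmp E i\<^esub> x" if "x \<in> carrier (cmp N i)" for i x
    using sub_minus[OF mE[of i], where S = "kernel_set E F \<phi> i" and x = x] mN[of i] that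
    by (simp add: N_def) (auto simp: kernel_set_def)
  have Nd: "dif N = dif E" "hty N = hty E" by (simp_all add: N_def)
  have Nz: "\<zero>\<^bsub>cmp N i\<^esub> = \<zero>\<^bsub>cmp E i\<^esub>" for i by (simp add: N_def)
  have sd: "dif (dg_shift N 1) i x = \<ominus>\<^bsub>cmp E (i + 2)\<^esub> dif E (i + 1) x"
    "hty (dg_shift N 1) i x = \<ominus>\<^bsub>cmp E i\<^esub> hty E (i + 1) x" if "x \<in> carrier (cmp N (i + 1))" for i x
    using Nm[OF kdg_closed(1)[OF N that]] Nm[OF kdg_closed(2)[OF N that]] by (simp_all add: signed_def Nd ix)
  have \<iota>: "?\<iota> \<in> cocycles B (dg_shift N 1) ?C"
  proof (rule cocyclesI[OF C])
    fix i
    have "(\<lambda>x. x) \<in> module_hom B (cmp N (i + 1)) (cmp E (i + 1))"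
      by (rule module_homI) (auto simp: N_def kernel_set_def)
    from pair_hom[OF this module_hom_zero[OF mF]]
    show "?\<iota> i \<in> module_hom B (cmp (dg_shift N 1) i) (cmp ?C i)" by simp
    fix x assume "x \<in> carrier (cmp (dg_shift N 1) i)"
    then have x: "x \<in> carrier (cmp N (i + 1))" by simp
    then have x': "x \<in> carrier (cmp E (i + 1))" "\<phi> (i + 1) x = \<zero>\<^bsub>cmp F (i + 1)\<^esub>" by (auto simp: Nc)
    show "?\<iota> (i - 1) (hty (dg_shift N 1) i x) = hty ?C i (?\<iota> i x)"
      unfolding sd[OF x] by (simp add: kdg_simps(2)[OF F])
    show "?\<iota> (i + 1) (dif (dg_shift N 1) i x) = dif ?C i (?\<iota> i x)"
      unfolding sd[OF x] using module_simps(2,6)[OF mF[of "i + 1"]] by (simp add: kdg_simps(1)[OF F] x' ix)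
  qed
  show "quasi_iso B (dg_shift N 1) ?C ?\<iota>"
    unfolding quasi_iso_def
  proof (intro conjI allI ballI impI)
    show "?\<iota> \<in> cocycles B (dg_shift N 1) ?C" by (rule \<iota>)
  next
    fix i n assume "n \<in> carrier (cmp (dg_shift N 1) i)"
      "dif (dg_shift N 1) i n = \<zero>\<^bsub>cmp (dg_shift N 1) (i + 1)\<^esub> \<and> ?\<iota> i n \<in> dif ?C (i - 1) ` carrier (cmp ?C (i - 1))"
    then have n: "n \<in> carrier (cmp N (i + 1))" and "?\<iota> i n \<in> dif ?C (i - 1) ` carrier (cmp ?C (i - 1))" by auto
    then obtain m v where m: "m \<in> carrier (cmp E i)" and v: "v \<in> carrier (cmp F (i - 1))"
      and eq: "?\<iota> i n = dif ?C (i - 1) (pair m v)"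
      by (auto elim!: pair_moduleE simp: ix)
    then have n_eq: "n = \<ominus>\<^bsub>cmp E (i + 1)\<^esub> dif E i m" and z: "\<zero>\<^bsub>cmp F i\<^esub> = \<phi> i m \<oplus>\<^bsub>cmp F i\<^esub> dif F (i - 1) v"
      by (simp_all add: ix)
    \<comment> \<open>The boundary \<open>(m, v)\<close> is moved into the kernel: with
      \<open>w\<close> a lift of \<open>v\<close>, the element m + d w maps to zero and has the same
      differential as m.\<close>
    obtain w where w: "w \<in> carrier (cmp E (i - 1))" "\<phi> (i - 1) w = v" using surj[OF v] by blast
    have dw: "dif E (i - 1) w \<in> carrier (cmp E i)" using kdg_closed(1)[OF E w(1)] by (simp add: ix)
    let ?m = "m \<oplus>\<^bsub>cmp E i\<^esub> dif E (i - 1) w"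
    have "\<phi> i ?m = \<zero>\<^bsub>cmp F i\<^esub>"
      using module_homD(2)[OF \<phi>D(1) m dw] \<phi>D(3)[OF w(1), of i] w(2) z by simp
    then have mN': "?m \<in> carrier (cmp N i)" using m dw module_simps(3)[OF mE] by (simp add: Nc)
    have "dif E i ?m = dif E i m"
      using kdg_simps(5)[OF E m dw] kdg_square(1)[OF E w(1), of i] module_simps(7)[OF mE kdg_closed(1)[OF E m]] by simp
    then have "dif (dg_shift N 1) (i - 1) ?m = n"
      using sd(1)[of ?m "i - 1"] mN' by (simp only: ix n_eq)
    then show "n \<in> dif (dg_shift N 1) (i - 1) ` carrier (cmp (dg_shift N 1) (i - 1))"
      using mN' by (intro image_eqI[of _ _ ?m]) (simp_all only: dg_shift_simps ix)
  next
    fix i z assume "z \<in> carrier (cmp ?C i)" and dz: "dif ?C i z = \<zero>\<^bsub>cmp ?C (i + 1)\<^esub>"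
    then obtain m v where m: "m \<in> carrier (cmp E (i + 1))" and v: "v \<in> carrier (cmp F i)" and z: "z = pair m v"
      by (auto elim!: pair_moduleE)
    from dz have dm: "\<ominus>\<^bsub>cmp E (i + 2)\<^esub> dif E (i + 1) m = \<zero>\<^bsub>cmp E (i + 2)\<^esub>"
      and pm: "\<phi> (i + 1) m \<oplus>\<^bsub>cmp F (i + 1)\<^esub> dif F i v = \<zero>\<^bsub>cmp F (i + 1)\<^esub>"
      by (simp_all add: z ix)
    obtain w where w: "w \<in> carrier (cmp E i)" "\<phi> i w = v" using surj[OF v] by blast
    note dw = kdg_closed(1)[OF E w(1)]
    let ?m = "m \<oplus>\<^bsub>cmp E (i + 1)\<^esub> dif E i w"
    have "\<phi> (i + 1) ?m = \<zero>\<^bsub>cmp F (i + 1)\<^esub>"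
      using module_homD(2)[OF \<phi>D(1) m dw] \<phi>D(3)[OF w(1), of "i + 1"] w(2) pm by simp
    then have mN': "?m \<in> carrier (cmp N (i + 1))" using m dw module_simps(3)[OF mE] by (simp add: Nc)
    have "dif E (i + 1) ?m = dif E (i + 1) m"
      using kdg_simps(5)[OF E m dw] kdg_square(1)[OF E w(1), of "i + 1"] module_simps(7)[OF mE kdg_closed(1)[OF E m]] by simp
    then have 1: "dif (dg_shift N 1) i ?m = \<zero>\<^bsub>cmp (dg_shift N 1) (i + 1)\<^esub>"
      using sd(1)[OF mN'] dm by (simp add: Nz ix)
    have "m = ?m \<oplus>\<^bsub>cmp E (i + 1)\<^esub> \<ominus>\<^bsub>cmp E (i + 1)\<^esub> dif E i w"
      by (rule lin_eqI[OF module_abelian_group[OF mE[of "i + 1"]]],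
          (rule lin_rules | (rule lin_atom, (simp add: m dw; fail)))+, simp)
    \<comment> \<open>The boundary of (w, 0) in the cone is (-d w, v), which is exactly the
      difference between the cycle (m, v) and the image of m + d w.\<close>
    then have "z = ?\<iota> i ?m \<oplus>\<^bsub>cmp ?C i\<^esub> dif ?C (i - 1) (pair w \<zero>\<^bsub>cmp F (i - 1)\<^esub>)"
      using kdg_simps(1)[OF F, of "i - 1"] v module_simps(6,7)[OF mF v] by (simp add: z ix w(2))
    moreover have "pair w \<zero>\<^bsub>cmp F (i - 1)\<^esub> \<in> carrier (cmp ?C (i - 1))"
      using w(1) module_simps(2)[OF mF] by (simp add: ix pair_closed)
    ultimately show "\<exists>x\<in>carrier (cmp (dg_shift N 1) i). dif (dg_shift N 1) i x = \<zero>\<^bsub>cmp (dg_shift N 1) (i + 1)\<^esub> \<and>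
       (\<exists>z'\<in>carrier (cmp ?C (i - 1)). z = ?\<iota> i x \<oplus>\<^bsub>cmp ?C i\<^esub> dif ?C (i - 1) z')"
      using mN' 1 by (intro bexI[of _ ?m] conjI bexI[of _ "pair w \<zero>\<^bsub>cmp F (i - 1)\<^esub>"]) simp_all
  qed
qed

section \<open>Perfection of modules that are projective over the exterior algebra\<close>

lemma bij_quasi_iso:
  assumes E: "E \<in> kdg_mod B f" and F: "F \<in> kdg_mod B f" and \<phi>: "\<phi> \<in> cocycles B E F"
    and inj: "\<And>i. inj_on (\<phi> i) (carrier (cmp E i))"
    and surj: "\<And>i y. y \<in> carrier (cmp F i) \<Longrightarrow> \<exists>x\<in>carrier (cmp E i). \<phi> i x = y"
  shows "quasi_iso B E F \<phi>"
proof -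
  note \<phi>D = cocyclesD[OF E F \<phi>] and mE = kdg_modD(1)[OF E] and mF = kdg_modD(1)[OF F]
  show ?thesis
    unfolding quasi_iso_def
  proof (intro conjI allI ballI impI)
    fix i x assume x: "x \<in> carrier (cmp E i)" and
      "dif E i x = \<zero>\<^bsub>cmp E (i + 1)\<^esub> \<and> \<phi> i x \<in> dif F (i - 1) ` carrier (cmp F (i - 1))"
    then obtain z where z: "z \<in> carrier (cmp F (i - 1))" "\<phi> i x = dif F (i - 1) z" by blast
    then obtain w where w: "w \<in> carrier (cmp E (i - 1))" "\<phi> (i - 1) w = z" using surj by blast
    have "dif E (i - 1) w \<in> carrier (cmp E i)" using kdg_closed(1)[OF E w(1)] by simp
    moreover have "\<phi> i (dif E (i - 1) w) = \<phi> i x" using \<phi>D(3)[OF w(1), of i] w(2) z(2) by simp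
    ultimately have "x = dif E (i - 1) w" using inj_onD[OF inj] x by metis
    then show "x \<in> dif E (i - 1) ` carrier (cmp E (i - 1))" using w(1) by blast
  next
    fix i y assume y: "y \<in> carrier (cmp F i)" "dif F i y = \<zero>\<^bsub>cmp F (i + 1)\<^esub>"
    then obtain x where x: "x \<in> carrier (cmp E i)" "\<phi> i x = y" using surj by blast
    have "\<phi> (i + 1) (dif E i x) = \<phi> (i + 1) \<zero>\<^bsub>cmp E (i + 1)\<^esub>"
      using \<phi>D(3)[OF x(1), of "i + 1"] x(2) y(2) module_hom_simps(1)[OF \<phi>D(1) mE mF] by simp
    then have "dif E i x = \<zero>\<^bsub>cmp E (i + 1)\<^esub>"
      using inj_onD[OF inj] kdg_closed(1)[OF E x(1)] module_simps(2)[OF mE] by metis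
    moreover have "y = \<phi> i x \<oplus>\<^bsub>cmp F i\<^esub> dif F (i - 1) \<zero>\<^bsub>cmp F (i - 1)\<^esub>"
      using kdg_simps(1)[OF F, of "i - 1"] module_simps(7)[OF mF y(1)] x(2) by simp
    ultimately show "\<exists>x\<in>carrier (cmp E i). dif E i x = \<zero>\<^bsub>cmp E (i + 1)\<^esub> \<and>
       (\<exists>z\<in>carrier (cmp F (i - 1)). y = \<phi> i x \<oplus>\<^bsub>cmp F i\<^esub> dif F (i - 1) z)"
      using x(1) module_simps(2)[OF mF] by blast
  qed (rule \<phi>)
qed

section \<open>The Koszul algebra and induced modules\<close>

lemma scalar_module_module:
  assumes "cring B"
  shows "Module.module B (scalar_module B (if b then carrier B else {\<zero>\<^bsub>B\<^esub>}) :: ('b, ('b, 'x) univ) module)"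
proof -
  interpret R: cring B by fact
  have full: "Module.module B (scalar_module B (carrier B) :: ('b, ('b, 'x) univ) module)"
  proof (rule moduleI)
    show "abelian_group (scalar_module B (carrier B))"
    proof (rule abelian_groupI)
      fix x assume "x \<in> carrier (scalar_module B (carrier B))"
      then obtain r where "x = Scalar r" "r \<in> carrier B" by (auto simp: scalar_module_def)
      then show "\<exists>y\<in>carrier (scalar_module B (carrier B)).
          y \<oplus>\<^bsub>scalar_module B (carrier B)\<^esub> x = \<zero>\<^bsub>scalar_module B (carrier B)\<^esub>"
        by (intro bexI[of _ "Scalar (\<ominus>\<^bsub>B\<^esub> r)"]) (auto simp: scalar_module_def R.l_neg)
    qed (auto simp: scalar_module_def R.a_ac)
  qed (auto simp: scalar_module_def R.l_distr R.r_distr R.m_assoc assms)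
  have "(scalar_module B {\<zero>\<^bsub>B\<^esub>} :: ('b, ('b, 'x) univ) module) = (scalar_module B (carrier B))\<lparr>carrier := {Scalar \<zero>\<^bsub>B\<^esub>}\<rparr>"
    by (simp add: scalar_module_def)
  moreover have "Module.module B ((scalar_module B (carrier B) :: ('b, ('b, 'x) univ) module)\<lparr>carrier := {Scalar \<zero>\<^bsub>B\<^esub>}\<rparr>)"
    by (rule sub_module_module[OF full]) (auto simp: scalar_module_def)
  ultimately show ?thesis using full by simp
qed

lemma koszul_simps:
  "carrier (cmp (koszul B f) i) = Scalar ` (if i = - 1 \<or> i = 0 then carrier B else {\<zero>\<^bsub>B\<^esub>})"
  "dif (koszul B f) i (Scalar b) = Scalar (if i = - 1 then f \<otimes>\<^bsub>B\<^esub> b else \<zero>\<^bsub>B\<^esub>)"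
  "hty (koszul B f) i (Scalar b) = Scalar (if i = 0 then b else \<zero>\<^bsub>B\<^esub>)"
  "\<zero>\<^bsub>cmp (koszul B f) i\<^esub> = Scalar \<zero>\<^bsub>B\<^esub>"
  "Scalar b \<oplus>\<^bsub>cmp (koszul B f) i\<^esub> Scalar c = Scalar (b \<oplus>\<^bsub>B\<^esub> c)"
  "r \<odot>\<^bsub>cmp (koszul B f) i\<^esub> Scalar c = Scalar (r \<otimes>\<^bsub>B\<^esub> c)"
  by (simp_all add: koszul_def scalar_module_def)

lemma koszul_kdg_mod:
  assumes "cring B" "f \<in> carrier B"
  shows "koszul B f \<in> kdg_mod B f"
proof -
  interpret R: cring B by fact
  show ?thesis
  proof (rule kdg_modI)
    fix i
    show "Module.module B (cmp (koszul B f) i)"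
      using scalar_module_module[OF assms(1), of "i = - 1 \<or> i = 0"] by (simp add: koszul_def)
    show "dif (koszul B f) i \<in> module_hom B (cmp (koszul B f) i) (cmp (koszul B f) (i + 1))"
      using assms(2) by (intro module_homI) (auto simp: koszul_simps R.r_distr R.m_lcomm split: if_splits)
    show "hty (koszul B f) i \<in> module_hom B (cmp (koszul B f) i) (cmp (koszul B f) (i - 1))"
      by (intro module_homI) (auto simp: koszul_simps split: if_splits)
  qed (use assms(2) in \<open>auto simp: koszul_simps split: if_splits\<close>)
qed

text \<open>The Koszul algebra itself serves as the perfect module through which the zero map is
  factored.\<close>

lemma perf_acyclic:
  assumes "cring B" "f \<in> carrier B" "E \<in> kdg_mod B f"
    and "\<And>i x. x \<in> carrier (cmp E i) \<Longrightarrow> dif E i x = \<zero>\<^bsub>cmp E (i + 1)\<^esub> \<Longrightarrow>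
      x \<in> dif E (i - 1) ` carrier (cmp E (i - 1))"
  shows "E \<in> perf B f"
  by (rule perf_acyclic_retract[OF assms(3) koszul_kdg_mod[OF assms(1,2)] perf.unit assms(4)])

text \<open>This is \<open>P\<close> extended from B to K(B,f): the generators in degree 0 and their
  \<epsilon>-multiples in degree -1. In the other degrees the record of \<open>P\<close> is kept
  with carrier zero, so that all degrees share one addition.\<close>

definition induced :: "('b, 'c) ring_scheme \<Rightarrow> 'b \<Rightarrow> ('b, 'm) module \<Rightarrow> ('b, 'm) kdg" where
  "induced B f P =
     \<lparr>cmp = (\<lambda>i. P\<lparr>carrier := if i = - 1 \<or> i = 0 then carrier P else {\<zero>\<^bsub>P\<^esub>}\<rparr>),
      dif = (\<lambda>i x. if i = - 1 then f \<odot>\<^bsub>P\<^esub> x else \<zero>\<^bsub>P\<^esub>),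
      hty = (\<lambda>i x. if i = 0 then x else \<zero>\<^bsub>P\<^esub>)\<rparr>"

lemma induced_simps [simp]:
  "cmp (induced B f P) i = P\<lparr>carrier := if i = - 1 \<or> i = 0 then carrier P else {\<zero>\<^bsub>P\<^esub>}\<rparr>"
  "dif (induced B f P) i x = (if i = - 1 then f \<odot>\<^bsub>P\<^esub> x else \<zero>\<^bsub>P\<^esub>)"
  "hty (induced B f P) i x = (if i = 0 then x else \<zero>\<^bsub>P\<^esub>)"
  by (simp_all add: induced_def)

lemma zero_sub_module:
  assumes "Module.module B M"
  shows "Module.module B (M\<lparr>carrier := {\<zero>\<^bsub>M\<^esub>}\<rparr>)"
  using module_simps(2,6,12)[OF assms] by (intro sub_module_module[OF assms]) auto

lemma induced_kdg_mod:
  assumes "Module.module B P" "f \<in> carrier B"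
  shows "induced B f P \<in> kdg_mod B f"
proof (rule kdg_modI)
  fix i
  interpret module B P by fact
  show "Module.module B (cmp (induced B f P) i)"
    using assms(1) zero_sub_module[OF assms(1)] by simp
  show "dif (induced B f P) i \<in> module_hom B (cmp (induced B f P) i) (cmp (induced B f P) (i + 1))"
    using assms(2) by (intro module_homI)
      (auto simp: smult_r_distr smult_assoc1[symmetric] R.m_comm split: if_splits)
  show "hty (induced B f P) i \<in> module_hom B (cmp (induced B f P) i) (cmp (induced B f P) (i - 1))"
    by (intro module_homI) (auto split: if_splits)
qed (use assms module_simps[OF assms(1)] in \<open>auto split: if_splits\<close>)

text \<open>Each entry of a dual basis gives a map to K(B,f) and a map back. A finite sum of copies
  of K(B,f) carries all of them, and the identity of the induced module factors through it.\<close>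

lemma induced_perf:
  fixes P :: "('b, ('b, 'x) univ) module"
  assumes "cring B" "f \<in> carrier B" "fg_projective B P"
  shows "induced B f P \<in> perf B f"
proof -
  let ?KO = "koszul B f :: ('b, ('b, 'x) univ) kdg"
  have P: "Module.module B P" using assms(3) by (simp add: fg_projective_def)
  interpret module B P by (rule P)
  let ?I = "induced B f P"
  have I: "?I \<in> kdg_mod B f" by (rule induced_kdg_mod[OF P assms(2)])
  have K: "?KO \<in> kdg_mod B f" by (rule koszul_kdg_mod[OF assms(1,2)])
  obtain l where l: "dual_system B P P l" "\<And>x. x \<in> carrier P \<Longrightarrow> lin_comb P l x = x"
    using fg_projectiveD[OF assms(1,3)] by metis
  \<comment> \<open>Generalised from the dual basis to an arbitrary dual system, for induction on
    the list: the factorisation realises the operator \<open>lin_comb P l\<close>, whatever it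
    is.\<close>
  have "\<exists>Q u v. Q \<in> perf B f \<and> Q \<in> kdg_mod B f \<and> u \<in> cocycles B ?I Q \<and> v \<in> cocycles B Q ?I \<and>
    (\<forall>i. \<forall>x\<in>carrier (cmp ?I i). v i (u i x) = lin_comb P l x)"
    using l(1)
  proof (induction l)
    case Nil
    show ?case
      using K perf.unit cocycles_zero[OF I K] cocycles_zero[OF K I] by fastforce
  next
    case (Cons p l)
    then obtain Q u v where Q: "Q \<in> perf B f" "Q \<in> kdg_mod B f" and u: "u \<in> cocycles B ?I Q"
      and v: "v \<in> cocycles B Q ?I"
      and vu: "\<And>i x. x \<in> carrier (cmp ?I i) \<Longrightarrow> v i (u i x) = lin_comb P l x"
      by fastforce
    define \<xi> e where "\<xi> = fst p" and "e = snd p"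
    have \<xi>: "functional B P \<xi>" and e: "e \<in> carrier P" using Cons.prems by (auto simp: \<xi>_def e_def)
    note \<xi>D = functionalD[OF \<xi>]
    have \<xi>0: "\<xi> \<zero>\<^bsub>P\<^esub> = \<zero>\<^bsub>B\<^esub>"
      using \<xi>D(3)[OF M.zero_closed R.zero_closed] \<xi>D(1)[OF M.zero_closed] by simp
    \<comment> \<open>Direct sums are obtained as cones of zero maps. The shift by -1 is undone by
      the degree shift of the cone, so the new summand is K(B,f) in its own degrees.\<close>
    let ?K = "dg_shift (?KO) (- 1)"
    have sK: "?K \<in> kdg_mod B f" by (rule dg_shift_kdg_mod[OF K])
    let ?z = "\<lambda>i x. \<zero>\<^bsub>cmp Q i\<^esub>"
    let ?Q = "dg_cone ?K Q ?z"
    have z: "?z \<in> cocycles B ?K Q" by (rule cocycles_zero[OF sK Q(2)])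
    have Qk: "?Q \<in> kdg_mod B f" by (rule dg_cone_kdg_mod[OF sK Q(2) z])
    have Qp: "?Q \<in> perf B f" by (rule perf.cone[OF perf.shift[OF perf.unit] Q(1) z])
    have ix: "i + 1 + - 1 = i" "i + 1 - 1 = i" "i - 1 + 1 = i" "i + 1 + 1 = i + 2" "i + 2 + - 1 = i + 1" "i + 2 - 1 = i + 1" "i + - 1 = i - 1" for i :: int
      by simp_all
    note mK = kdg_modD(1)[OF K] and mQ = kdg_modD(1)[OF Q(2)] and mI = kdg_modD(1)[OF I]
    have cQ: "cmp ?Q i = pair_module (cmp (?KO) i) (cmp Q i)" for i
    proof -
      have "cmp ?K (i + 1) = cmp (?KO) i" by (simp add: ix)
      then show ?thesis by (simp only: dg_cone_simps)
    qed
    \<comment> \<open>The sign of the odd shift cancels the sign of the cone, so differential and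
      homotopy act componentwise.\<close>
    have dQ: "dif ?Q i (pair k q) = pair (dif (?KO) i k) (dif Q i q)"
      if "k \<in> carrier (cmp (?KO) i)" "q \<in> carrier (cmp Q i)" for i k q
      using module_simps(9)[OF mK kdg_closed(1)[OF K that(1)]] module_simps(6)[OF mQ kdg_closed(1)[OF Q(2) that(2)]]
      by (simp add: signed_def ix)
    have hQ: "hty ?Q i (pair k q) = pair (hty (?KO) i k) (hty Q i q)"
      if "k \<in> carrier (cmp (?KO) i)" for i k q
      using module_simps(9)[OF mK kdg_closed(2)[OF K that(1)]]
      by (simp add: signed_def ix)
    note uD = cocyclesD[OF I Q(2) u] and uc = cocycles_closed[OF I Q(2) u]
    note vD = cocyclesD[OF Q(2) I v] and vc = cocycles_closed[OF Q(2) I v]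
    let ?u = "\<lambda>i x. pair (Scalar (\<xi> x)) (u i x)"
    let ?v = "\<lambda>i z. scalar (component z 0) \<odot>\<^bsub>P\<^esub> e \<oplus>\<^bsub>P\<^esub> v i (component z 1)"
    have \<xi>c: "Scalar (\<xi> x) \<in> carrier (cmp (?KO) i)" if "x \<in> carrier (cmp ?I i)" for i x
      using that \<xi>D(1) by (auto simp: koszul_simps \<xi>0 split: if_splits)
    have Ic: "x \<in> carrier P" if "x \<in> carrier (cmp ?I i)" for i x
      using that by (auto split: if_splits)
    have 1: "?u \<in> cocycles B ?I ?Q"
    proof (rule cocyclesI[OF Qk])
      fix i
      have "(\<lambda>x. Scalar (\<xi> x)) \<in> module_hom B (cmp ?I i) (cmp (?KO) i)"
      proof (rule module_homI)
        fix x assume x: "x \<in> carrier (cmp ?I i)"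
        show "Scalar (\<xi> x) \<in> carrier (cmp ?KO i)" by (rule \<xi>c[OF x])
        show "Scalar (\<xi> (r \<odot>\<^bsub>cmp ?I i\<^esub> x)) = r \<odot>\<^bsub>cmp ?KO i\<^esub> Scalar (\<xi> x)" if "r \<in> carrier B" for r
          using \<xi>D(3)[OF Ic[OF x] that] by (simp add: koszul_simps(6))
        show "Scalar (\<xi> (x \<oplus>\<^bsub>cmp ?I i\<^esub> y)) = Scalar (\<xi> x) \<oplus>\<^bsub>cmp ?KO i\<^esub> Scalar (\<xi> y)"
          if "y \<in> carrier (cmp ?I i)" for y
          using \<xi>D(2)[OF Ic[OF x] Ic[OF that]] by (simp add: koszul_simps(5))
      qed
      from pair_hom[OF this uD(1)] show "?u i \<in> module_hom B (cmp ?I i) (cmp ?Q i)"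
        unfolding cQ .
      fix x assume x: "x \<in> carrier (cmp ?I i)"
      show "?u (i - 1) (hty ?I i x) = hty ?Q i (?u i x)"
        unfolding hQ[OF \<xi>c[OF x]] using uD(2)[OF x, of "i - 1"] by (simp add: koszul_simps \<xi>0)
      show "?u (i + 1) (dif ?I i x) = dif ?Q i (?u i x)"
        unfolding dQ[OF \<xi>c[OF x] uc[OF x]]
        using uD(3)[OF x, of "i + 1"] \<xi>D(3)[OF Ic[OF x] assms(2)] by (simp add: koszul_simps \<xi>0)
    qed
    have 2: "?v \<in> cocycles B ?Q ?I"
    proof (rule cocyclesI[OF I])
      fix i
      have sc: "scalar k \<odot>\<^bsub>P\<^esub> e \<in> carrier (cmp ?I i)" if "k \<in> carrier (cmp (?KO) i)" for k
        using that e by (auto simp: koszul_simps split: if_splits)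
      have "(\<lambda>k. scalar k \<odot>\<^bsub>P\<^esub> e) \<in> module_hom B (cmp (?KO) i) (cmp ?I i)"
        using e sc by (intro module_homI) (auto simp: koszul_simps smult_l_distr smult_assoc1 split: if_splits)
      from module_hom_add[OF module_hom_comp[OF component_pair_hom(1) this]
          module_hom_comp[OF component_pair_hom(2) vD(1)] mI]
      have "(\<lambda>z. scalar (component z 0) \<odot>\<^bsub>P\<^esub> e \<oplus>\<^bsub>cmp ?I i\<^esub> v i (component z 1))
          \<in> module_hom B (cmp ?Q i) (cmp ?I i)"
        unfolding cQ .
      moreover have "x \<oplus>\<^bsub>cmp ?I i\<^esub> y = x \<oplus>\<^bsub>P\<^esub> y" for x y by simp
      ultimately show "?v i \<in> module_hom B (cmp ?Q i) (cmp ?I i)" by (simp only:)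
      fix z assume "z \<in> carrier (cmp ?Q i)"
      then obtain k q where kq: "k \<in> carrier (cmp (?KO) i)" "q \<in> carrier (cmp Q i)" "z = pair k q"
        unfolding cQ by (rule pair_moduleE)
      obtain b where b: "k = Scalar b" "b \<in> carrier B" using kq(1) by (auto simp: koszul_simps split: if_splits)
      have vq: "v i q \<in> carrier P" by (rule Ic[OF vc[OF kq(2)]])
      show "?v (i - 1) (hty ?Q i z) = hty ?I i (?v i z)"
        unfolding kq(3) hQ[OF kq(1)] component_pair
        using vD(2)[OF kq(2), of "i - 1"] e vq b by (simp add: koszul_simps)
      show "?v (i + 1) (dif ?Q i z) = dif ?I i (?v i z)"
        unfolding kq(3) dQ[OF kq(1,2)] component_pair
        using vD(3)[OF kq(2), of "i + 1"] e vq b assms(2)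
        by (auto simp: koszul_simps smult_r_distr smult_assoc1)
    qed
    have 3: "\<forall>i. \<forall>x\<in>carrier (cmp ?I i). ?v i (?u i x) = lin_comb P (p # l) x"
      using vu by (simp add: \<xi>_def e_def)
    show ?case using Qp Qk 1 2 3 by blast
  qed
  then obtain Q u v where Q: "Q \<in> perf B f" "Q \<in> kdg_mod B f" and u: "u \<in> cocycles B ?I Q"
    and v: "v \<in> cocycles B Q ?I"
    and vu: "\<And>i x. x \<in> carrier (cmp ?I i) \<Longrightarrow> v i (u i x) = lin_comb P l x"
    by fastforce
  show ?thesis
  proof (rule perf_retract[OF Q(1) I Q(2) u v])
    fix i x assume x: "x \<in> carrier (cmp ?I i)"
    then have "x \<in> carrier P" by (auto split: if_splits)
    then show "v i (u i x) = x" using vu[OF x] l(2) by simp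
  qed
qed


text \<open>What is split off consists of \<open>cmp N a\<close> and its image under \<sigma>, a
  complement of the kernel of \<open>hty\<close> in degree a + 1. The remainder is closed under
  \<open>dif\<close> because everything from degree a + 2 on is kept, and under \<open>hty\<close>
  because \<open>hty\<close> squares to zero.\<close>

definition peeled :: "('b, 'm) kdg \<Rightarrow> int \<Rightarrow> int \<Rightarrow> 'm set" where
  "peeled N a i = (if i \<le> a then {\<zero>\<^bsub>cmp N i\<^esub>}
     else if i = a + 1 then {x \<in> carrier (cmp N i). hty N i x = \<zero>\<^bsub>cmp N a\<^esub>}
     else carrier (cmp N i))"

text \<open>The contraction \<open>\<sigma>\<close> of \<open>hty\<close> exhibits the module as projective over \<open>B[\<epsilon>]\<close>. Peeling off the
  bottom degree \<open>a\<close> writes it as a cone over a map from a shift of the module induced from degree \<open>a\<close>.\<close>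

lemma perf_contractible_step:
  fixes N :: "('b, ('b, 'x) univ) kdg"
  assumes B: "cring B" "f \<in> carrier B" and N: "N \<in> kdg_mod B f"
    and fg: "\<And>i. fg_projective B (cmp N i)" and low: "\<And>i. i < a \<Longrightarrow> carrier (cmp N i) = {\<zero>\<^bsub>cmp N i\<^esub>}"
    and \<sigma>: "\<And>i. \<sigma> i \<in> module_hom B (cmp N i) (cmp N (i + 1))"
    and contr: "\<And>i x. x \<in> carrier (cmp N i) \<Longrightarrow>
      hty N (i + 1) (\<sigma> i x) \<oplus>\<^bsub>cmp N i\<^esub> \<sigma> (i - 1) (hty N i x) = x"
  shows "sub_kdg N (peeled N a) \<in> kdg_mod B f" and "\<And>i. fg_projective B (cmp (sub_kdg N (peeled N a)) i)"
    and "\<And>i. \<sigma> i \<in> module_hom B (cmp (sub_kdg N (peeled N a)) i) (cmp (sub_kdg N (peeled N a)) (i + 1))"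
    and "sub_kdg N (peeled N a) \<in> perf B f \<Longrightarrow> N \<in> perf B f"
proof -
  let ?S = "peeled N a"
  note S_def = peeled_def[of N a]
  let ?N = "sub_kdg N ?S"
  note mN = kdg_modD(1)[OF N] and cN = kdg_closed[OF N]
  have ms: "x \<oplus>\<^bsub>cmp N i\<^esub> y \<in> carrier (cmp N i)" if "x \<in> carrier (cmp N i)" "y \<in> carrier (cmp N i)" for x y i
    using module_simps(3)[OF mN that] .
  have z: "\<zero>\<^bsub>cmp N i\<^esub> \<in> carrier (cmp N i)" for i using module_simps(2)[OF mN] .
  have Sc: "?S i \<subseteq> carrier (cmp N i)" for i by (auto simp: S_def z)
  have low0: "x = \<zero>\<^bsub>cmp N i\<^esub>" if "x \<in> carrier (cmp N i)" "i < a" for x i using low[OF that(2)] that(1) by blast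
  note h0 = kdg_simps(2)[OF N] and d0 = kdg_simps(1)[OF N]
  show N': "?N \<in> kdg_mod B f"
  proof (rule sub_kdg_mod[OF N Sc])
    show "\<zero>\<^bsub>cmp N i\<^esub> \<in> ?S i" for i using h0[of "a + 1"] by (auto simp: S_def z)
    show "x \<oplus>\<^bsub>cmp N i\<^esub> y \<in> ?S i" if "x \<in> ?S i" "y \<in> ?S i" for i x y
      using that kdg_simps(6)[OF N, of x i y] module_simps(6)[OF mN z] ms[of x i y]
      by (auto simp: S_def split: if_splits)
    show "r \<odot>\<^bsub>cmp N i\<^esub> x \<in> ?S i" if "r \<in> carrier B" "x \<in> ?S i" for i r x
      using that kdg_simps(10)[OF N that(1), of x i] module_simps(11,12)[OF mN that(1)]
      by (auto simp: S_def split: if_splits)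
    show "dif N i x \<in> ?S (i + 1)" if "x \<in> ?S i" for i x
      using that cN(1)[of x i] d0[of i] h0[of "i + 1"] z by (auto simp: S_def split: if_splits)
    show "hty N i x \<in> ?S (i - 1)" if "x \<in> ?S i" for i x
      using that cN(2)[of x i] h0[of i] kdg_square(2)[OF N, of x i "i - 1"] by (auto simp: S_def split: if_splits)
  qed
  \<comment> \<open>On the kernel of \<open>hty\<close> the second term of the contraction identity
    vanishes, so \<sigma> is a section of \<open>hty\<close> there.\<close>
  have hs: "hty N (i + 1) (\<sigma> i x) = x" if "x \<in> carrier (cmp N i)" "hty N i x = \<zero>\<^bsub>cmp N (i - 1)\<^esub>" for i x
    using contr[OF that(1)] that(2) module_hom_simps(1)[OF \<sigma> mN mN, of "i - 1"]
      kdg_closed(2)[OF N module_homD(1)[OF \<sigma> that(1)]] module_simps(7)[OF mN, of _ i] by simp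
  have \<sigma>c: "\<sigma> i x \<in> carrier (cmp N (i + 1))" if "x \<in> carrier (cmp N i)" for i x by (rule module_homD(1)[OF \<sigma> that])
  have \<sigma>0: "\<sigma> i \<zero>\<^bsub>cmp N i\<^esub> = \<zero>\<^bsub>cmp N (i + 1)\<^esub>" for i by (rule module_hom_simps(1)[OF \<sigma> mN mN])
  show \<sigma>': "\<sigma> i \<in> module_hom B (cmp ?N i) (cmp ?N (i + 1))" for i
  proof (rule module_homI)
    fix x assume "x \<in> carrier (cmp ?N i)"
    then have x: "x \<in> ?S i" by simp
    then show "\<sigma> i x \<in> carrier (cmp ?N (i + 1))"
      using \<sigma>c[of x i] \<sigma>0[of i] h0[of "i + 1"] z by (auto simp: S_def split: if_splits)
  next
    fix x y assume "x \<in> carrier (cmp ?N i)" "y \<in> carrier (cmp ?N i)"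
    then show "\<sigma> i (x \<oplus>\<^bsub>cmp ?N i\<^esub> y) = \<sigma> i x \<oplus>\<^bsub>cmp ?N (i + 1)\<^esub> \<sigma> i y"
      using module_homD(2)[OF \<sigma>, of x i y] Sc by auto
  next
    fix r x assume "r \<in> carrier B" "x \<in> carrier (cmp ?N i)"
    then show "\<sigma> i (r \<odot>\<^bsub>cmp ?N i\<^esub> x) = r \<odot>\<^bsub>cmp ?N (i + 1)\<^esub> \<sigma> i x"
      using module_homD(3)[OF \<sigma>, of r x i] Sc by auto
  qed
  show "fg_projective B (cmp ?N i)" for i
  proof -
    consider "i \<le> a" | "i = a + 1" | "i > a + 1" by linarith
    then show ?thesis
    proof cases
      case 1
      then show ?thesis
        using kdg_modD(1)[OF N', of i] by (intro fg_projectiveI[OF B(1), where l = "[]"]) (auto simp: S_def)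
    next
      case 2
      have s: "(\<lambda>x. x) \<in> module_hom B (cmp ?N i) (cmp N i)" using Sc by (auto simp: module_hom_def)
      \<comment> \<open>In degree a + 1 the map x - \<sigma> h x projects onto the kernel of h,
        since h \<sigma> is the identity on the image of h. This makes the kernel a direct
        summand.\<close>
      have "(\<lambda>x. \<sigma> a (hty N i x)) \<in> module_hom B (cmp N i) (cmp N i)"
        using module_hom_comp[OF kdg_modD(3)[OF N, of i] \<sigma>] 2 by simp
      note q = module_hom_diff[OF module_hom_id this mN]
      have qS: "x \<ominus>\<^bsub>cmp N i\<^esub> \<sigma> a (hty N i x) \<in> ?S i" if x: "x \<in> carrier (cmp N i)" for x
      proof -
        have hx: "hty N i x \<in> carrier (cmp N a)" using cN(2)[OF x] 2 by simp
        have "hty N (a + 1) (\<sigma> a (hty N i x)) = hty N i x"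
          using hs[OF hx] kdg_square(2)[OF N x, of a] 2 by simp
        then have "hty N i (x \<ominus>\<^bsub>cmp N i\<^esub> \<sigma> a (hty N i x)) = hty N i x \<ominus>\<^bsub>cmp N a\<^esub> hty N i x"
          using kdg_simps(8)[OF N x, of "\<sigma> a (hty N i x)"] \<sigma>c[OF hx] 2 by simp
        then show ?thesis
          using minus_eq_zero_iff[OF mN hx hx] module_homD(1)[OF q x] 2 by (simp add: S_def)
      qed
      have q': "(\<lambda>x. x \<ominus>\<^bsub>cmp N i\<^esub> \<sigma> a (hty N i x)) \<in> module_hom B (cmp N i) (cmp ?N i)"
        using module_homD(2,3)[OF q] qS by (intro module_homI) simp_all
      show ?thesis
      proof (rule fg_projective_retract[OF B(1) fg kdg_modD(1)[OF N'] s q'])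
        fix x assume "x \<in> carrier (cmp ?N i)"
        then have "x \<in> carrier (cmp N i)" "hty N i x = \<zero>\<^bsub>cmp N a\<^esub>" using 2 by (auto simp: S_def)
        then show "x \<ominus>\<^bsub>cmp N i\<^esub> \<sigma> a (hty N i x) = x" using \<sigma>0[of a] module_simps(8)[OF mN] 2 by simp
      qed
    next
      case 3
      then show ?thesis using fg[of i] by (simp add: S_def)
    qed
  qed
  assume pN': "?N \<in> perf B f"
  let ?P = "cmp N a"
  \<comment> \<open>The induced module occupies degrees -1 and 0; this shift moves it to a + 1 and a
    + 2, and the cone lowers it to a and a + 1, where the split-off piece lives.\<close>
  let ?C = "dg_shift (induced B f ?P) (- a - 2)"
  \<comment> \<open>The shift multiplies the structure maps by the sign of a, and the cone
    contributes a further -1. This is the product of the two signs.\<close>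
  define sg where "sg x = (if odd a then x else \<ominus>\<^bsub>?P\<^esub> x)" for x
  have sgc: "sg x \<in> carrier ?P" if "x \<in> carrier ?P" for x
    using that module_simps(5)[OF mN] by (simp add: sg_def)
  have sgsg: "sg (sg x) = x" if "x \<in> carrier ?P" for x
    using that module_simps(9)[OF mN that] by (simp add: sg_def)
  have sg_hom: "sg \<in> module_hom B ?P ?P"
    unfolding sg_def using module_hom_minus[OF module_hom_id mN[of a]] by (cases "odd a") (auto intro: module_hom_id)
  have sgf: "sg (f \<odot>\<^bsub>?P\<^esub> x) = f \<odot>\<^bsub>?P\<^esub> sg x" if "x \<in> carrier ?P" for x
    by (rule module_homD(3)[OF sg_hom B(2) that])
  have I: "induced B f ?P \<in> kdg_mod B f" by (rule induced_kdg_mod[OF mN B(2)])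
  have C: "?C \<in> kdg_mod B f" by (rule dg_shift_kdg_mod[OF I])
  have pC: "?C \<in> perf B f" by (rule perf.shift[OF induced_perf[OF B fg]])
  note mC = kdg_modD(1)[OF C]
  have cC: "cmp ?C i = ?P\<lparr>carrier := if i = a + 1 \<or> i = a + 2 then carrier ?P else {\<zero>\<^bsub>?P\<^esub>}\<rparr>" for i
  proof -
    have "(i + (- a - 2) = - 1) = (i = a + 1)" "(i + (- a - 2) = 0) = (i = a + 2)" by auto
    then show ?thesis by (simp only: dg_shift_simps induced_simps)
  qed
  have neg: "\<ominus>\<^bsub>cmp ?C i\<^esub> x = \<ominus>\<^bsub>?P\<^esub> x" if "x \<in> carrier (cmp ?C i)" for i x
    using sub_minus[OF mN[of a], where S = "if i = a + 1 \<or> i = a + 2 then carrier ?P else {\<zero>\<^bsub>?P\<^esub>}" and x = x]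
      mC[of i] that z[of a] unfolding cC by (auto split: if_splits)
  have par: "even (- a - 2) = even a" by simp
  have sg0: "sg \<zero>\<^bsub>?P\<^esub> = \<zero>\<^bsub>?P\<^esub>" by (rule module_hom_simps(1)[OF sg_hom mN mN])
  have sg_minus: "sg (\<ominus>\<^bsub>?P\<^esub> x) = \<ominus>\<^bsub>?P\<^esub> sg x" if "x \<in> carrier ?P" for x
    by (rule module_hom_simps(2)[OF sg_hom mN mN that])
  have cP: "c \<in> carrier ?P" if "c \<in> carrier (cmp ?C i)" for c i
    using that z unfolding cC by (auto split: if_splits)
  have C0: "c = \<zero>\<^bsub>?P\<^esub>" if "c \<in> carrier (cmp ?C i)" "i \<noteq> a + 1" "i \<noteq> a + 2" for c i
    using that unfolding cC by auto
  have signed_C: "signed (cmp ?C i) (- a - 2) y = \<ominus>\<^bsub>?P\<^esub> sg y" "\<ominus>\<^bsub>cmp ?C i\<^esub> (\<ominus>\<^bsub>?P\<^esub> sg y) = sg y"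
    if y: "y \<in> carrier (cmp ?C i)" for i y
  proof -
    note m = module_simps(5,9)[OF mC y]
    show 1: "signed (cmp ?C i) (- a - 2) y = \<ominus>\<^bsub>?P\<^esub> sg y"
      using neg[OF y] module_simps(9)[OF mN cP[OF y]] by (simp add: signed_def sg_def par del: dg_shift_simps)
    have "signed (cmp ?C i) (- a - 2) y \<in> carrier (cmp ?C i)"
      using m(1) y by (simp add: signed_def del: dg_shift_simps)
    then show "\<ominus>\<^bsub>cmp ?C i\<^esub> (\<ominus>\<^bsub>?P\<^esub> sg y) = sg y"
      using neg[of "\<ominus>\<^bsub>?P\<^esub> sg y" i] module_simps(9)[OF mN sgc[OF cP[OF y]]] unfolding 1 by simp
  qed
  have yd: "(if i = a + 1 then f \<odot>\<^bsub>?P\<^esub> c else \<zero>\<^bsub>?P\<^esub>) \<in> carrier (cmp ?C (i + 1))"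
    if "c \<in> carrier (cmp ?C i)" for i c
    using module_simps(11)[OF mN B(2) cP[OF that]] z[of a] unfolding cC by auto
  have yh: "(if i = a + 2 then c else \<zero>\<^bsub>?P\<^esub>) \<in> carrier (cmp ?C (i - 1))"
    if "c \<in> carrier (cmp ?C i)" for i c
    using cP[OF that] z[of a] unfolding cC by auto
  have dC: "dif ?C i c = \<ominus>\<^bsub>?P\<^esub> sg (if i = a + 1 then f \<odot>\<^bsub>?P\<^esub> c else \<zero>\<^bsub>?P\<^esub>)"
    if "c \<in> carrier (cmp ?C i)" for i c
  proof -
    have "i + 1 + (- a - 2) = i + (- a - 2) + 1" "(i + (- a - 2) = - 1) = (i = a + 1)" by auto
    then have "dif ?C i c = signed (cmp ?C (i + 1)) (- a - 2) (if i = a + 1 then f \<odot>\<^bsub>?P\<^esub> c else \<zero>\<^bsub>?P\<^esub>)"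
      by (simp only: dg_shift_simps induced_simps)
    then show ?thesis using signed_C(1)[OF yd[OF that]] by simp
  qed
  have hC: "hty ?C i c = \<ominus>\<^bsub>?P\<^esub> sg (if i = a + 2 then c else \<zero>\<^bsub>?P\<^esub>)"
    if "c \<in> carrier (cmp ?C i)" for i c
  proof -
    have "i - 1 + (- a - 2) = i + (- a - 2) - 1" "(i + (- a - 2) = 0) = (i = a + 2)" by auto
    then have "hty ?C i c = signed (cmp ?C (i - 1)) (- a - 2) (if i = a + 2 then c else \<zero>\<^bsub>?P\<^esub>)"
      by (simp only: dg_shift_simps induced_simps)
    then show ?thesis using signed_C(1)[OF yh[OF that]] by simp
  qed
  \<comment> \<open>Since h vanishes in degree a, one has h d x = f x there. Hence this is d x -
    \<sigma> h d x, the component of d x in the kernel of h.\<close>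
  define g where "g x = dif N a x \<ominus>\<^bsub>cmp N (a + 1)\<^esub> \<sigma> a (f \<odot>\<^bsub>?P\<^esub> x)" for x
  have g_hom: "g \<in> module_hom B ?P (cmp N (a + 1))"
    unfolding g_def using module_hom_smult[OF module_hom_id mN[of a] B(2)]
    by (intro module_hom_diff kdg_modD(2)[OF N] module_hom_comp[OF _ \<sigma>] mN)
  note gc = module_homD(1)[OF g_hom]
  have hP: "hty N a x = \<zero>\<^bsub>cmp N (a - 1)\<^esub>" if "x \<in> carrier ?P" for x
    by (rule low0[OF cN(2)[OF that]]) simp
  have hsP: "hty N (a + 1) (\<sigma> a x) = x" if "x \<in> carrier ?P" for x
    by (rule hs[OF that hP[OF that]])
  have fc: "f \<odot>\<^bsub>?P\<^esub> x \<in> carrier ?P" if "x \<in> carrier ?P" for x by (rule module_simps(11)[OF mN B(2) that])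
  have \<sigma>f: "\<sigma> a (f \<odot>\<^bsub>?P\<^esub> x) = f \<odot>\<^bsub>cmp N (a + 1)\<^esub> \<sigma> a x" if "x \<in> carrier ?P" for x
    by (rule module_homD(3)[OF \<sigma> B(2) that])
  have hd: "hty N (a + 1) (dif N a x) = f \<odot>\<^bsub>?P\<^esub> x" if x: "x \<in> carrier ?P" for x
    using kdg_modD(6)[OF N x] hP[OF x] d0[of "a - 1"] module_simps(6)[OF mN cN(4)[OF x]] by simp
  have hg: "hty N (a + 1) (g x) = \<zero>\<^bsub>?P\<^esub>" if x: "x \<in> carrier ?P" for x
    using kdg_simps(8)[OF N cN(1)[OF x] \<sigma>c[OF fc[OF x]]] hd[OF x] hsP[OF fc[OF x]]
      minus_eq_zero_iff[OF mN fc[OF x] fc[OF x]] by (simp add: g_def)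
  have ixa: "a + 1 + 1 = a + 2" "a + 1 - 1 = a" by simp_all
  have hd\<sigma>: "hty N (a + 2) (dif N (a + 1) (\<sigma> a x)) = \<ominus>\<^bsub>cmp N (a + 1)\<^esub> g x" if x: "x \<in> carrier ?P" for x
  proof -
    note c = kdg_closed[OF N \<sigma>c[OF x]]
    have "dif N a x \<oplus>\<^bsub>cmp N (a + 1)\<^esub> hty N (a + 2) (dif N (a + 1) (\<sigma> a x)) = \<sigma> a (f \<odot>\<^bsub>?P\<^esub> x)"
      using kdg_modD(6)[OF N \<sigma>c[OF x], unfolded ixa] by (simp add: hsP[OF x] \<sigma>f[OF x])
    moreover have "hty N (a + 2) (dif N (a + 1) (\<sigma> a x)) = \<ominus>\<^bsub>cmp N (a + 1)\<^esub>
      (dif N a x \<ominus>\<^bsub>cmp N (a + 1)\<^esub> (dif N a x \<oplus>\<^bsub>cmp N (a + 1)\<^esub> hty N (a + 2) (dif N (a + 1) (\<sigma> a x))))"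
      by (rule lin_eqI[OF module_abelian_group[OF mN[of "a + 1"]]],
          (rule lin_rules | (rule lin_atom, (simp add: cN(1)[OF x] c(4); fail)))+, simp)
    ultimately show ?thesis by (simp add: g_def)
  qed
  \<comment> \<open>The attaching map is the component of d from the split-off piece into the peeled
    submodule: \<open>g\<close> on the bottom degree, and d \<sigma> on its complement one degree
    higher. The sign on the bottom degree is the same as in the comparison map \<open>s\<close>
    below.\<close>
  define \<delta> where "\<delta> i c = (if i = a + 1 then g (sg c) else if i = a + 2 then dif N (a + 1) (\<sigma> a c) else \<zero>\<^bsub>cmp N i\<^esub>)" for i c
  have d\<sigma>_hom: "(\<lambda>c. dif N (a + 1) (\<sigma> a c)) \<in> module_hom B ?P (cmp N (a + 2))"
    using module_hom_comp[OF \<sigma> kdg_modD(2)[OF N], of a] by (simp add: add.commute)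
  have C_hom: "\<psi> \<in> module_hom B (cmp ?C i) M" if "\<psi> \<in> module_hom B ?P M" for \<psi> i M
    using that cP[of _ i] unfolding module_hom_def by (auto simp: cC Pi_iff)
  have into_N': "\<psi> \<in> module_hom B M (cmp ?N i)"
    if "\<psi> \<in> module_hom B M (cmp N i)" "\<And>x. x \<in> carrier M \<Longrightarrow> \<psi> x \<in> ?S i" for \<psi> i and M :: "('b, ('b, 'x) univ) module"
    using that unfolding module_hom_def by auto
  have \<delta>0: "\<delta> i \<zero>\<^bsub>?P\<^esub> = \<zero>\<^bsub>cmp N i\<^esub>" for i
    using sg0 module_hom_simps(1)[OF g_hom mN mN] module_hom_simps(1)[OF d\<sigma>_hom mN mN] by (simp add: \<delta>_def)
  have \<delta>: "\<delta> \<in> cocycles B ?C ?N"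
  proof (rule cocyclesI[OF N'])
    fix i
    consider "i = a + 1" | "i = a + 2" | "i \<noteq> a + 1 \<and> i \<noteq> a + 2" by blast
    note cs = this
    have "\<delta> i \<in> module_hom B (cmp ?C i) (cmp N i)"
      using cs C_hom[OF module_hom_comp[OF sg_hom g_hom], of i] C_hom[OF d\<sigma>_hom, of i]
        module_hom_zero[OF mN, of i "cmp ?C i"] by cases (simp_all add: \<delta>_def[abs_def] del: dg_shift_simps)
    moreover have "\<delta> i x \<in> ?S i" if "x \<in> carrier (cmp ?C i)" for x
      using cs
    proof cases
      case 1
      then show ?thesis using gc[OF sgc[OF cP[OF that]]] hg[OF sgc[OF cP[OF that]]] by (simp add: \<delta>_def S_def)
    next
      case 2
      then show ?thesis using module_homD(1)[OF d\<sigma>_hom cP[OF that]] by (simp add: \<delta>_def S_def)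
    next
      case 3
      then show ?thesis using h0[of "a + 1"] z by (auto simp: \<delta>_def S_def)
    qed
    ultimately show "\<delta> i \<in> module_hom B (cmp ?C i) (cmp ?N i)" by (rule into_N')
    fix c assume c: "c \<in> carrier (cmp ?C i)"
    note cp = cP[OF c]
    show "\<delta> (i - 1) (hty ?C i c) = hty ?N i (\<delta> i c)"
      using cs
    proof cases
      case 1
      then show ?thesis using hg[OF sgc[OF cp]] \<delta>0[of a] module_simps(10)[OF mN]
        unfolding hC[OF c] by (simp add: sg0) (simp add: \<delta>_def)
    next
      case 2
      then show ?thesis
        using hd\<sigma>[OF cp] sg_minus[OF sgc[OF cp]] sgsg[OF cp] module_hom_simps(2)[OF g_hom mN mN cp]
        unfolding hC[OF c] by (simp add: \<delta>_def)
    next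
      case 3
      then show ?thesis
        using \<delta>0[of "i - 1"] h0[of i] module_simps(10)[OF mN]
        unfolding hC[OF c] by (simp add: sg0) (simp add: \<delta>_def)
    qed
    show "\<delta> (i + 1) (dif ?C i c) = dif ?N i (\<delta> i c)"
      using cs
    proof cases
      case 1
      have 2: "dif N (a + 1) (g (sg c)) = \<ominus>\<^bsub>cmp N (a + 2)\<^esub> dif N (a + 1) (\<sigma> a (f \<odot>\<^bsub>?P\<^esub> sg c))"
        using kdg_simps(7)[OF N cN(1)[OF sgc[OF cp]] \<sigma>c[OF fc[OF sgc[OF cp]]]]
          kdg_square(1)[OF N sgc[OF cp], of "a + 1"] kdg_closed(1)[OF N \<sigma>c[OF fc[OF sgc[OF cp]]]]
          module_simps(6)[OF mN[of "a + 2"]] module_simps(5)[OF mN[of "a + 2"]]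
        by (simp add: g_def a_minus_def add.commute)
      have "\<delta> (a + 2) (\<ominus>\<^bsub>?P\<^esub> sg (f \<odot>\<^bsub>?P\<^esub> c)) = \<ominus>\<^bsub>cmp N (a + 2)\<^esub> dif N (a + 1) (\<sigma> a (f \<odot>\<^bsub>?P\<^esub> sg c))"
        using module_hom_simps(2)[OF d\<sigma>_hom mN mN fc[OF sgc[OF cp]]] sgf[OF cp] by (simp add: \<delta>_def)
      then show ?thesis using 1 2 unfolding dC[OF c] by (simp add: \<delta>_def)
    next
      case 2
      then show ?thesis
        using kdg_square(1)[OF N \<sigma>c[OF cp], of "a + 2"] \<delta>0[of "a + 3"] module_simps(10)[OF mN]
        unfolding dC[OF c] by (simp add: sg0 add.commute) (simp add: \<delta>_def add.commute)
    next
      case 3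
      then show ?thesis
        using \<delta>0[of "i + 1"] d0[of i] module_simps(10)[OF mN]
        unfolding dC[OF c] by (simp add: sg0) (simp add: \<delta>_def)
    qed
  qed
  let ?D = "dg_cone ?C ?N \<delta>"
  have D: "?D \<in> kdg_mod B f" by (rule dg_cone_kdg_mod[OF C N' \<delta>])
  have pD: "?D \<in> perf B f" by (rule perf.cone[OF pC pN' \<delta>])
  \<comment> \<open>The split-off piece inside \<open>N\<close>: the bottom degree itself and its
    image under \<sigma>. Twisting the first by \<open>sg\<close> absorbs the sign computed above,
    since h then takes \<sigma> c back to c.\<close>
  define s where "s i c = (if i = a then sg c else if i = a + 1 then \<sigma> a c else \<zero>\<^bsub>cmp N i\<^esub>)" for i c
  have s_hom: "s i \<in> module_hom B (cmp ?C (i + 1)) (cmp N i)" for i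
  proof -
    consider "i = a" | "i = a + 1" | "i \<noteq> a \<and> i \<noteq> a + 1" by blast
    then show ?thesis
      using C_hom[OF sg_hom, of "i + 1"] C_hom[OF \<sigma>, of "i + 1"] module_hom_zero[OF mN, of i "cmp ?C (i + 1)"]
      by cases (simp_all add: s_def[abs_def] del: dg_shift_simps)
  qed
  note sc = module_homD(1)[OF s_hom]
  have s0: "s i \<zero>\<^bsub>?P\<^esub> = \<zero>\<^bsub>cmp N i\<^esub>" for i using sg0 \<sigma>0[of a] by (simp add: s_def)
  \<comment> \<open>Degreewise this is the decomposition of \<open>N\<close> into the split-off and
    the peeled part, hence a bijective closed morphism from the cone.\<close>
  let ?v = "\<lambda>i z. s i (component z 0) \<oplus>\<^bsub>cmp N i\<^esub> component z 1"
  have inc: "(\<lambda>x. x) \<in> module_hom B (cmp ?N i) (cmp N i)" for i using Sc by (auto simp: module_hom_def)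
  have cD: "cmp ?D i = pair_module (cmp ?C (i + 1)) (cmp ?N i)" for i by (rule dg_cone_simps)
  have yc: "y \<in> carrier (cmp N i)" if "y \<in> carrier (cmp ?N i)" for y i using that Sc by auto
  have ya: "y = \<zero>\<^bsub>cmp N i\<^esub>" if "y \<in> carrier (cmp ?N i)" "i \<le> a" for y i using that by (simp add: S_def)
  have hy0: "hty N (a + 1) y = \<zero>\<^bsub>?P\<^esub>" if "y \<in> carrier (cmp ?N (a + 1))" for y using that by (simp add: S_def)
  have hv: "hty N (a + 1) (\<sigma> a c \<oplus>\<^bsub>cmp N (a + 1)\<^esub> y) = c"
    if "c \<in> carrier ?P" "y \<in> carrier (cmp ?N (a + 1))" for c y
    using kdg_simps(6)[OF N \<sigma>c[OF that(1)] yc[OF that(2)]] hsP[OF that(1)] hy0[OF that(2)] module_simps(7)[OF mN that(1)] by simp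
  have v: "?v \<in> cocycles B ?D N"
  proof (rule cocyclesI[OF N])
    fix i
    from module_hom_add[OF module_hom_comp[OF component_pair_hom(1) s_hom] module_hom_comp[OF component_pair_hom(2) inc] mN]
    show "?v i \<in> module_hom B (cmp ?D i) (cmp N i)" unfolding cD .
    fix w assume "w \<in> carrier (cmp ?D i)"
    then obtain c y where c: "c \<in> carrier (cmp ?C (i + 1))" and y: "y \<in> carrier (cmp ?N i)" and w: "w = pair c y"
      unfolding cD by (rule pair_moduleE)
    note cp = cP[OF c] and yN = yc[OF y]
    have ix: "i + 1 - 1 = i" "i + 1 + 1 = i + 2" "i - 1 + 1 = i" "(i + 1 = a + 1) = (i = a)" "(i + 1 = a + 2) = (i = a + 1)" by auto
    have h: "hty ?D i w = pair (sg (if i = a + 1 then c else \<zero>\<^bsub>?P\<^esub>)) (hty N i y)"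
      unfolding w dg_cone_simps hC[OF c]
      using signed_C(2)[OF yh[OF c]] by (simp only: ix sub_kdg_simps)
    have d: "dif ?D i w = pair (sg (if i = a then f \<odot>\<^bsub>?P\<^esub> c else \<zero>\<^bsub>?P\<^esub>)) (\<delta> (i + 1) c \<oplus>\<^bsub>cmp N (i + 1)\<^esub> dif N i y)"
      unfolding w dg_cone_simps dC[OF c]
      using signed_C(2)[OF yd[OF c]] by (simp add: ix del: dg_shift_simps)
    show "?v (i - 1) (hty ?D i w) = hty N i (?v i w)"
    proof -
      consider "i = a" | "i = a + 1" | "i \<noteq> a \<and> i \<noteq> a + 1" by blast
      then show ?thesis
      proof cases
        case 1
        then have "hty N i y = \<zero>\<^bsub>cmp N (i - 1)\<^esub>" "hty N i (s i c \<oplus>\<^bsub>cmp N i\<^esub> y) = \<zero>\<^bsub>cmp N (i - 1)\<^esub>"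
          using low0[OF cN(2)[OF yN]] low0[OF cN(2)[OF ms[OF sc[OF c] yN]]] by auto
        then show ?thesis using s0[of "i - 1"] module_simps(6)[OF mN z] 1
          unfolding h unfolding w component_pair by (simp add: sg0)
      next
        case 2
        then have "hty N i y = \<zero>\<^bsub>?P\<^esub>" "hty N i (s i c \<oplus>\<^bsub>cmp N i\<^esub> y) = c"
          using hy0 hv[OF cp] y by (simp_all add: s_def)
        then show ?thesis using module_simps(7)[OF mN cp] 2
          unfolding h unfolding w component_pair by (simp add: s_def sgsg[OF cp])
      next
        case 3
        then have "s i c = \<zero>\<^bsub>cmp N i\<^esub>" by (simp add: s_def)
        then show ?thesis using s0[of "i - 1"] module_simps(6)[OF mN] yN cN(2)[OF yN] 3
          unfolding h unfolding w component_pair by (simp add: sg0)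
      qed
    qed
    show "?v (i + 1) (dif ?D i w) = dif N i (?v i w)"
    proof -
      have ds: "dif N i (s i c \<oplus>\<^bsub>cmp N i\<^esub> y) = dif N i (s i c) \<oplus>\<^bsub>cmp N (i + 1)\<^esub> dif N i y"
        by (rule kdg_simps(5)[OF N sc[OF c] yN])
      note cy = cN(1)[OF yN]
      consider "i = a" | "i = a + 1" | "i \<noteq> a \<and> i \<noteq> a + 1" by blast
      then show ?thesis
      proof cases
        case 1
        have "\<sigma> a (sg (f \<odot>\<^bsub>?P\<^esub> c)) \<oplus>\<^bsub>cmp N (a + 1)\<^esub> (g (sg c) \<oplus>\<^bsub>cmp N (a + 1)\<^esub> dif N i y)
            = dif N a (sg c) \<oplus>\<^bsub>cmp N (a + 1)\<^esub> dif N i y"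
          unfolding sgf[OF cp] g_def
          by (rule lin_eqI[OF module_abelian_group[OF mN]], (rule lin_rules | (rule lin_atom,
              (simp add: cN(1)[OF sgc[OF cp]] \<sigma>c[OF fc[OF sgc[OF cp]]] cy[unfolded 1] 1; fail)))+, simp)
        then show ?thesis unfolding d unfolding w component_pair using 1 ds by (simp add: s_def \<delta>_def)
      next
        case 2
        then have "\<delta> (i + 1) c \<oplus>\<^bsub>cmp N (i + 1)\<^esub> dif N i y = dif N i (s i c) \<oplus>\<^bsub>cmp N (i + 1)\<^esub> dif N i y"
          by (simp add: \<delta>_def s_def)
        then show ?thesis unfolding d unfolding w component_pair
          using 2 ds s0[of "i + 1"] module_simps(6)[OF mN ms[OF cN(1)[OF sc[OF c]] cy]] by (simp add: sg0)
      next
        case 3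
        then have "\<delta> (i + 1) c = \<zero>\<^bsub>cmp N (i + 1)\<^esub>" "s i c = \<zero>\<^bsub>cmp N i\<^esub>"
          by (simp_all add: \<delta>_def s_def)
        then show ?thesis unfolding d unfolding w component_pair
          using 3 ds s0[of "i + 1"] module_simps(6)[OF mN cy] d0[of i] by (simp add: sg0)
      qed
    qed
  qed
  show "N \<in> perf B f"
  proof (rule perf_quasi_iso[OF D N bij_quasi_iso[OF D N v] pD])
    fix i
    have cancel: "y = y'" if "s i c \<oplus>\<^bsub>cmp N i\<^esub> y = s i c \<oplus>\<^bsub>cmp N i\<^esub> y'"
      "c \<in> carrier (cmp ?C (i + 1))" "y \<in> carrier (cmp N i)" "y' \<in> carrier (cmp N i)" for c y y'
    proof -
      have "u = (s i c \<oplus>\<^bsub>cmp N i\<^esub> u) \<ominus>\<^bsub>cmp N i\<^esub> s i c" if "u \<in> carrier (cmp N i)" for u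
        by (rule lin_eqI[OF module_abelian_group[OF mN[of i]]],
            (rule lin_rules | (rule lin_atom, (simp add: that sc[OF \<open>c \<in> carrier (cmp ?C (i + 1))\<close>]; fail)))+, simp)
      then show ?thesis using that(1,3,4) by metis
    qed
    show "inj_on (?v i) (carrier (cmp ?D i))"
    proof (rule inj_onI)
      fix w w' assume "w \<in> carrier (cmp ?D i)" "w' \<in> carrier (cmp ?D i)" and eq: "?v i w = ?v i w'"
      then obtain c y c' y' where c: "c \<in> carrier (cmp ?C (i + 1))" "c' \<in> carrier (cmp ?C (i + 1))"
        and y: "y \<in> carrier (cmp ?N i)" "y' \<in> carrier (cmp ?N i)" and w: "w = pair c y" "w' = pair c' y'"
        unfolding cD by (elim pair_moduleE)
      note cp = cP[OF c(1)] cP[OF c(2)]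
      have eq: "s i c \<oplus>\<^bsub>cmp N i\<^esub> y = s i c' \<oplus>\<^bsub>cmp N i\<^esub> y'" using eq by (simp add: w)
      have "c = c'"
      proof -
        consider "i = a" | "i = a + 1" | "i \<noteq> a \<and> i \<noteq> a + 1" by blast
        then show ?thesis
        proof cases
          case 1
          then have "sg c = sg c'" using eq ya[OF y(1)] ya[OF y(2)] module_simps(7)[OF mN sgc[OF cp(1)]]
              module_simps(7)[OF mN sgc[OF cp(2)]] by (simp add: s_def)
          then show ?thesis using sgsg[OF cp(1)] sgsg[OF cp(2)] by metis
        next
          case 2
          then show ?thesis using eq hv[OF cp(1), of y] hv[OF cp(2), of y'] y by (simp add: s_def)
        next
          case 3
          then show ?thesis using C0[OF c(1)] C0[OF c(2)] by simp
        qed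
      qed
      then show "w = w'" using cancel[of c y y'] eq c(1) yc[OF y(1)] yc[OF y(2)] w by simp
    qed
    fix x assume x: "x \<in> carrier (cmp N i)"
    have "\<exists>c\<in>carrier (cmp ?C (i + 1)). \<exists>y\<in>carrier (cmp ?N i). s i c \<oplus>\<^bsub>cmp N i\<^esub> y = x"
    proof -
      consider "i = a" | "i = a + 1" | "i < a" | "i > a + 1" by linarith
      then show ?thesis
      proof cases
        case 1
        then show ?thesis
          using x sgc[of x] sgsg[of x] module_simps(7)[OF mN x] unfolding cC
          by (intro bexI[of _ "sg x"] bexI[of _ "\<zero>\<^bsub>cmp N i\<^esub>"]) (simp_all add: s_def S_def)
      next
        case 2
        have hx: "hty N i x \<in> carrier ?P" using cN(2)[OF x] 2 by simp
        have sx: "\<sigma> a (hty N i x) \<in> carrier (cmp N i)" using \<sigma>c[OF hx] 2 by simp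
        let ?y = "x \<ominus>\<^bsub>cmp N i\<^esub> \<sigma> a (hty N i x)"
        have "hty N i ?y = \<zero>\<^bsub>?P\<^esub>"
          using kdg_simps(8)[OF N x sx] hsP[OF hx] minus_eq_zero_iff[OF mN hx hx] 2 by simp
        then have "?y \<in> carrier (cmp ?N i)" using module_simps(4)[OF mN x sx] 2 by (simp add: S_def)
        moreover have "\<sigma> a (hty N i x) \<oplus>\<^bsub>cmp N i\<^esub> ?y = x"
          by (rule lin_eqI[OF module_abelian_group[OF mN[of i]]],
            (rule lin_rules | (rule lin_atom, (simp add: x sx; fail)))+, simp)
        moreover have "hty N i x \<in> carrier (cmp ?C (i + 1))" using hx 2 unfolding cC by simp
        ultimately show ?thesis using 2 by (intro bexI[of _ "hty N i x"] bexI[of _ ?y]) (simp_all add: s_def)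
      next
        case 3
        then have "x = \<zero>\<^bsub>cmp N i\<^esub>" using low0[OF x] by simp
        then show ?thesis using 3 z[of a] module_simps(6)[OF mN x] unfolding cC
          by (intro bexI[of _ "\<zero>\<^bsub>?P\<^esub>"] bexI[of _ "\<zero>\<^bsub>cmp N i\<^esub>"]) (simp_all add: s_def S_def)
      next
        case 4
        then show ?thesis using z[of a] x module_simps(6)[OF mN x] unfolding cC
          by (intro bexI[of _ "\<zero>\<^bsub>?P\<^esub>"] bexI[of _ x]) (simp_all add: s_def S_def)
      qed
    qed
    then show "\<exists>w\<in>carrier (cmp ?D i). ?v i w = x"
      unfolding cD using pair_closed by (metis component_pair)
  qed
qed

text \<open>The upper bound stays fixed and peeling raises the lower one, so the length of the
  degree interval decreases; the same \<sigma> contracts the peeled module. When the interval is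
  empty the module is zero, and it is perfect as an acyclic module.\<close>

lemma perf_contractible:
  fixes N :: "('b, ('b, 'x) univ) kdg"
  assumes B: "cring B" "f \<in> carrier B" and N: "N \<in> kdg_mod B f"
    and fg: "\<And>i. fg_projective B (cmp N i)"
    and bounded: "\<And>i. i < a \<or> b < i \<Longrightarrow> carrier (cmp N i) = {\<zero>\<^bsub>cmp N i\<^esub>}"
    and \<sigma>: "\<And>i. \<sigma> i \<in> module_hom B (cmp N i) (cmp N (i + 1))"
    and contr: "\<And>i x. x \<in> carrier (cmp N i) \<Longrightarrow>
      hty N (i + 1) (\<sigma> i x) \<oplus>\<^bsub>cmp N i\<^esub> \<sigma> (i - 1) (hty N i x) = x"
  shows "N \<in> perf B f"
  using N fg bounded \<sigma> contr
proof (induction "nat (b + 1 - a)" arbitrary: N a)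
  case 0
  then have "b < a" by simp
  then have c: "carrier (cmp N i) = {\<zero>\<^bsub>cmp N i\<^esub>}" for i using "0.prems"(3)[of i] by linarith
  show ?case
  proof (rule perf_acyclic[OF B "0.prems"(1)])
    fix i x assume "x \<in> carrier (cmp N i)"
    then show "x \<in> dif N (i - 1) ` carrier (cmp N (i - 1))"
      using c kdg_simps(1)[OF "0.prems"(1), of "i - 1"] by simp
  qed
next
  case (Suc n)
  have low: "carrier (cmp N i) = {\<zero>\<^bsub>cmp N i\<^esub>}" if "i < a" for i using Suc.prems(3) that by blast
  let ?S = "peeled N a"
  note S_def = peeled_def[of N a]
  note st = perf_contractible_step[OF B Suc.prems(1,2) low Suc.prems(4,5)]
  have z: "\<zero>\<^bsub>cmp N i\<^esub> \<in> carrier (cmp N i)" for i using module_simps(2)[OF kdg_modD(1)[OF Suc.prems(1)]] .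
  have X: "sub_kdg N ?S \<in> perf B f"
  proof (rule Suc.hyps(1))
    show "n = nat (b + 1 - (a + 1))" using Suc.hyps(2) by simp
    show "sub_kdg N ?S \<in> kdg_mod B f" by (rule st(1))
    show "fg_projective B (cmp (sub_kdg N ?S) i)" for i by (rule st(2))
    show "\<sigma> i \<in> module_hom B (cmp (sub_kdg N ?S) i) (cmp (sub_kdg N ?S) (i + 1))" for i by (rule st(3))
    have "\<zero>\<^bsub>cmp N i\<^esub> \<in> ?S i" for i
      using kdg_simps(2)[OF Suc.prems(1), of "a + 1"] z by (auto simp: S_def)
    moreover have Sc: "?S i \<subseteq> carrier (cmp N i)" for i using z by (auto simp: S_def)
    ultimately show "carrier (cmp (sub_kdg N ?S) i) = {\<zero>\<^bsub>cmp (sub_kdg N ?S) i\<^esub>}" if "i < a + 1 \<or> b < i" for i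
      using that Suc.prems(3)[of i] kdg_simps(2)[OF Suc.prems(1), of "a + 1"]
      by (cases "i \<le> a") (auto simp: S_def)
    show "hty (sub_kdg N ?S) (i + 1) (\<sigma> i x) \<oplus>\<^bsub>cmp (sub_kdg N ?S) i\<^esub> \<sigma> (i - 1) (hty (sub_kdg N ?S) i x) = x"
      if "x \<in> carrier (cmp (sub_kdg N ?S) i)" for i x
      using that Sc Suc.prems(5)[of x i] by auto
  qed
  show ?case by (rule st(4)[OF _ _ X])
qed

section \<open>Modules assembled from the components of a dg module\<close>

text \<open>An element of \<open>\<Oplus>\<^sub>j\<^sub>\<in>\<^sub>J E\<^sub>j\<close> is handled as a function on all of \<open>\<int>\<close> vanishing outside \<open>J\<close>;
  \<open>total_map E\<close> is \<open>d + h\<close>, whose square is \<open>f\<close>.\<close>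

definition fun_space :: "('r, 'm) kdg \<Rightarrow> (int \<Rightarrow> 'm) set" where
  "fun_space E = {x. \<forall>j. x j \<in> carrier (cmp E j)}"

definition supported :: "('r, 'm) kdg \<Rightarrow> int set \<Rightarrow> (int \<Rightarrow> 'm) set" where
  "supported E J = {x \<in> fun_space E. \<forall>j. j \<notin> J \<longrightarrow> x j = \<zero>\<^bsub>cmp E j\<^esub>}"

definition total_map :: "('r, 'm) kdg \<Rightarrow> (int \<Rightarrow> 'm) \<Rightarrow> int \<Rightarrow> 'm" where
  "total_map E x j = dif E (j - 1) (x (j - 1)) \<oplus>\<^bsub>cmp E j\<^esub> hty E (j + 1) (x (j + 1))"

definition family :: "int set \<Rightarrow> (int \<Rightarrow> ('b, 'x) univ) \<Rightarrow> ('b, 'x) univ" where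
  "family J x = Family (\<lambda>j\<in>J. x j)"

definition extend :: "('b, ('b, 'x) univ) kdg \<Rightarrow> int set \<Rightarrow> ('b, 'x) univ \<Rightarrow> int \<Rightarrow> ('b, 'x) univ" where
  "extend E J z j = (if j \<in> J then component z j else \<zero>\<^bsub>cmp E j\<^esub>)"

text \<open>Linearity of an operator on functions, in a form closed under the pointwise operations,
  degree tests and D out of which all later formulas are built. It reduces linearity of each
  structure map to the rules \<open>lin_op_intros\<close>.\<close>

definition lin_op :: "('b, 'c) ring_scheme \<Rightarrow> ('b, 'm) kdg \<Rightarrow> ((int \<Rightarrow> 'm) \<Rightarrow> int \<Rightarrow> 'm) \<Rightarrow> bool" where
  "lin_op B E T \<longleftrightarrow> (\<forall>x\<in>fun_space E. T x \<in> fun_space E \<and>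
     (\<forall>y\<in>fun_space E. \<forall>j. T (\<lambda>j. x j \<oplus>\<^bsub>cmp E j\<^esub> y j) j = T x j \<oplus>\<^bsub>cmp E j\<^esub> T y j) \<and>
     (\<forall>r\<in>carrier B. \<forall>j. T (\<lambda>j. r \<odot>\<^bsub>cmp E j\<^esub> x j) j = r \<odot>\<^bsub>cmp E j\<^esub> T x j))"

definition site_map ::
  "('b, ('b, 'x) univ) kdg \<Rightarrow> (int \<Rightarrow> int set) \<Rightarrow> (int \<Rightarrow> int set)
    \<Rightarrow> (int \<Rightarrow> (int \<Rightarrow> ('b, 'x) univ) \<Rightarrow> int \<Rightarrow> ('b, 'x) univ) \<Rightarrow> int \<Rightarrow> ('b, 'x) univ \<Rightarrow> ('b, 'x) univ" where
  "site_map E J J' T i z = family (J' i) (T i (extend E (J i) z))"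

text \<open>The set \<open>J i\<close> lists the components of \<open>E\<close> present in degree
  \<open>i\<close>. The structure maps are formulas on functions, restricted to these index sets;
  lattice modules and roofs are both of this form.\<close>

definition site_kdg ::
  "('b, ('b, 'x) univ) kdg \<Rightarrow> (int \<Rightarrow> int set)
    \<Rightarrow> (int \<Rightarrow> (int \<Rightarrow> ('b, 'x) univ) \<Rightarrow> int \<Rightarrow> ('b, 'x) univ)
    \<Rightarrow> (int \<Rightarrow> (int \<Rightarrow> ('b, 'x) univ) \<Rightarrow> int \<Rightarrow> ('b, 'x) univ) \<Rightarrow> ('b, ('b, 'x) univ) kdg" where
  "site_kdg E J \<Delta> H =
     \<lparr>cmp = (\<lambda>i. direct_sum (J i) (cmp E)),
      dif = site_map E J (\<lambda>i. J (i + 1)) \<Delta>,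
      hty = site_map E J (\<lambda>i. J (i - 1)) H\<rparr>"

lemma site_kdg_simps [simp]:
  "cmp (site_kdg E J \<Delta> H) i = direct_sum (J i) (cmp E)"
  "dif (site_kdg E J \<Delta> H) = site_map E J (\<lambda>i. J (i + 1)) \<Delta>"
  "hty (site_kdg E J \<Delta> H) = site_map E J (\<lambda>i. J (i - 1)) H"
  by (simp_all add: site_kdg_def)

lemma coh_s_kdg_mod: "E \<in> coh_s B f \<Longrightarrow> E \<in> kdg_mod B f"
  by (simp add: coh_s_def)

lemma coh_s_finite_support:
  assumes "E \<in> coh_s B f"
  shows "finite {j. carrier (cmp E j) \<noteq> {\<zero>\<^bsub>cmp E j\<^esub>}}"
proof -
  obtain m m' where "\<forall>i. i < m \<or> m' < i \<longrightarrow> carrier (cmp E i) = {\<zero>\<^bsub>cmp E i\<^esub>}"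
    using assms by (auto simp: coh_s_def)
  then have "{j. carrier (cmp E j) \<noteq> {\<zero>\<^bsub>cmp E j\<^esub>}} \<subseteq> {m..m'}" by force
  then show ?thesis by (rule finite_subset) simp
qed

locale bounded_kdg =
  fixes B :: "('b, 'c) ring_scheme" and f :: 'b and E :: "('b, ('b, 'x) univ) kdg"
  assumes cring_B: "cring B" and f_closed: "f \<in> carrier B" and coh: "E \<in> coh_s B f"
begin

lemma E: "E \<in> kdg_mod B f" by (rule coh_s_kdg_mod[OF coh])

lemmas mE = kdg_modD(1)[OF E]
text \<open>The first fact is dropped, so the numbering is lower by one than that of
  \<open>module_simps\<close>.\<close>

lemmas M_simps = module_simps(2-)[OF mE]

lemma lin_eq: 
  "lin_rep (cmp E j) x X \<Longrightarrow> lin_rep (cmp E j) y Y \<Longrightarrow> X = Y \<Longrightarrow> x = y"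
  by (rule lin_eqI[OF module_abelian_group[OF mE]])

lemma fs_closed: "x \<in> fun_space E \<Longrightarrow> x j \<in> carrier (cmp E j)"
  by (simp add: fun_space_def)

lemma supported_fs: "x \<in> supported E J \<Longrightarrow> x \<in> fun_space E"
  by (simp add: supported_def)

lemma supported_zero: "x \<in> supported E J \<Longrightarrow> j \<notin> J \<Longrightarrow> x j = \<zero>\<^bsub>cmp E j\<^esub>"
  by (simp add: supported_def)

section \<open>The operator D and linear operators on functions\<close>

lemma nbr_closed:
  assumes "x \<in> fun_space E"
  shows "dif E (j - 1) (x (j - 1)) \<in> carrier (cmp E j)" "hty E (j + 1) (x (j + 1)) \<in> carrier (cmp E j)"
  using kdg_closed(1)[OF E fs_closed[OF assms, of "j - 1"]] kdg_closed(2)[OF E fs_closed[OF assms, of "j + 1"]]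
  by simp_all

lemma total_closed:
  assumes "x \<in> fun_space E"
  shows "total_map E x \<in> fun_space E"
  unfolding fun_space_def mem_Collect_eq total_map_def by (intro allI M_simps(2) nbr_closed[OF assms])

lemma total_cong: "x (j - 1) = y (j - 1) \<Longrightarrow> x (j + 1) = y (j + 1) \<Longrightarrow> total_map E x j = total_map E y j"
  by (simp add: total_map_def)

lemma total_add:
  assumes x: "x \<in> fun_space E" and y: "y \<in> fun_space E"
  shows "total_map E (\<lambda>j. x j \<oplus>\<^bsub>cmp E j\<^esub> y j) j = total_map E x j \<oplus>\<^bsub>cmp E j\<^esub> total_map E y j"
proof -
  have d: "dif E (j - 1) (x (j - 1) \<oplus>\<^bsub>cmp E (j - 1)\<^esub> y (j - 1))
      = dif E (j - 1) (x (j - 1)) \<oplus>\<^bsub>cmp E j\<^esub> dif E (j - 1) (y (j - 1))"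
    using kdg_simps(5)[OF E, of "x (j - 1)" "j - 1" "y (j - 1)"] fs_closed[OF x] fs_closed[OF y] by simp
  have h: "hty E (j + 1) (x (j + 1) \<oplus>\<^bsub>cmp E (j + 1)\<^esub> y (j + 1))
      = hty E (j + 1) (x (j + 1)) \<oplus>\<^bsub>cmp E j\<^esub> hty E (j + 1) (y (j + 1))"
    using kdg_simps(6)[OF E, of "x (j + 1)" "j + 1" "y (j + 1)"] fs_closed[OF x] fs_closed[OF y] by simp
  show ?thesis
    unfolding total_map_def d h
    by (rule lin_eq, (rule lin_rules | (rule lin_atom, (simp add: nbr_closed[OF x] nbr_closed[OF y]; fail)))+, simp)
qed

lemma total_smult:
  assumes r: "r \<in> carrier B" and x: "x \<in> fun_space E"
  shows "total_map E (\<lambda>j. r \<odot>\<^bsub>cmp E j\<^esub> x j) j = r \<odot>\<^bsub>cmp E j\<^esub> total_map E x j"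
  using kdg_simps(9)[OF E r, of "x (j - 1)" "j - 1"] kdg_simps(10)[OF E r, of "x (j + 1)" "j + 1"] fs_closed[OF x]
    M_simps(12)[OF r nbr_closed[OF x]] by (simp add: total_map_def)

lemma lin_opD:
  assumes "lin_op B E T" "x \<in> fun_space E"
  shows "T x \<in> fun_space E"
    and "y \<in> fun_space E \<Longrightarrow> T (\<lambda>j. x j \<oplus>\<^bsub>cmp E j\<^esub> y j) j = T x j \<oplus>\<^bsub>cmp E j\<^esub> T y j"
    and "r \<in> carrier B \<Longrightarrow> T (\<lambda>j. r \<odot>\<^bsub>cmp E j\<^esub> x j) j = r \<odot>\<^bsub>cmp E j\<^esub> T x j"
  using assms by (auto simp: lin_op_def)

lemma lin_op_id: "lin_op B E (\<lambda>x j. x j)"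
  by (auto simp: lin_op_def)

lemma lin_op_zero: "lin_op B E (\<lambda>x j. \<zero>\<^bsub>cmp E j\<^esub>)"
  by (auto simp: lin_op_def M_simps fun_space_def)

lemma lin_op_if:
  "lin_op B E A \<Longrightarrow> lin_op B E C \<Longrightarrow> lin_op B E (\<lambda>x j. if P j then A x j else C x j)"
  by (auto simp: lin_op_def fun_space_def)

lemma lin_op_minus:
  assumes "lin_op B E A"
  shows "lin_op B E (\<lambda>x j. \<ominus>\<^bsub>cmp E j\<^esub> A x j)"
proof -
  have "\<ominus>\<^bsub>cmp E j\<^esub> (a \<oplus>\<^bsub>cmp E j\<^esub> b) = \<ominus>\<^bsub>cmp E j\<^esub> a \<oplus>\<^bsub>cmp E j\<^esub> \<ominus>\<^bsub>cmp E j\<^esub> b"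
    if "a \<in> carrier (cmp E j)" "b \<in> carrier (cmp E j)" for a b j
    by (rule abelian_group.minus_add[OF module_abelian_group[OF mE] that])
  then show ?thesis
    using lin_opD[OF assms] by (auto simp: lin_op_def fun_space_def M_simps)
qed

lemma lin_op_add:
  assumes "lin_op B E A" "lin_op B E C"
  shows "lin_op B E (\<lambda>x j. A x j \<oplus>\<^bsub>cmp E j\<^esub> C x j)"
proof -
  have "(a \<oplus>\<^bsub>cmp E j\<^esub> b) \<oplus>\<^bsub>cmp E j\<^esub> (c \<oplus>\<^bsub>cmp E j\<^esub> d) = (a \<oplus>\<^bsub>cmp E j\<^esub> c) \<oplus>\<^bsub>cmp E j\<^esub> (b \<oplus>\<^bsub>cmp E j\<^esub> d)"
    if "a \<in> carrier (cmp E j)" "b \<in> carrier (cmp E j)" "c \<in> carrier (cmp E j)" "d \<in> carrier (cmp E j)" for a b c d j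
    by (rule lin_eq, (rule lin_rules | (rule lin_atom, (simp add: that; fail)))+, simp)
  then show ?thesis
    using lin_opD[OF assms(1)] lin_opD[OF assms(2)] by (auto simp: lin_op_def fun_space_def M_simps)
qed

lemma lin_op_diff:
  "lin_op B E A \<Longrightarrow> lin_op B E C \<Longrightarrow> lin_op B E (\<lambda>x j. A x j \<ominus>\<^bsub>cmp E j\<^esub> C x j)"
  unfolding a_minus_def by (rule lin_op_add[OF _ lin_op_minus])

lemma lin_op_smult:
  assumes "lin_op B E A"
  shows "lin_op B E (\<lambda>x j. f \<odot>\<^bsub>cmp E j\<^esub> A x j)"
proof -
  have "f \<odot>\<^bsub>cmp E j\<^esub> (r \<odot>\<^bsub>cmp E j\<^esub> a) = r \<odot>\<^bsub>cmp E j\<^esub> (f \<odot>\<^bsub>cmp E j\<^esub> a)"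
    if "a \<in> carrier (cmp E j)" "r \<in> carrier B" for a r j
  proof -
    interpret module B "cmp E j" by (rule mE)
    show ?thesis using that f_closed by (simp add: smult_assoc1[symmetric] R.m_comm)
  qed
  then show ?thesis
    using lin_opD[OF assms] f_closed by (auto simp: lin_op_def fun_space_def M_simps)
qed

lemma lin_op_total:
  assumes "lin_op B E A"
  shows "lin_op B E (\<lambda>x j. total_map E (A x) j)"
  unfolding lin_op_def
proof (intro ballI conjI allI)
  fix x assume x: "x \<in> fun_space E"
  show "(\<lambda>j. total_map E (A x) j) \<in> fun_space E" using total_closed lin_opD(1)[OF assms x] by simp
  show "total_map E (A (\<lambda>j. x j \<oplus>\<^bsub>cmp E j\<^esub> y j)) j = total_map E (A x) j \<oplus>\<^bsub>cmp E j\<^esub> total_map E (A y) j"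
    if "y \<in> fun_space E" for y j
    using total_cong[of "A (\<lambda>j. x j \<oplus>\<^bsub>cmp E j\<^esub> y j)" j "\<lambda>j. A x j \<oplus>\<^bsub>cmp E j\<^esub> A y j"]
      lin_opD(2)[OF assms x that] total_add[OF lin_opD(1)[OF assms x] lin_opD(1)[OF assms that]] by simp
  show "total_map E (A (\<lambda>j. r \<odot>\<^bsub>cmp E j\<^esub> x j)) j = r \<odot>\<^bsub>cmp E j\<^esub> total_map E (A x) j" if "r \<in> carrier B" for r j
    using total_cong[of "A (\<lambda>j. r \<odot>\<^bsub>cmp E j\<^esub> x j)" j "\<lambda>j. r \<odot>\<^bsub>cmp E j\<^esub> A x j"]
      lin_opD(3)[OF assms x that] total_smult[OF that lin_opD(1)[OF assms x]] by simp
qed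

lemmas lin_op_intros = lin_op_if lin_op_diff lin_op_add lin_op_minus lin_op_smult lin_op_total lin_op_zero lin_op_id

lemma total_minus:
  assumes x: "x \<in> fun_space E"
  shows "total_map E (\<lambda>j. \<ominus>\<^bsub>cmp E j\<^esub> x j) j = \<ominus>\<^bsub>cmp E j\<^esub> total_map E x j"
  using kdg_simps(3)[OF E, of "x (j - 1)" "j - 1"] kdg_simps(4)[OF E, of "x (j + 1)" "j + 1"] fs_closed[OF x]
    abelian_group.minus_add[OF module_abelian_group[OF mE] nbr_closed[OF x]]
  by (simp add: total_map_def)

lemma total_diff:
  assumes "x \<in> fun_space E" "y \<in> fun_space E"
  shows "total_map E (\<lambda>j. x j \<ominus>\<^bsub>cmp E j\<^esub> y j) j = total_map E x j \<ominus>\<^bsub>cmp E j\<^esub> total_map E y j"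
proof -
  have "(\<lambda>j. \<ominus>\<^bsub>cmp E j\<^esub> y j) \<in> fun_space E" using assms(2) by (auto simp: fun_space_def M_simps)
  then show ?thesis unfolding a_minus_def using total_add[OF assms(1)] total_minus[OF assms(2)] by simp
qed

lemma total_zero: "x (j - 1) = \<zero>\<^bsub>cmp E (j - 1)\<^esub> \<Longrightarrow> x (j + 1) = \<zero>\<^bsub>cmp E (j + 1)\<^esub> \<Longrightarrow> total_map E x j = \<zero>\<^bsub>cmp E j\<^esub>"
  using kdg_simps(1)[OF E, of "j - 1"] kdg_simps(2)[OF E, of "j + 1"] by (simp add: total_map_def M_simps)

text \<open>The contributions from distance two are d d and h h, which vanish; the contribution of
  \<open>x j\<close> itself is d h + h d.\<close>

lemma total_total:
  assumes x: "x \<in> fun_space E"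
  shows "total_map E (total_map E x) j = f \<odot>\<^bsub>cmp E j\<^esub> x j"
proof -
  have ix: "j - 1 - 1 = j - 2" "j - 1 + 1 = j" "j + 1 - 1 = j" "j + 1 + 1 = j + 2" by auto
  have xj: "x j \<in> carrier (cmp E j)" and x2: "x (j - 2) \<in> carrier (cmp E (j - 2))" "x (j + 2) \<in> carrier (cmp E (j + 2))"
    by (rule fs_closed[OF x])+
  have c: "dif E (j - 2) (x (j - 2)) \<in> carrier (cmp E (j - 1))" "hty E j (x j) \<in> carrier (cmp E (j - 1))"
    "dif E j (x j) \<in> carrier (cmp E (j + 1))" "hty E (j + 2) (x (j + 2)) \<in> carrier (cmp E (j + 1))"
    using nbr_closed[OF x, of "j - 1", unfolded ix] nbr_closed[OF x, of "j + 1", unfolded ix] by auto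
  have dd: "dif E (j - 1) (dif E (j - 2) (x (j - 2))) = \<zero>\<^bsub>cmp E j\<^esub>"
    using kdg_square(1)[OF E x2(1), of "j - 1"] by simp
  have hh: "hty E (j + 1) (hty E (j + 2) (x (j + 2))) = \<zero>\<^bsub>cmp E j\<^esub>"
    using kdg_square(2)[OF E x2(2), of "j + 1"] by simp
  have "total_map E (total_map E x) j = dif E (j - 1) (hty E j (x j)) \<oplus>\<^bsub>cmp E j\<^esub> hty E (j + 1) (dif E j (x j))"
    using kdg_simps(5)[OF E c(1,2)] kdg_simps(6)[OF E c(3,4)] kdg_closed(3,4)[OF E xj]
    by (simp add: total_map_def ix dd hh M_simps)
  then show ?thesis using kdg_modD(6)[OF E xj] by simp
qed

text \<open>Boundedness of \<open>E\<close> makes the direct sum over any index set coincide with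
  the product, so every function in \<open>fun_space E\<close> defines an element.\<close>

lemma finite_nonzero: "x \<in> fun_space E \<Longrightarrow> finite {j \<in> J. x j \<noteq> \<zero>\<^bsub>cmp E j\<^esub>}"
  using coh_s_finite_support[OF coh] by (rule rev_finite_subset) (force simp: fun_space_def)

section \<open>Passage between functions and elements of direct sums\<close>

lemma family_closed: "x \<in> fun_space E \<Longrightarrow> family J x \<in> carrier (direct_sum J (cmp E))"
  unfolding family_def by (rule direct_sum_carrierI[OF fs_closed finite_nonzero])

lemma extend_supported: "z \<in> carrier (direct_sum J (cmp E)) \<Longrightarrow> extend E J z \<in> supported E J"
  using direct_sum_closed[of z J "cmp E"] by (auto simp: supported_def fun_space_def extend_def M_simps)

lemma extend_family: "x \<in> supported E J \<Longrightarrow> extend E J (family J x) = x"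
  by (rule ext) (auto simp: extend_def family_def supported_def)

lemma family_extend:
  assumes "z \<in> carrier (direct_sum J (cmp E))"
  shows "family J (extend E J z) = z"
  by (rule direct_sum_eqI[OF family_closed[OF supported_fs[OF extend_supported[OF assms]]] assms])
    (simp add: family_def extend_def)

lemma familyE:
  assumes "z \<in> carrier (direct_sum J (cmp E))"
  obtains x where "x \<in> supported E J" "z = family J x"
  using extend_supported[OF assms] family_extend[OF assms, symmetric] by (rule that)

lemma family_cong: "(\<And>j. j \<in> J \<Longrightarrow> x j = y j) \<Longrightarrow> family J x = family J y"
  unfolding family_def by (metis restrict_ext)

lemma family_zero: "\<zero>\<^bsub>direct_sum J (cmp E)\<^esub> = family J (\<lambda>j. \<zero>\<^bsub>cmp E j\<^esub>)"
  by (simp add: direct_sum_def family_def)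

lemma family_add: "family J x \<oplus>\<^bsub>direct_sum J (cmp E)\<^esub> family J y = family J (\<lambda>j. x j \<oplus>\<^bsub>cmp E j\<^esub> y j)"
  by (auto simp: direct_sum_def family_def intro!: restrict_ext)

lemma family_smult: "r \<odot>\<^bsub>direct_sum J (cmp E)\<^esub> family J x = family J (\<lambda>j. r \<odot>\<^bsub>cmp E j\<^esub> x j)"
  by (auto simp: direct_sum_def family_def intro!: restrict_ext)

lemma supported_add:
  "x \<in> supported E J \<Longrightarrow> y \<in> supported E J \<Longrightarrow> (\<lambda>j. x j \<oplus>\<^bsub>cmp E j\<^esub> y j) \<in> supported E J"
  by (auto simp: supported_def fun_space_def M_simps)

lemma supported_smult:
  "r \<in> carrier B \<Longrightarrow> x \<in> supported E J \<Longrightarrow> (\<lambda>j. r \<odot>\<^bsub>cmp E j\<^esub> x j) \<in> supported E J"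
  by (auto simp: supported_def fun_space_def M_simps)

lemma direct_sum_cmp_module: "Module.module B (direct_sum J (cmp E))"
  by (rule direct_sum_module[OF cring_B mE])

lemma site_map_family: "x \<in> supported E (J i) \<Longrightarrow> site_map E J J' T i (family (J i) x) = family (J' i) (T i x)"
  by (simp add: site_map_def extend_family)

lemma site_map_hom:
  assumes T: "lin_op B E (T i)"
  shows "site_map E J J' T i \<in> module_hom B (direct_sum (J i) (cmp E)) (direct_sum (J' i) (cmp E))"
proof (rule module_homI)
  fix z assume "z \<in> carrier (direct_sum (J i) (cmp E))"
  then obtain x where x: "x \<in> supported E (J i)" "z = family (J i) x" by (rule familyE)
  note Tx = lin_opD[OF T supported_fs[OF x(1)]]
  show "site_map E J J' T i z \<in> carrier (direct_sum (J' i) (cmp E))"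
    unfolding x(2) site_map_family[where J = J and i = i, OF x(1)] by (rule family_closed[OF Tx(1)])
  show "site_map E J J' T i (r \<odot>\<^bsub>direct_sum (J i) (cmp E)\<^esub> z) = r \<odot>\<^bsub>direct_sum (J' i) (cmp E)\<^esub> site_map E J J' T i z"
    if "r \<in> carrier B" for r
    unfolding x(2) family_smult site_map_family[where J = J and i = i, OF x(1)] site_map_family[where J = J and i = i, OF supported_smult[OF that x(1)]]
    using Tx(3)[OF that] by (intro family_cong) auto
  fix w assume "w \<in> carrier (direct_sum (J i) (cmp E))"
  then obtain y where y: "y \<in> supported E (J i)" "w = family (J i) y" by (rule familyE)
  show "site_map E J J' T i (z \<oplus>\<^bsub>direct_sum (J i) (cmp E)\<^esub> w)
      = site_map E J J' T i z \<oplus>\<^bsub>direct_sum (J' i) (cmp E)\<^esub> site_map E J J' T i w"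
    unfolding x(2) y(2) family_add site_map_family[where J = J and i = i, OF x(1)] site_map_family[where J = J and i = i, OF y(1)]
      site_map_family[where J = J and i = i, OF supported_add[OF x(1) y(1)]]
    using Tx(2)[OF supported_fs[OF y(1)]] by (intro family_cong) auto
qed

section \<open>Dg modules and closed morphisms given by operators on functions\<close>

lemma site_kdg_mod:
  assumes \<Delta>: "\<And>i. lin_op B E (\<Delta> i)" "\<And>i x. x \<in> supported E (J i) \<Longrightarrow> \<Delta> i x \<in> supported E (J (i + 1))"
    and H: "\<And>i. lin_op B E (H i)" "\<And>i x. x \<in> supported E (J i) \<Longrightarrow> H i x \<in> supported E (J (i - 1))"
    and dd: "\<And>i x j. x \<in> supported E (J i) \<Longrightarrow> j \<in> J (i + 2) \<Longrightarrow> \<Delta> (i + 1) (\<Delta> i x) j = \<zero>\<^bsub>cmp E j\<^esub>"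
    and hh: "\<And>i x j. x \<in> supported E (J i) \<Longrightarrow> j \<in> J (i - 2) \<Longrightarrow> H (i - 1) (H i x) j = \<zero>\<^bsub>cmp E j\<^esub>"
    and dh: "\<And>i x j. x \<in> supported E (J i) \<Longrightarrow> j \<in> J i \<Longrightarrow>
      \<Delta> (i - 1) (H i x) j \<oplus>\<^bsub>cmp E j\<^esub> H (i + 1) (\<Delta> i x) j = f \<odot>\<^bsub>cmp E j\<^esub> x j"
  shows "site_kdg E J \<Delta> H \<in> kdg_mod B f"
proof (rule kdg_modI)
  fix i :: int
  show "Module.module B (cmp (site_kdg E J \<Delta> H) i)" by (simp add: direct_sum_cmp_module)
  show "dif (site_kdg E J \<Delta> H) i \<in> module_hom B (cmp (site_kdg E J \<Delta> H) i) (cmp (site_kdg E J \<Delta> H) (i + 1))"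
    "hty (site_kdg E J \<Delta> H) i \<in> module_hom B (cmp (site_kdg E J \<Delta> H) i) (cmp (site_kdg E J \<Delta> H) (i - 1))"
    using site_map_hom[where J = J and i = i and J' = "\<lambda>i. J (i + 1)", OF \<Delta>(1)]
      site_map_hom[where J = J and i = i and J' = "\<lambda>i. J (i - 1)", OF H(1)] by simp_all
  fix z assume "z \<in> carrier (cmp (site_kdg E J \<Delta> H) i)"
  then have "z \<in> carrier (direct_sum (J i) (cmp E))" by simp
  then obtain x where x: "x \<in> supported E (J i)" and z: "z = family (J i) x" by (rule familyE)
  have ix: "i + 1 + 1 = i + 2" "i - 1 - 1 = i - 2" "i - 1 + 1 = i" "i + 1 - 1 = i" by auto
  note m = site_map_family
  show "dif (site_kdg E J \<Delta> H) (i + 1) (dif (site_kdg E J \<Delta> H) i z) = \<zero>\<^bsub>cmp (site_kdg E J \<Delta> H) (i + 2)\<^esub>"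
    unfolding z site_kdg_simps m[where J = J and i = i, OF x] m[where J = J and i = "i + 1", OF \<Delta>(2)[OF x]] ix family_zero
    using dd[OF x] by (intro family_cong) auto
  show "hty (site_kdg E J \<Delta> H) (i - 1) (hty (site_kdg E J \<Delta> H) i z) = \<zero>\<^bsub>cmp (site_kdg E J \<Delta> H) (i - 2)\<^esub>"
    unfolding z site_kdg_simps m[where J = J and i = i, OF x] m[where J = J and i = "i - 1", OF H(2)[OF x]] ix family_zero
    using hh[OF x] by (intro family_cong) auto
  show "dif (site_kdg E J \<Delta> H) (i - 1) (hty (site_kdg E J \<Delta> H) i z) \<oplus>\<^bsub>cmp (site_kdg E J \<Delta> H) i\<^esub>
      hty (site_kdg E J \<Delta> H) (i + 1) (dif (site_kdg E J \<Delta> H) i z) = f \<odot>\<^bsub>cmp (site_kdg E J \<Delta> H) i\<^esub> z"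
    unfolding z site_kdg_simps m[where J = J and i = i, OF x] m[where J = J and i = "i - 1", OF H(2)[OF x]] m[where J = J and i = "i + 1", OF \<Delta>(2)[OF x]] ix family_add family_smult
    using dh[OF x] by (intro family_cong) auto
qed

lemma site_map_cocycle:
  assumes K': "site_kdg E J' \<Delta>' H' \<in> kdg_mod B f"
    and \<Delta>: "\<And>i x. x \<in> supported E (J i) \<Longrightarrow> \<Delta> i x \<in> supported E (J (i + 1))"
    and H: "\<And>i x. x \<in> supported E (J i) \<Longrightarrow> H i x \<in> supported E (J (i - 1))"
    and T: "\<And>i. lin_op B E (T i)" "\<And>i x. x \<in> supported E (J i) \<Longrightarrow> T i x \<in> supported E (J' i)"
    and dT: "\<And>i x j. x \<in> supported E (J i) \<Longrightarrow> j \<in> J' (i + 1) \<Longrightarrow> T (i + 1) (\<Delta> i x) j = \<Delta>' i (T i x) j"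
    and hT: "\<And>i x j. x \<in> supported E (J i) \<Longrightarrow> j \<in> J' (i - 1) \<Longrightarrow> T (i - 1) (H i x) j = H' i (T i x) j"
  shows "site_map E J J' T \<in> cocycles B (site_kdg E J \<Delta> H) (site_kdg E J' \<Delta>' H')"
proof (rule cocyclesI[OF K'])
  fix i :: int
  note m = site_map_family
  show "site_map E J J' T i \<in> module_hom B (cmp (site_kdg E J \<Delta> H) i) (cmp (site_kdg E J' \<Delta>' H') i)"
    using site_map_hom[OF T(1)] by simp
  fix z assume "z \<in> carrier (cmp (site_kdg E J \<Delta> H) i)"
  then have "z \<in> carrier (direct_sum (J i) (cmp E))" by simp
  then obtain x where x: "x \<in> supported E (J i)" and z: "z = family (J i) x" by (rule familyE)
  show "site_map E J J' T (i - 1) (hty (site_kdg E J \<Delta> H) i z) = hty (site_kdg E J' \<Delta>' H') i (site_map E J J' T i z)"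
    unfolding z site_kdg_simps m[where J = J and i = i, OF x] m[where J = J and i = "i - 1", OF H[OF x]] m[where J = J' and i = i, OF T(2)[OF x]]
    using hT[OF x] by (intro family_cong) auto
  show "site_map E J J' T (i + 1) (dif (site_kdg E J \<Delta> H) i z) = dif (site_kdg E J' \<Delta>' H') i (site_map E J J' T i z)"
    unfolding z site_kdg_simps m[where J = J and i = i, OF x] m[where J = J and i = "i + 1", OF \<Delta>[OF x]] m[where J = J' and i = i, OF T(2)[OF x]]
    using dT[OF x] by (intro family_cong) auto
qed

text \<open>Only finitely many components of \<open>E\<close> are nonzero and each occurs in
  finitely many degrees, which bounds the degrees; every degree is a direct sum of finitely
  generated projectives, almost all zero.\<close>

lemma site_kdg_coh_s:
  assumes "site_kdg E J \<Delta> H \<in> kdg_mod B f"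
    and J: "\<And>j. finite {i. j \<in> J i}"
  shows "site_kdg E J \<Delta> H \<in> coh_s B f"
proof -
  define F where "F = {j. carrier (cmp E j) \<noteq> {\<zero>\<^bsub>cmp E j\<^esub>}}"
  have F: "finite F" unfolding F_def by (rule coh_s_finite_support[OF coh])
  have "finite (\<Union>j\<in>F. {i. j \<in> J i})" using F J by simp
  then have fin: "finite (insert 0 (abs ` (\<Union>j\<in>F. {i. j \<in> J i})))" by simp
  define k where "k = Max (insert 0 (abs ` (\<Union>j\<in>F. {i. j \<in> J i})))"
  have k: "\<bar>i\<bar> \<le> k" if "j \<in> F" "j \<in> J i" for i j
    unfolding k_def by (rule Max_ge[OF fin]) (use that in blast)
  have zero: "carrier (direct_sum (J i) (cmp E)) = {\<zero>\<^bsub>direct_sum (J i) (cmp E)\<^esub>}" if "i < - k \<or> k < i" for i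
  proof (rule direct_sum_trivial)
    fix j assume "j \<in> J i"
    then have "j \<notin> F" using k[of j i] that by auto
    then show "carrier (cmp E j) = {\<zero>\<^bsub>cmp E j\<^esub>}" by (simp add: F_def)
  qed
  have fg: "fg_projective B (direct_sum J' (cmp E))" for J'
    using coh coh_s_finite_support[OF coh]
    by (intro fg_projective_direct_sum[OF cring_B]) (auto simp: coh_s_def elim: rev_finite_subset)
  have "\<exists>m m'. \<forall>i. i < m \<or> m' < i \<longrightarrow> carrier (direct_sum (J i) (cmp E)) = {\<zero>\<^bsub>direct_sum (J i) (cmp E)\<^esub>}"
    by (rule exI[of _ "- k"], rule exI[of _ k]) (use zero in blast)
  then show ?thesis using assms(1) fg by (simp add: coh_s_def)
qed

end

section \<open>Lattice modules and the roofs between them\<close>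

text \<open>A shape \<open>\<gamma>\<close> places the component \<open>E\<^sub>j\<close> in degree \<open>\<gamma> j\<close>; the summands of \<open>d + h\<close> that
  raise this degree form the differential, and those that lower it form the action of \<open>\<epsilon>\<close>.
  The identity gives back \<open>E\<close>, the shape with values in \<open>{-1, 0}\<close> gives the folded module.\<close>

definition shape :: "(int \<Rightarrow> int) \<Rightarrow> bool" where
  "shape \<gamma> \<longleftrightarrow> (\<forall>j. even (\<gamma> j - j) \<and> (\<gamma> (j + 1) = \<gamma> j + 1 \<or> \<gamma> (j + 1) = \<gamma> j - 1))"

definition lattice_module :: "('b, ('b, 'x) univ) kdg \<Rightarrow> (int \<Rightarrow> int) \<Rightarrow> ('b, ('b, 'x) univ) kdg" where
  "lattice_module E \<gamma> = site_kdg E (\<lambda>i. {j. \<gamma> j = i})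
     (\<lambda>i x j. if \<gamma> j = i + 1 then total_map E x j else \<zero>\<^bsub>cmp E j\<^esub>)
     (\<lambda>i x j. if \<gamma> j = i - 1 then total_map E x j else \<zero>\<^bsub>cmp E j\<^esub>)"

text \<open>The parity test selects a row of the matrix. As \<open>total_map\<close> reads the
  neighbours of \<open>j\<close>, whose parity is opposite, the first branch is D a - f b and the
  second is a - D b; one formula in \<open>x\<close> serves both. The outer test cuts off targets
  outside the range of \<open>j\<close>.\<close>

definition roof_dif :: "'b \<Rightarrow> ('b, ('b, 'x) univ) kdg \<Rightarrow> (int \<Rightarrow> int) \<Rightarrow> (int \<Rightarrow> int)
    \<Rightarrow> int \<Rightarrow> (int \<Rightarrow> ('b, 'x) univ) \<Rightarrow> int \<Rightarrow> ('b, 'x) univ" where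
  "roof_dif f E \<gamma> \<gamma>' i x j = (if \<gamma> j \<le> i + 1 \<and> i + 1 \<le> \<gamma>' j then
       if even (i + 1 - j) then total_map E x j \<ominus>\<^bsub>cmp E j\<^esub> f \<odot>\<^bsub>cmp E j\<^esub> x j
       else x j \<ominus>\<^bsub>cmp E j\<^esub> total_map E x j
     else \<zero>\<^bsub>cmp E j\<^esub>)"

text \<open>Away from the bottom \<epsilon> acts by -1 from a copy of matching parity to the one
  below it. The first branch concerns bottom copies only: a neighbour of a bottom copy in degree
  \<open>i\<close> can receive D in degree \<open>i - 1\<close> only as a bottom copy itself, so
  \<epsilon> acts there as on the lattice module.\<close>

definition roof_hty :: "('b, ('b, 'x) univ) kdg \<Rightarrow> (int \<Rightarrow> int) \<Rightarrow> (int \<Rightarrow> int)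
    \<Rightarrow> int \<Rightarrow> (int \<Rightarrow> ('b, 'x) univ) \<Rightarrow> int \<Rightarrow> ('b, 'x) univ" where
  "roof_hty E \<gamma> \<gamma>' i x j = (if \<gamma> j \<le> i - 1 \<and> i - 1 \<le> \<gamma>' j then
       if even (i - 1 - j) then total_map E (\<lambda>k. if \<gamma> k = i then x k else \<zero>\<^bsub>cmp E k\<^esub>) j
       else \<ominus>\<^bsub>cmp E j\<^esub> x j
     else \<zero>\<^bsub>cmp E j\<^esub>)"

text \<open>The roof between \<open>\<gamma> \<le> \<gamma>'\<close> has one copy of \<open>E\<^sub>j\<close> in each degree from \<open>\<gamma> j\<close> to \<open>\<gamma>' j\<close>.
  Copies in degrees congruent to \<open>j\<close> map identically to the copy one degree higher.\<close>

definition roof :: "'b \<Rightarrow> ('b, ('b, 'x) univ) kdg \<Rightarrow> (int \<Rightarrow> int) \<Rightarrow> (int \<Rightarrow> int) \<Rightarrow> ('b, ('b, 'x) univ) kdg" where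
  "roof f E \<gamma> \<gamma>' = site_kdg E (\<lambda>i. {j. \<gamma> j \<le> i \<and> i \<le> \<gamma>' j}) (roof_dif f E \<gamma> \<gamma>') (roof_hty E \<gamma> \<gamma>')"

definition roof_bot :: "('b, ('b, 'x) univ) kdg \<Rightarrow> (int \<Rightarrow> int) \<Rightarrow> int \<Rightarrow> (int \<Rightarrow> ('b, 'x) univ) \<Rightarrow> int \<Rightarrow> ('b, 'x) univ" where
  "roof_bot E \<gamma> i x j = (if \<gamma> j = i then x j else \<zero>\<^bsub>cmp E j\<^esub>)"

text \<open>When \<open>\<gamma>' j = i\<close>, the term \<open>total_map E x j\<close> only sees the copies of \<open>E\<^sub>j\<^sub>-\<^sub>1\<close> and \<open>E\<^sub>j\<^sub>+\<^sub>1\<close> that are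
  targets of identity maps. Subtracting it makes the projection a chain map.\<close>

definition roof_top :: "('b, ('b, 'x) univ) kdg \<Rightarrow> (int \<Rightarrow> int) \<Rightarrow> int \<Rightarrow> (int \<Rightarrow> ('b, 'x) univ) \<Rightarrow> int \<Rightarrow> ('b, 'x) univ" where
  "roof_top E \<gamma>' i x j = (if \<gamma>' j = i then x j \<ominus>\<^bsub>cmp E j\<^esub> total_map E x j else \<zero>\<^bsub>cmp E j\<^esub>)"

abbreviation to_bot where
  "to_bot E \<gamma> \<gamma>' \<equiv> site_map E (\<lambda>i. {j. \<gamma> j \<le> i \<and> i \<le> \<gamma>' j}) (\<lambda>i. {j. \<gamma> j = i}) (roof_bot E \<gamma>)"

abbreviation to_top where
  "to_top E \<gamma> \<gamma>' \<equiv> site_map E (\<lambda>i. {j. \<gamma> j \<le> i \<and> i \<le> \<gamma>' j}) (\<lambda>i. {j. \<gamma>' j = i}) (roof_top E \<gamma>')"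

lemma shapeD:
  assumes "shape \<gamma>"
  shows "even (\<gamma> j - j)" "k = j - 1 \<or> k = j + 1 \<Longrightarrow> \<gamma> k = \<gamma> j - 1 \<or> \<gamma> k = \<gamma> j + 1"
proof -
  show "even (\<gamma> j - j)" using assms by (simp add: shape_def)
  have "\<gamma> (j + 1) = \<gamma> j - 1 \<or> \<gamma> (j + 1) = \<gamma> j + 1" using assms by (auto simp: shape_def)
  moreover have "\<gamma> (j - 1) = \<gamma> j - 1 \<or> \<gamma> (j - 1) = \<gamma> j + 1"
    using assms[unfolded shape_def, rule_format, of "j - 1"] by auto
  ultimately show "k = j - 1 \<or> k = j + 1 \<Longrightarrow> \<gamma> k = \<gamma> j - 1 \<or> \<gamma> k = \<gamma> j + 1" by blast
qed

context bounded_kdg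
begin

lemma total_cong_nbr: "(\<And>k. k = j - 1 \<or> k = j + 1 \<Longrightarrow> x k = y k) \<Longrightarrow> total_map E x j = total_map E y j"
  by (rule total_cong) auto

lemma total_zero_nbr: "(\<And>k. k = j - 1 \<or> k = j + 1 \<Longrightarrow> x k = \<zero>\<^bsub>cmp E k\<^esub>) \<Longrightarrow> total_map E x j = \<zero>\<^bsub>cmp E j\<^esub>"
  by (rule total_zero) auto

lemma lin_op_supported:
  "lin_op B E T \<Longrightarrow> x \<in> fun_space E \<Longrightarrow> (\<And>j. j \<notin> J \<Longrightarrow> T x j = \<zero>\<^bsub>cmp E j\<^esub>) \<Longrightarrow> T x \<in> supported E J"
  using lin_opD(1) by (auto simp: supported_def)

lemma supported_mono: "x \<in> supported E K \<Longrightarrow> K \<subseteq> K' \<Longrightarrow> x \<in> supported E K'"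
  by (auto simp: supported_def)

lemma zero_smult: "f \<odot>\<^bsub>cmp E j\<^esub> \<zero>\<^bsub>cmp E j\<^esub> = \<zero>\<^bsub>cmp E j\<^esub>"
  by (rule M_simps(11)[OF f_closed])

lemma self_diff: "a \<in> carrier (cmp E j) \<Longrightarrow> a \<ominus>\<^bsub>cmp E j\<^esub> a = \<zero>\<^bsub>cmp E j\<^esub>"
  using minus_eq_zero_iff[OF mE] by blast

lemma total_smult_fs: "x \<in> fun_space E \<Longrightarrow> total_map E (\<lambda>k. f \<odot>\<^bsub>cmp E k\<^esub> x k) j = f \<odot>\<^bsub>cmp E j\<^esub> total_map E x j"
  by (rule total_smult[OF f_closed])

lemma smult_fs: "x \<in> fun_space E \<Longrightarrow> (\<lambda>k. f \<odot>\<^bsub>cmp E k\<^esub> x k) \<in> fun_space E"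
  by (auto simp: fun_space_def M_simps f_closed)

lemma smult_diff: "x \<in> fun_space E \<Longrightarrow> y \<in> fun_space E \<Longrightarrow>
  f \<odot>\<^bsub>cmp E j\<^esub> (x j \<ominus>\<^bsub>cmp E j\<^esub> y j) = f \<odot>\<^bsub>cmp E j\<^esub> x j \<ominus>\<^bsub>cmp E j\<^esub> f \<odot>\<^bsub>cmp E j\<^esub> y j"
  by (rule M_simps(14)[OF f_closed fs_closed fs_closed])

section \<open>Lattice modules\<close>

context
  fixes \<gamma> :: "int \<Rightarrow> int"
  assumes \<gamma>: "shape \<gamma>"
begin

lemma lattice_ops:
  "lin_op B E (\<lambda>x j. if \<gamma> j = i then total_map E x j else \<zero>\<^bsub>cmp E j\<^esub>)"
  by (intro lin_op_intros)

lemma lattice_supported: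
  "x \<in> fun_space E \<Longrightarrow> (\<lambda>j. if \<gamma> j = i then total_map E x j else \<zero>\<^bsub>cmp E j\<^esub>) \<in> supported E {j. \<gamma> j = i}"
  by (rule lin_op_supported[OF lattice_ops]) auto

lemma lattice_total_zero:
  assumes "x \<in> supported E {j. \<gamma> j = i}" "\<gamma> k \<noteq> i + 1" "\<gamma> k \<noteq> i - 1"
  shows "total_map E x k = \<zero>\<^bsub>cmp E k\<^esub>"
proof (rule total_zero_nbr)
  fix l assume "l = k - 1 \<or> l = k + 1"
  then have "\<gamma> l \<noteq> i" using shapeD(2)[OF \<gamma>, of l k] assms(2,3) by auto
  then show "x l = \<zero>\<^bsub>cmp E l\<^esub>" using supported_zero[OF assms(1)] by simp
qed

text \<open>All three identities are D D = f, read in degrees i + 2, i - 2 and i. Neighbours differ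
  in degree by exactly one, so in the extreme degrees the truncation of D x is invisible to the
  second D and \<open>x\<close> has no component there; in degree i the two truncations add up to D
  x.\<close>

lemma lattice_kdg_mod: "lattice_module E \<gamma> \<in> kdg_mod B f"
  unfolding lattice_module_def
proof (rule site_kdg_mod)
  fix i x assume x: "x \<in> supported E {j. \<gamma> j = i}"
  note xf = supported_fs[OF x]
  let ?d = "\<lambda>j. if \<gamma> j = i + 1 then total_map E x j else \<zero>\<^bsub>cmp E j\<^esub>"
  let ?h = "\<lambda>j. if \<gamma> j = i - 1 then total_map E x j else \<zero>\<^bsub>cmp E j\<^esub>"
  show "?d \<in> supported E {j. \<gamma> j = i + 1}" "?h \<in> supported E {j. \<gamma> j = i - 1}"
    by (rule lattice_supported[OF xf])+
  note d = supported_fs[OF lattice_supported[OF xf]]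
  { fix j assume "j \<in> {j. \<gamma> j = i + 2}"
    then have j: "\<gamma> j = i + 2" by simp
    have "total_map E ?d j = total_map E (total_map E x) j"
    proof (rule total_cong_nbr)
      fix k assume "k = j - 1 \<or> k = j + 1"
      then show "?d k = total_map E x k" using lattice_total_zero[OF x, of k] shapeD(2)[OF \<gamma>, of k j] j by auto
    qed
    then show "(if \<gamma> j = i + 1 + 1 then total_map E ?d j else \<zero>\<^bsub>cmp E j\<^esub>) = \<zero>\<^bsub>cmp E j\<^esub>"
      using total_total[OF xf] supported_zero[OF x] j zero_smult by simp }
  { fix j assume "j \<in> {j. \<gamma> j = i - 2}"
    then have j: "\<gamma> j = i - 2" by simp
    have "total_map E ?h j = total_map E (total_map E x) j"
    proof (rule total_cong_nbr)
      fix k assume "k = j - 1 \<or> k = j + 1"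
      then show "?h k = total_map E x k" using lattice_total_zero[OF x, of k] shapeD(2)[OF \<gamma>, of k j] j by auto
    qed
    then show "(if \<gamma> j = i - 1 - 1 then total_map E ?h j else \<zero>\<^bsub>cmp E j\<^esub>) = \<zero>\<^bsub>cmp E j\<^esub>"
      using total_total[OF xf] supported_zero[OF x] j zero_smult by simp }
  { fix j assume "j \<in> {j. \<gamma> j = i}"
    then have j: "\<gamma> j = i" by simp
    have "total_map E ?h j \<oplus>\<^bsub>cmp E j\<^esub> total_map E ?d j = total_map E (\<lambda>k. ?h k \<oplus>\<^bsub>cmp E k\<^esub> ?d k) j"
      by (rule total_add[OF d d, symmetric])
    also have "\<dots> = total_map E (total_map E x) j"
    proof (rule total_cong_nbr)
      fix k assume "k = j - 1 \<or> k = j + 1"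
      then have "\<gamma> k = i - 1 \<or> \<gamma> k = i + 1" using shapeD(2)[OF \<gamma>, of k j] j by auto
      then show "?h k \<oplus>\<^bsub>cmp E k\<^esub> ?d k = total_map E x k"
        using fs_closed[OF total_closed[OF xf], of k] by (auto simp: M_simps)
    qed
    finally show "(if \<gamma> j = i - 1 + 1 then total_map E ?h j else \<zero>\<^bsub>cmp E j\<^esub>) \<oplus>\<^bsub>cmp E j\<^esub>
        (if \<gamma> j = i + 1 - 1 then total_map E ?d j else \<zero>\<^bsub>cmp E j\<^esub>) = f \<odot>\<^bsub>cmp E j\<^esub> x j"
      using total_total[OF xf] j by simp }
qed (rule lattice_ops)+

lemma lattice_coh_s: "lattice_module E \<gamma> \<in> coh_s B f"
  using lattice_kdg_mod unfolding lattice_module_def by (rule site_kdg_coh_s) simp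

end

section \<open>The roof as a dg module\<close>

context
  fixes \<gamma> \<gamma>' :: "int \<Rightarrow> int"
  assumes \<gamma>: "shape \<gamma>" and \<gamma>': "shape \<gamma>'" and le: "\<And>j. \<gamma> j \<le> \<gamma>' j"
begin

lemmas \<gamma>_nbr = shapeD(2)[OF \<gamma>] and \<gamma>_even = shapeD(1)[OF \<gamma>]
lemmas \<gamma>'_nbr = shapeD(2)[OF \<gamma>'] and \<gamma>'_even = shapeD(1)[OF \<gamma>']

abbreviation "J i \<equiv> {j. \<gamma> j \<le> i \<and> i \<le> \<gamma>' j}"

lemma roof_ops:
  "lin_op B E (roof_dif f E \<gamma> \<gamma>' i)" "lin_op B E (roof_hty E \<gamma> \<gamma>' i)"
  "lin_op B E (roof_bot E \<gamma> i)" "lin_op B E (roof_top E \<gamma>' i)"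
  unfolding roof_dif_def[abs_def] roof_hty_def[abs_def] roof_bot_def[abs_def] roof_top_def[abs_def]
  by (intro lin_op_intros)+

lemma roof_supported:
  assumes "x \<in> fun_space E"
  shows "roof_dif f E \<gamma> \<gamma>' i x \<in> supported E (J (i + 1))" "roof_hty E \<gamma> \<gamma>' i x \<in> supported E (J (i - 1))"
    "roof_bot E \<gamma> i x \<in> supported E {j. \<gamma> j = i}" "roof_top E \<gamma>' i x \<in> supported E {j. \<gamma>' j = i}"
proof -
  note sup = lin_op_supported[OF _ assms]
  show "roof_dif f E \<gamma> \<gamma>' i x \<in> supported E (J (i + 1))"
    by (rule sup[OF roof_ops(1)]) (simp only: roof_dif_def mem_Collect_eq if_False)
  show "roof_hty E \<gamma> \<gamma>' i x \<in> supported E (J (i - 1))"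
    by (rule sup[OF roof_ops(2)]) (simp only: roof_hty_def mem_Collect_eq if_False)
  show "roof_bot E \<gamma> i x \<in> supported E {j. \<gamma> j = i}"
    by (rule sup[OF roof_ops(3)]) (simp add: roof_bot_def)
  show "roof_top E \<gamma>' i x \<in> supported E {j. \<gamma>' j = i}"
    by (rule sup[OF roof_ops(4)]) (simp add: roof_top_def)
qed

text \<open>The truncation in \<open>roof_dif\<close> removes nothing below the lower boundary, where \<open>x\<close> and \<open>total_map E x\<close>
  already vanish.\<close>

lemma roof_dif_untruncated:
  assumes x: "x \<in> supported E (J i)" and j: "i + 1 \<le> \<gamma>' j"
  shows "even (i + 1 - j) \<Longrightarrow> roof_dif f E \<gamma> \<gamma>' i x j = total_map E x j \<ominus>\<^bsub>cmp E j\<^esub> f \<odot>\<^bsub>cmp E j\<^esub> x j"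
    and "odd (i + 1 - j) \<Longrightarrow> roof_dif f E \<gamma> \<gamma>' i x j = x j \<ominus>\<^bsub>cmp E j\<^esub> total_map E x j"
proof -
  have "x j = \<zero>\<^bsub>cmp E j\<^esub> \<and> total_map E x j = \<zero>\<^bsub>cmp E j\<^esub>" if "\<not> \<gamma> j \<le> i + 1"
  proof
    show "x j = \<zero>\<^bsub>cmp E j\<^esub>" using that by (intro supported_zero[OF x]) simp
    show "total_map E x j = \<zero>\<^bsub>cmp E j\<^esub>"
    proof (rule total_zero_nbr)
      fix k assume "k = j - 1 \<or> k = j + 1"
      then show "x k = \<zero>\<^bsub>cmp E k\<^esub>" using \<gamma>_nbr[of k j] that by (intro supported_zero[OF x]) auto
    qed
  qed
  then show "even (i + 1 - j) \<Longrightarrow> roof_dif f E \<gamma> \<gamma>' i x j = total_map E x j \<ominus>\<^bsub>cmp E j\<^esub> f \<odot>\<^bsub>cmp E j\<^esub> x j"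
    and "odd (i + 1 - j) \<Longrightarrow> roof_dif f E \<gamma> \<gamma>' i x j = x j \<ominus>\<^bsub>cmp E j\<^esub> total_map E x j"
    using j M_simps(1) by (auto simp: roof_dif_def zero_smult M_simps(7))
qed

lemma bot_total_zero:
  assumes "x \<in> fun_space E" "\<gamma> j \<noteq> i + 1" "\<gamma> j \<noteq> i - 1"
  shows "total_map E (roof_bot E \<gamma> i x) j = \<zero>\<^bsub>cmp E j\<^esub>"
  by (rule lattice_total_zero[OF \<gamma> roof_supported(3)[OF assms(1)] assms(2,3)])

text \<open>A neighbour of \<open>j\<close> has its bottom copy either in degree \<open>i\<close> or
  in degree \<open>i + 2\<close>; in the second case it is absent from degree \<open>i\<close>. So D
  only meets bottom copies here.\<close>

lemma bot_total:
  assumes x: "x \<in> supported E (J i)" and "\<gamma> j = i + 1"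
  shows "total_map E x j = total_map E (roof_bot E \<gamma> i x) j"
proof (rule total_cong_nbr)
  fix k assume "k = j - 1 \<or> k = j + 1"
  then have "\<gamma> k = i \<or> \<gamma> k = i + 2" using \<gamma>_nbr[of k j] assms(2) by auto
  then show "x k = roof_bot E \<gamma> i x k" using supported_zero[OF x, of k] by (auto simp: roof_bot_def)
qed

lemma roof_hty_bot:
  "roof_hty E \<gamma> \<gamma>' i x j = (if \<gamma> j \<le> i - 1 \<and> i - 1 \<le> \<gamma>' j then
       if even (i - 1 - j) then total_map E (roof_bot E \<gamma> i x) j else \<ominus>\<^bsub>cmp E j\<^esub> x j else \<zero>\<^bsub>cmp E j\<^esub>)"
  by (simp add: roof_hty_def roof_bot_def[abs_def])

text \<open>The rows (D, -f) and (1, -D) multiplied out, using D D = f. At the upper end the entries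
  entering D are still present, because neighbouring ranges end at most one degree apart.\<close>

lemma roof_dif_square:
  assumes x: "x \<in> supported E (J i)" and j: "j \<in> J (i + 2)"
  shows "roof_dif f E \<gamma> \<gamma>' (i + 1) (roof_dif f E \<gamma> \<gamma>' i x) j = \<zero>\<^bsub>cmp E j\<^esub>"
proof -
  let ?y = "roof_dif f E \<gamma> \<gamma>' i x"
  note xf = supported_fs[OF x]
  note Df = total_closed[OF xf]
  have j': "\<gamma> j \<le> i + 1 + 1 \<and> i + 1 + 1 \<le> \<gamma>' j" using j by simp
  have c: "x j \<in> carrier (cmp E j)" "total_map E x j \<in> carrier (cmp E j)"
    "f \<odot>\<^bsub>cmp E j\<^esub> x j \<in> carrier (cmp E j)" "f \<odot>\<^bsub>cmp E j\<^esub> total_map E x j \<in> carrier (cmp E j)"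
    using fs_closed[OF xf] fs_closed[OF Df] by (auto simp: M_simps f_closed)
  show ?thesis
  proof (cases "even (i + 1 + 1 - j)")
    case True
    have "total_map E ?y j = total_map E (\<lambda>k. total_map E x k \<ominus>\<^bsub>cmp E k\<^esub> f \<odot>\<^bsub>cmp E k\<^esub> x k) j"
    proof (rule total_cong_nbr)
      fix k assume k: "k = j - 1 \<or> k = j + 1"
      have "even (i + 1 - k)" using k True by auto
      moreover have "i + 1 \<le> \<gamma>' k" using \<gamma>'_nbr[OF k] j by auto
      ultimately show "?y k = total_map E x k \<ominus>\<^bsub>cmp E k\<^esub> f \<odot>\<^bsub>cmp E k\<^esub> x k"
        using roof_dif_untruncated(1)[OF x] by blast
    qed
    also have "\<dots> = f \<odot>\<^bsub>cmp E j\<^esub> x j \<ominus>\<^bsub>cmp E j\<^esub> f \<odot>\<^bsub>cmp E j\<^esub> total_map E x j"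
      by (simp add: total_diff[OF Df smult_fs[OF xf]] total_total[OF xf] total_smult_fs[OF xf])
    finally have 1: "total_map E ?y j = f \<odot>\<^bsub>cmp E j\<^esub> x j \<ominus>\<^bsub>cmp E j\<^esub> f \<odot>\<^bsub>cmp E j\<^esub> total_map E x j" .
    have "?y j = x j \<ominus>\<^bsub>cmp E j\<^esub> total_map E x j"
      using roof_dif_untruncated(2)[OF x, of j] True j by simp
    then have 2: "f \<odot>\<^bsub>cmp E j\<^esub> ?y j = f \<odot>\<^bsub>cmp E j\<^esub> x j \<ominus>\<^bsub>cmp E j\<^esub> f \<odot>\<^bsub>cmp E j\<^esub> total_map E x j"
      using smult_diff[OF xf Df] by simp
    show ?thesis
      unfolding roof_dif_def[of f E \<gamma> \<gamma>' "i + 1" ?y] using j' True 1 2 c by (simp add: self_diff M_simps)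
  next
    case False
    have g: "i + 3 \<le> \<gamma>' j" using \<gamma>'_even[of j] False j' by presburger
    have "total_map E ?y j = total_map E (\<lambda>k. x k \<ominus>\<^bsub>cmp E k\<^esub> total_map E x k) j"
    proof (rule total_cong_nbr)
      fix k assume k: "k = j - 1 \<or> k = j + 1"
      have "odd (i + 1 - k)" using k False by auto
      moreover have "i + 1 \<le> \<gamma>' k" using \<gamma>'_nbr[OF k] g by auto
      ultimately show "?y k = x k \<ominus>\<^bsub>cmp E k\<^esub> total_map E x k"
        using roof_dif_untruncated(2)[OF x] by blast
    qed
    also have "\<dots> = total_map E x j \<ominus>\<^bsub>cmp E j\<^esub> f \<odot>\<^bsub>cmp E j\<^esub> x j"
      by (simp add: total_diff[OF xf Df] total_total[OF xf])
    finally have 1: "total_map E ?y j = total_map E x j \<ominus>\<^bsub>cmp E j\<^esub> f \<odot>\<^bsub>cmp E j\<^esub> x j" .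
    have 2: "?y j = total_map E x j \<ominus>\<^bsub>cmp E j\<^esub> f \<odot>\<^bsub>cmp E j\<^esub> x j"
      using roof_dif_untruncated(1)[OF x, of j] False j by simp
    show ?thesis
      unfolding roof_dif_def[of f E \<gamma> \<gamma>' "i + 1" ?y] using j' False 1 2 c by (simp add: self_diff M_simps)
  qed
qed

text \<open>The action of \<epsilon> kills copies of the other parity. On bottom copies it is the
  action of the lattice module, where two steps down yield f times a component that vanishes because
  \<open>\<gamma> j\<close> is smaller than \<open>i\<close>.\<close>

lemma roof_hty_square:
  assumes x: "x \<in> supported E (J i)" and j: "j \<in> J (i - 2)"
  shows "roof_hty E \<gamma> \<gamma>' (i - 1) (roof_hty E \<gamma> \<gamma>' i x) j = \<zero>\<^bsub>cmp E j\<^esub>"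
proof -
  let ?y = "roof_hty E \<gamma> \<gamma>' i x"
  note xf = supported_fs[OF x]
  note Qf = supported_fs[OF roof_supported(3)[OF xf, of i]]
  show ?thesis
  proof (cases "even (i - 1 - 1 - j)")
    case True
    have "total_map E (roof_bot E \<gamma> (i - 1) ?y) j = total_map E (total_map E (roof_bot E \<gamma> i x)) j"
    proof (rule total_cong_nbr)
      fix k assume k: "k = j - 1 \<or> k = j + 1"
      show "roof_bot E \<gamma> (i - 1) ?y k = total_map E (roof_bot E \<gamma> i x) k"
      proof (cases "\<gamma> k = i - 1")
        case True
        then have "even (i - 1 - k)" using \<gamma>_even[of k] by simp
        then show ?thesis using True le[of k] by (simp add: roof_bot_def roof_hty_bot)
      next
        case False
        then have "\<gamma> k \<noteq> i + 1" using \<gamma>_nbr[OF k] j by auto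
        then show ?thesis using False bot_total_zero[OF xf] by (simp add: roof_bot_def)
      qed
    qed
    also have "\<dots> = f \<odot>\<^bsub>cmp E j\<^esub> roof_bot E \<gamma> i x j" by (rule total_total[OF Qf])
    also have "roof_bot E \<gamma> i x j = \<zero>\<^bsub>cmp E j\<^esub>" using j by (simp add: roof_bot_def)
    finally show ?thesis using True zero_smult unfolding roof_hty_bot[of "i - 1" ?y] by simp
  next
    case False
    then have "even (i - 1 - j)" by simp
    moreover have "\<gamma> j \<noteq> i - 1" "\<gamma> j \<noteq> i + 1" using j by auto
    ultimately have "?y j = \<zero>\<^bsub>cmp E j\<^esub>" using bot_total_zero[OF xf, of j i] by (simp add: roof_hty_bot)
    then show ?thesis using False M_simps(9) unfolding roof_hty_bot[of "i - 1" ?y] by simp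
  qed
qed

text \<open>Let Q be the bottom part of x. In copies of the parity of i, the two terms with D add up
  to D D Q = f Q, and the term -f (h x) contributes -f Q + f x. In the other copies the sum
  telescopes: D Q - (D Q - D x) - (D x - f x).\<close>

lemma roof_homotopy:
  assumes x: "x \<in> supported E (J i)" and j: "j \<in> J i"
  shows "roof_dif f E \<gamma> \<gamma>' (i - 1) (roof_hty E \<gamma> \<gamma>' i x) j \<oplus>\<^bsub>cmp E j\<^esub>
    roof_hty E \<gamma> \<gamma>' (i + 1) (roof_dif f E \<gamma> \<gamma>' i x) j = f \<odot>\<^bsub>cmp E j\<^esub> x j"
proof -
  let ?y = "roof_hty E \<gamma> \<gamma>' i x" and ?w = "roof_dif f E \<gamma> \<gamma>' i x" and ?Q = "roof_bot E \<gamma> i x"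
  note xf = supported_fs[OF x]
  note Df = total_closed[OF xf]
  note Qf = supported_fs[OF roof_supported(3)[OF xf, of i]]
  note DQf = total_closed[OF Qf]
  note c = fs_closed[OF xf] fs_closed[OF Df] fs_closed[OF Qf] fs_closed[OF DQf]
  have cf: "f \<odot>\<^bsub>cmp E k\<^esub> x k \<in> carrier (cmp E k)" "f \<odot>\<^bsub>cmp E k\<^esub> ?Q k \<in> carrier (cmp E k)" for k
    using c by (auto simp: M_simps f_closed)
  have rw: "roof_dif f E \<gamma> \<gamma>' (i - 1) ?y j = (if even (i - j) then total_map E ?y j \<ominus>\<^bsub>cmp E j\<^esub> f \<odot>\<^bsub>cmp E j\<^esub> ?y j
       else ?y j \<ominus>\<^bsub>cmp E j\<^esub> total_map E ?y j)"
    "roof_hty E \<gamma> \<gamma>' (i + 1) ?w j = (if even (i - j) then total_map E (roof_bot E \<gamma> (i + 1) ?w) j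
       else \<ominus>\<^bsub>cmp E j\<^esub> ?w j)"
    using j unfolding roof_dif_def[of f E \<gamma> \<gamma>' "i - 1" ?y] roof_hty_bot[of "i + 1" ?w] by simp_all
  show ?thesis
  proof (cases "even (i - j)")
    case True
    \<comment> \<open>One formula for both cases: at the bottom copy the left side is zero and
      \<open>?Q j\<close> equals \<open>x j\<close>, while elsewhere \<open>?Q j\<close> is
      zero.\<close>
    have y_j: "?y j = ?Q j \<ominus>\<^bsub>cmp E j\<^esub> x j"
    proof (cases "\<gamma> j = i")
      case True
      then show ?thesis using self_diff[OF c(1)] by (simp add: roof_hty_bot roof_bot_def)
    next
      case False
      then have "\<gamma> j \<le> i - 1 \<and> i - 1 \<le> \<gamma>' j" using j by auto
      then show ?thesis using True False M_simps(5)[OF M_simps(4)[OF c(1)]]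
        by (simp add: roof_hty_bot roof_bot_def a_minus_def)
    qed
    have yf: "?y \<in> fun_space E" by (rule supported_fs[OF roof_supported(2)[OF xf]])
    have bwf: "roof_bot E \<gamma> (i + 1) ?w \<in> fun_space E"
      by (rule supported_fs[OF roof_supported(3)[OF supported_fs[OF roof_supported(1)[OF xf]]]])
    have "total_map E ?y j \<oplus>\<^bsub>cmp E j\<^esub> total_map E (roof_bot E \<gamma> (i + 1) ?w) j
        = total_map E (\<lambda>k. ?y k \<oplus>\<^bsub>cmp E k\<^esub> roof_bot E \<gamma> (i + 1) ?w k) j"
      by (rule total_add[OF yf bwf, symmetric])
    \<comment> \<open>Each neighbour is supplied exactly once: by the bottom part of d x if its
      range starts in degree i + 1, and by h x if it starts at or below i - 1.\<close>
    also have "\<dots> = total_map E (total_map E ?Q) j"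
    proof (rule total_cong_nbr)
      fix k assume k: "k = j - 1 \<or> k = j + 1"
      have par: "even (i - 1 - k)" "even (i + 1 - k)" using k True by auto
      show "?y k \<oplus>\<^bsub>cmp E k\<^esub> roof_bot E \<gamma> (i + 1) ?w k = total_map E ?Q k"
      proof (cases "\<gamma> k = i + 1")
        case True
        have "x k = \<zero>\<^bsub>cmp E k\<^esub>" using True by (intro supported_zero[OF x]) simp
        then have "?w k = total_map E ?Q k"
          using roof_dif_untruncated(1)[OF x _ par(2)] le[of k] True bot_total[OF x True] zero_smult M_simps(7)[OF c(4)]
          by simp
        then show ?thesis using True M_simps(5)[OF c(4)] by (simp add: roof_hty_bot roof_bot_def)
      next
        case False
        have "\<gamma> k \<noteq> i" using \<gamma>_even[of k] par by presburger
        then have "\<gamma> k \<le> i - 1" "i - 1 \<le> \<gamma>' k" using \<gamma>_nbr[OF k] \<gamma>'_nbr[OF k] j False by auto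
        then show ?thesis using False par M_simps(6)[OF c(4)] by (simp add: roof_hty_bot roof_bot_def[of E \<gamma> "i + 1" ?w])
      qed
    qed
    also have "\<dots> = f \<odot>\<^bsub>cmp E j\<^esub> ?Q j" by (rule total_total[OF Qf])
    finally have s: "total_map E ?y j \<oplus>\<^bsub>cmp E j\<^esub> total_map E (roof_bot E \<gamma> (i + 1) ?w) j = f \<odot>\<^bsub>cmp E j\<^esub> ?Q j" .
    have fy: "f \<odot>\<^bsub>cmp E j\<^esub> ?y j = f \<odot>\<^bsub>cmp E j\<^esub> ?Q j \<ominus>\<^bsub>cmp E j\<^esub> f \<odot>\<^bsub>cmp E j\<^esub> x j"
      unfolding y_j by (rule smult_diff[OF Qf xf])
    have "(total_map E ?y j \<ominus>\<^bsub>cmp E j\<^esub> f \<odot>\<^bsub>cmp E j\<^esub> ?y j) \<oplus>\<^bsub>cmp E j\<^esub> total_map E (roof_bot E \<gamma> (i + 1) ?w) j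
       = (total_map E ?y j \<oplus>\<^bsub>cmp E j\<^esub> total_map E (roof_bot E \<gamma> (i + 1) ?w) j) \<ominus>\<^bsub>cmp E j\<^esub> f \<odot>\<^bsub>cmp E j\<^esub> ?y j"
      by (rule lin_eq, (rule lin_rules | (rule lin_atom,
          (simp add: fs_closed[OF total_closed[OF yf]] fs_closed[OF total_closed[OF bwf]] fs_closed[OF yf] M_simps(10) f_closed; fail)))+, simp)
    also have "\<dots> = f \<odot>\<^bsub>cmp E j\<^esub> x j"
      unfolding s fy by (rule lin_eq, (rule lin_rules | (rule lin_atom, (simp add: cf; fail)))+, simp)
    finally show ?thesis unfolding rw using True by simp
  next
    case False
    have par: "even (i - 1 - j)" "even (i + 1 - j)" using False by auto
    \<comment> \<open>Both ends of the range have the parity of \<open>j\<close>, so a copy of the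
      other parity is strictly inside.\<close>
    have g: "\<gamma> j \<le> i - 1" "i + 1 \<le> \<gamma>' j"
      using \<gamma>_even[of j] \<gamma>'_even[of j] False j unfolding mem_Collect_eq by presburger+
    have y_j: "?y j = total_map E ?Q j" using g par by (simp add: roof_hty_bot)
    have "total_map E ?y j = total_map E (\<lambda>k. ?Q k \<ominus>\<^bsub>cmp E k\<^esub> x k) j"
    proof (rule total_cong_nbr)
      fix k assume k: "k = j - 1 \<or> k = j + 1"
      have park: "odd (i - 1 - k)" using k False by auto
      have gk: "\<gamma> k \<le> i" "i - 1 \<le> \<gamma>' k" using \<gamma>_nbr[OF k] \<gamma>'_nbr[OF k] g by auto
      show "?y k = ?Q k \<ominus>\<^bsub>cmp E k\<^esub> x k"
      proof (cases "\<gamma> k = i")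
        case True
        then show ?thesis using self_diff[OF c(1)] by (simp add: roof_hty_bot roof_bot_def)
      next
        case False
        then show ?thesis using gk park M_simps(5)[OF M_simps(4)[OF c(1)]]
          by (simp add: roof_hty_bot roof_bot_def a_minus_def)
      qed
    qed
    then have Dy: "total_map E ?y j = total_map E ?Q j \<ominus>\<^bsub>cmp E j\<^esub> total_map E x j" using total_diff[OF Qf xf] by simp
    have w_j: "?w j = total_map E x j \<ominus>\<^bsub>cmp E j\<^esub> f \<odot>\<^bsub>cmp E j\<^esub> x j"
      by (rule roof_dif_untruncated(1)[OF x g(2) par(2)])
    have "(?y j \<ominus>\<^bsub>cmp E j\<^esub> total_map E ?y j) \<oplus>\<^bsub>cmp E j\<^esub> \<ominus>\<^bsub>cmp E j\<^esub> ?w j = f \<odot>\<^bsub>cmp E j\<^esub> x j"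
      unfolding y_j Dy w_j by (rule lin_eq, (rule lin_rules | (rule lin_atom, (simp add: c cf; fail)))+, simp)
    then show ?thesis unfolding rw using False by simp
  qed
qed

lemma roof_kdg_mod: "roof f E \<gamma> \<gamma>' \<in> kdg_mod B f"
  unfolding roof_def
  by (rule site_kdg_mod[OF roof_ops(1) roof_supported(1)[OF supported_fs] roof_ops(2) roof_supported(2)[OF supported_fs]
        roof_dif_square roof_hty_square roof_homotopy])

lemma roof_coh_s: "roof f E \<gamma> \<gamma>' \<in> coh_s B f"
  using roof_kdg_mod unfolding roof_def
proof (rule site_kdg_coh_s)
  fix j
  have "{i. j \<in> J i} \<subseteq> {\<gamma> j..\<gamma>' j}" by auto
  then show "finite {i. j \<in> J i}" by (rule finite_subset) simp
qed


section \<open>The two projections of the roof\<close>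

lemma bot_cocycle: "to_bot E \<gamma> \<gamma>' \<in> cocycles B (roof f E \<gamma> \<gamma>') (lattice_module E \<gamma>)"
  unfolding roof_def lattice_module_def
proof (rule site_map_cocycle[OF lattice_kdg_mod[OF \<gamma>, unfolded lattice_module_def]
      roof_supported(1)[OF supported_fs] roof_supported(2)[OF supported_fs] roof_ops(3) roof_supported(3)[OF supported_fs]])
  fix i x j assume x: "x \<in> supported E (J i)"
  note Qf = supported_fs[OF roof_supported(3)[OF supported_fs[OF x], of i]]
  show "roof_bot E \<gamma> (i + 1) (roof_dif f E \<gamma> \<gamma>' i x) j
      = (if \<gamma> j = i + 1 then total_map E (roof_bot E \<gamma> i x) j else \<zero>\<^bsub>cmp E j\<^esub>)" if "j \<in> {j. \<gamma> j = i + 1}"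
  proof -
    have j: "\<gamma> j = i + 1" using that by simp
    have "even (i + 1 - j)" "i + 1 \<le> \<gamma>' j" using \<gamma>_even[of j] le[of j] j by auto
    moreover have "x j = \<zero>\<^bsub>cmp E j\<^esub>" using j by (intro supported_zero[OF x]) simp
    ultimately show ?thesis
      using roof_dif_untruncated(1)[OF x] bot_total[OF x j] zero_smult M_simps(7)[OF fs_closed[OF total_closed[OF Qf]]] j
      by (simp add: roof_bot_def[of E \<gamma> "i + 1"])
  qed
  show "roof_bot E \<gamma> (i - 1) (roof_hty E \<gamma> \<gamma>' i x) j
      = (if \<gamma> j = i - 1 then total_map E (roof_bot E \<gamma> i x) j else \<zero>\<^bsub>cmp E j\<^esub>)" if "j \<in> {j. \<gamma> j = i - 1}"
  proof -
    have j: "\<gamma> j = i - 1" using that by simp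
    have "even (i - 1 - j)" using \<gamma>_even[of j] j by simp
    then show ?thesis using j le[of j] by (simp add: roof_hty_bot roof_bot_def[of E \<gamma> "i - 1"])
  qed
qed

text \<open>Let T be the projection and Q the bottom part of x. For d: on the neighbours, d x and T
  x complement each other to x - D x, so D(d x) + D(T x) = D x - f x, which is d x at the top. For
  \<epsilon>: h x is D Q at the top and D(h x) is D Q - D x, so their difference is D x, which
  equals D(T x).\<close>

lemma top_cocycle: "to_top E \<gamma> \<gamma>' \<in> cocycles B (roof f E \<gamma> \<gamma>') (lattice_module E \<gamma>')"
  unfolding roof_def lattice_module_def
proof (rule site_map_cocycle[OF lattice_kdg_mod[OF \<gamma>', unfolded lattice_module_def]
      roof_supported(1)[OF supported_fs] roof_supported(2)[OF supported_fs] roof_ops(4) roof_supported(4)[OF supported_fs]])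
  fix i x j assume x: "x \<in> supported E (J i)"
  let ?y = "roof_hty E \<gamma> \<gamma>' i x" and ?w = "roof_dif f E \<gamma> \<gamma>' i x" and ?Q = "roof_bot E \<gamma> i x" and ?T = "roof_top E \<gamma>' i x"
  note xf = supported_fs[OF x]
  note Df = total_closed[OF xf]
  note Qf = supported_fs[OF roof_supported(3)[OF xf, of i]]
  note Tf = supported_fs[OF roof_supported(4)[OF xf, of i]]
  note wf = supported_fs[OF roof_supported(1)[OF xf, of i]]
  note c = fs_closed[OF xf] fs_closed[OF Df] fs_closed[OF Qf] fs_closed[OF total_closed[OF Qf]]
    fs_closed[OF total_closed[OF Tf]] fs_closed[OF total_closed[OF wf]]
  have cf: "f \<odot>\<^bsub>cmp E k\<^esub> x k \<in> carrier (cmp E k)" for k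
    using c by (auto simp: M_simps f_closed)
  show "roof_top E \<gamma>' (i + 1) ?w j = (if \<gamma>' j = i + 1 then total_map E ?T j else \<zero>\<^bsub>cmp E j\<^esub>)"
    if "j \<in> {j. \<gamma>' j = i + 1}"
  proof -
    have j: "\<gamma>' j = i + 1" using that by simp
    have par: "even (i + 1 - j)" using \<gamma>'_even[of j] j by simp
    have w_j: "?w j = total_map E x j \<ominus>\<^bsub>cmp E j\<^esub> f \<odot>\<^bsub>cmp E j\<^esub> x j"
      by (rule roof_dif_untruncated(1)[OF x _ par]) (simp add: j)
    have "total_map E ?w j \<oplus>\<^bsub>cmp E j\<^esub> total_map E ?T j = total_map E (\<lambda>k. ?w k \<oplus>\<^bsub>cmp E k\<^esub> ?T k) j"
      by (rule total_add[OF wf Tf, symmetric])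
    also have "\<dots> = total_map E (\<lambda>k. x k \<ominus>\<^bsub>cmp E k\<^esub> total_map E x k) j"
    proof (rule total_cong_nbr)
      fix k assume k: "k = j - 1 \<or> k = j + 1"
      have cd: "x k \<ominus>\<^bsub>cmp E k\<^esub> total_map E x k \<in> carrier (cmp E k)" by (rule M_simps(3)[OF c(1,2)])
      \<comment> \<open>Either the range of the neighbour ends in degree i and only the projection
        sees it, or it reaches i + 2 and only the differential does.\<close>
      consider "\<gamma>' k = i" | "\<gamma>' k = i + 2" using \<gamma>'_nbr[OF k] j by auto
      then show "?w k \<oplus>\<^bsub>cmp E k\<^esub> ?T k = x k \<ominus>\<^bsub>cmp E k\<^esub> total_map E x k"
      proof cases
        case 1
        then show ?thesis using M_simps(5)[OF cd] by (simp add: roof_top_def roof_dif_def)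
      next
        case 2
        have "odd (i + 1 - k)" using k par by auto
        then show ?thesis using roof_dif_untruncated(2)[OF x, of k] 2 M_simps(6)[OF cd] by (simp add: roof_top_def)
      qed
    qed
    also have "\<dots> = ?w j" unfolding total_diff[OF xf Df] total_total[OF xf] w_j ..
    finally have s: "total_map E ?w j \<oplus>\<^bsub>cmp E j\<^esub> total_map E ?T j = ?w j" .
    have "(total_map E ?w j \<oplus>\<^bsub>cmp E j\<^esub> total_map E ?T j) \<ominus>\<^bsub>cmp E j\<^esub> total_map E ?w j = total_map E ?T j"
      by (rule lin_eq, (rule lin_rules | (rule lin_atom, (simp add: c; fail)))+, simp)
    then show ?thesis unfolding s using j by (simp add: roof_top_def[of E \<gamma>' "i + 1"])
  qed
  show "roof_top E \<gamma>' (i - 1) ?y j = (if \<gamma>' j = i - 1 then total_map E ?T j else \<zero>\<^bsub>cmp E j\<^esub>)"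
    if "j \<in> {j. \<gamma>' j = i - 1}"
  proof -
    have j: "\<gamma>' j = i - 1" using that by simp
    have par: "even (i - 1 - j)" using \<gamma>'_even[of j] j by simp
    have y_j: "?y j = total_map E ?Q j" using j le[of j] par by (simp add: roof_hty_bot)
    \<comment> \<open>The range of \<open>j\<close> ends in degree i - 1, below the degree of x.
      This removes the term f x from D(x - D x).\<close>
    have xj: "x j = \<zero>\<^bsub>cmp E j\<^esub>" using j by (intro supported_zero[OF x]) simp
    have "total_map E ?y j = total_map E (\<lambda>k. ?Q k \<ominus>\<^bsub>cmp E k\<^esub> x k) j"
    proof (rule total_cong_nbr)
      fix k assume k: "k = j - 1 \<or> k = j + 1"
      have park: "odd (i - 1 - k)" using k par by auto
      consider "\<gamma>' k = i" "\<gamma> k = i" | "\<gamma>' k = i" "\<gamma> k \<le> i - 1" | "\<gamma>' k = i - 2" "\<gamma> k \<le> i - 2"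
        using \<gamma>'_nbr[OF k] j le[of k] by force
      then show "?y k = ?Q k \<ominus>\<^bsub>cmp E k\<^esub> x k"
      proof cases
        case 1
        then show ?thesis using self_diff[OF c(1)] by (simp add: roof_hty_bot roof_bot_def)
      next
        case 2
        then show ?thesis using park M_simps(5)[OF M_simps(4)[OF c(1)]]
          by (simp add: roof_hty_bot roof_bot_def a_minus_def)
      next
        case 3
        then have "x k = \<zero>\<^bsub>cmp E k\<^esub>" by (intro supported_zero[OF x]) simp
        then show ?thesis using 3 self_diff[OF M_simps(1)] by (simp add: roof_hty_bot roof_bot_def)
      qed
    qed
    then have Dy: "total_map E ?y j = total_map E ?Q j \<ominus>\<^bsub>cmp E j\<^esub> total_map E x j" using total_diff[OF Qf xf] by simp
    have "total_map E ?T j = total_map E (\<lambda>k. x k \<ominus>\<^bsub>cmp E k\<^esub> total_map E x k) j"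
    proof (rule total_cong_nbr)
      fix k assume k: "k = j - 1 \<or> k = j + 1"
      consider "\<gamma>' k = i" | "\<gamma>' k = i - 2" using \<gamma>'_nbr[OF k] j by auto
      then show "?T k = x k \<ominus>\<^bsub>cmp E k\<^esub> total_map E x k"
      proof cases
        case 2
        have "total_map E x k = \<zero>\<^bsub>cmp E k\<^esub>"
        proof (rule total_zero_nbr)
          fix l assume "l = k - 1 \<or> l = k + 1"
          then show "x l = \<zero>\<^bsub>cmp E l\<^esub>" using \<gamma>'_nbr[of l k] 2 by (intro supported_zero[OF x]) auto
        qed
        moreover have "x k = \<zero>\<^bsub>cmp E k\<^esub>" using 2 by (intro supported_zero[OF x]) simp
        ultimately show ?thesis using 2 self_diff[OF M_simps(1)] by (simp add: roof_top_def)
      qed (simp add: roof_top_def)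
    qed
    also have "\<dots> = total_map E x j"
      unfolding total_diff[OF xf Df] total_total[OF xf] xj zero_smult by (rule M_simps(7)[OF c(2)])
    finally have T: "total_map E ?T j = total_map E x j" .
    have "?y j \<ominus>\<^bsub>cmp E j\<^esub> total_map E ?y j = total_map E x j"
      unfolding y_j Dy by (rule lin_eq, (rule lin_rules | (rule lin_atom, (simp add: c; fail)))+, simp)
    then show ?thesis unfolding T using j by (simp add: roof_top_def[of E \<gamma>' "i - 1"])
  qed
qed

section \<open>Kernels of the projections\<close>

lemma family_eq_zero: "family K x = \<zero>\<^bsub>direct_sum K (cmp E)\<^esub> \<Longrightarrow> j \<in> K \<Longrightarrow> x j = \<zero>\<^bsub>cmp E j\<^esub>"
  unfolding family_zero family_def univ.inject by (metis restrict_apply')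

lemma bot_surj:
  assumes "y \<in> carrier (cmp (lattice_module E \<gamma>) i)"
  shows "\<exists>z\<in>carrier (cmp (roof f E \<gamma> \<gamma>') i). to_bot E \<gamma> \<gamma>' i z = y"
proof -
  have "y \<in> carrier (direct_sum {j. \<gamma> j = i} (cmp E))" using assms by (simp add: lattice_module_def)
  then obtain x where x: "x \<in> supported E {j. \<gamma> j = i}" "y = family {j. \<gamma> j = i} x" by (rule familyE)
  have xJ: "x \<in> supported E (J i)" by (rule supported_mono[OF x(1)]) (use le in auto)
  show ?thesis
  proof (rule bexI)
    show "to_bot E \<gamma> \<gamma>' i (family (J i) x) = y"
      unfolding site_map_family[where J = J and i = i, OF xJ] x(2)
      by (rule family_cong) (simp add: roof_bot_def)
    show "family (J i) x \<in> carrier (cmp (roof f E \<gamma> \<gamma>') i)"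
      using family_closed[OF supported_fs[OF x(1)]] by (simp add: roof_def)
  qed
qed

text \<open>An element supported on top copies is its own preimage: the correction D x lives on
  neighbours, whose upper ends lie in other degrees, so it vanishes where the projection is
  read.\<close>

lemma top_surj:
  assumes "y \<in> carrier (cmp (lattice_module E \<gamma>') i)"
  shows "\<exists>z\<in>carrier (cmp (roof f E \<gamma> \<gamma>') i). to_top E \<gamma> \<gamma>' i z = y"
proof -
  have "y \<in> carrier (direct_sum {j. \<gamma>' j = i} (cmp E))" using assms by (simp add: lattice_module_def)
  then obtain x where x: "x \<in> supported E {j. \<gamma>' j = i}" "y = family {j. \<gamma>' j = i} x" by (rule familyE)
  have xJ: "x \<in> supported E (J i)" by (rule supported_mono[OF x(1)]) (use le in auto)
  show ?thesis
  proof (rule bexI)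
    show "to_top E \<gamma> \<gamma>' i (family (J i) x) = y"
      unfolding site_map_family[where J = J and i = i, OF xJ] x(2)
    proof (rule family_cong)
      fix j assume "j \<in> {j. \<gamma>' j = i}"
      then have "\<gamma>' j = i" by simp
      moreover from this have "total_map E x j = \<zero>\<^bsub>cmp E j\<^esub>" by (intro lattice_total_zero[OF \<gamma>' x(1)]) auto
      ultimately show "roof_top E \<gamma>' i x j = x j"
        using M_simps(7)[OF fs_closed[OF supported_fs[OF x(1)]]] by (simp add: roof_top_def)
    qed
    show "family (J i) x \<in> carrier (cmp (roof f E \<gamma> \<gamma>') i)"
      using family_closed[OF supported_fs[OF x(1)]] by (simp add: roof_def)
  qed
qed

lemma roof_kernelE:
  assumes "z \<in> kernel_set (roof f E \<gamma> \<gamma>') (lattice_module E \<delta>) (site_map E J (\<lambda>i. {j. \<delta> j = i}) T) i"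
  obtains x where "x \<in> supported E (J i)" "z = family (J i) x" "\<forall>j. \<delta> j = i \<longrightarrow> T i x j = \<zero>\<^bsub>cmp E j\<^esub>"
proof -
  have z: "z \<in> carrier (direct_sum (J i) (cmp E))" "site_map E J (\<lambda>i. {j. \<delta> j = i}) T i z = \<zero>\<^bsub>direct_sum {j. \<delta> j = i} (cmp E)\<^esub>"
    using assms by (simp_all add: kernel_set_def roof_def lattice_module_def)
  obtain x where x: "x \<in> supported E (J i)" "z = family (J i) x" using z(1) by (rule familyE)
  show thesis
  proof (rule that[OF x], intro allI impI)
    fix j assume "\<delta> j = i"
    then show "T i x j = \<zero>\<^bsub>cmp E j\<^esub>"
      using family_eq_zero[OF z(2)[unfolded x(2) site_map_family[where J = J and i = i, OF x(1)]], of j] by simp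
  qed
qed

lemma roof_kernelI:
  assumes "x \<in> supported E (J i)" "\<And>j. \<delta> j = i \<Longrightarrow> T i x j = \<zero>\<^bsub>cmp E j\<^esub>"
  shows "family (J i) x \<in> kernel_set (roof f E \<gamma> \<gamma>') (lattice_module E \<delta>) (site_map E J (\<lambda>i. {j. \<delta> j = i}) T) i"
  using family_closed[OF supported_fs[OF assms(1)]] assms(2)
  by (auto simp: kernel_set_def roof_def lattice_module_def site_map_family[where J = J and i = i, OF assms(1)] family_zero
      intro!: family_cong)

text \<open>In a cocycle of the kernel the components of matching parity satisfy x = D x, so they
  are determined by the others. The others are hit by the identity maps from one degree below, which
  yields a primitive.\<close>

lemma top_cone_perf: "dg_cone (roof f E \<gamma> \<gamma>') (lattice_module E \<gamma>') (to_top E \<gamma> \<gamma>') \<in> perf B f"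
proof (rule perf_cone_of_surjection[OF roof_kdg_mod lattice_kdg_mod[OF \<gamma>'] top_cocycle top_surj])
  let ?S = "kernel_set (roof f E \<gamma> \<gamma>') (lattice_module E \<gamma>') (to_top E \<gamma> \<gamma>')"
  show "sub_kdg (roof f E \<gamma> \<gamma>') ?S \<in> perf B f"
  proof (rule perf_acyclic[OF cring_B f_closed kernel_kdg_mod[OF roof_kdg_mod lattice_kdg_mod[OF \<gamma>'] top_cocycle]])
    fix i z assume "z \<in> carrier (cmp (sub_kdg (roof f E \<gamma> \<gamma>') ?S) i)"
      and dz: "dif (sub_kdg (roof f E \<gamma> \<gamma>') ?S) i z = \<zero>\<^bsub>cmp (sub_kdg (roof f E \<gamma> \<gamma>') ?S) (i + 1)\<^esub>"
    then have "z \<in> ?S i" by simp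
    then obtain x where x: "x \<in> supported E (J i)" "z = family (J i) x"
      and Tx: "\<forall>j. \<gamma>' j = i \<longrightarrow> roof_top E \<gamma>' i x j = \<zero>\<^bsub>cmp E j\<^esub>" by (rule roof_kernelE)
    note xf = supported_fs[OF x(1)]
    note c = fs_closed[OF xf] fs_closed[OF total_closed[OF xf]]
    have dx: "roof_dif f E \<gamma> \<gamma>' i x j = \<zero>\<^bsub>cmp E j\<^esub>" if "j \<in> J (i + 1)" for j
      using dz that family_eq_zero[of "J (i + 1)" "roof_dif f E \<gamma> \<gamma>' i x" j]
        site_map_family[where J = J and i = i and J' = "\<lambda>i. J (i + 1)" and T = "roof_dif f E \<gamma> \<gamma>'", OF x(1)]
      by (simp add: x(2) roof_def)
    \<comment> \<open>The primitive: the components of the other parity, moved back along the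
      identity maps to degree i - 1.\<close>
    define t where "t = (\<lambda>j. if j \<in> J (i - 1) \<and> odd (i - j) then x j else \<zero>\<^bsub>cmp E j\<^esub>)"
    have t: "t \<in> supported E (J (i - 1))"
      using xf M_simps(1) by (auto simp: t_def supported_def fun_space_def)
    note tf = supported_fs[OF t]
    have t_odd: "t k = x k" if "odd (i - k)" for k
    proof (cases "k \<in> J (i - 1)")
      case True
      then show ?thesis using that by (simp add: t_def)
    next
      case False
      \<comment> \<open>A copy of the other parity is strictly inside the range, so a copy present
        in degree i would also be present in degree i - 1.\<close>
      have "k \<notin> J i"
        using False that \<gamma>_even[of k] \<gamma>'_even[of k] unfolding mem_Collect_eq by presburger
      then show ?thesis using that supported_zero[OF x(1), of k] False by (simp add: t_def)
    qed
    have t_even: "t k = \<zero>\<^bsub>cmp E k\<^esub>" if "even (i - k)" for k using that by (simp add: t_def)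
    have tK: "family (J (i - 1)) t \<in> ?S (i - 1)"
    proof (rule roof_kernelI[OF t])
      fix j assume j: "\<gamma>' j = i - 1"
      have "t j = \<zero>\<^bsub>cmp E j\<^esub>" using supported_zero[OF x(1), of j] j by (simp add: t_def)
      moreover have "total_map E t j = \<zero>\<^bsub>cmp E j\<^esub>"
      proof (rule total_zero_nbr)
        fix k assume k: "k = j - 1 \<or> k = j + 1"
        have "even (i - k)" using k j \<gamma>'_even[of j] by auto
        then show "t k = \<zero>\<^bsub>cmp E k\<^esub>" by (rule t_even)
      qed
      ultimately show "roof_top E \<gamma>' (i - 1) t j = \<zero>\<^bsub>cmp E j\<^esub>"
        using self_diff[OF M_simps(1)] by (simp add: roof_top_def)
    qed
    have "roof_dif f E \<gamma> \<gamma>' (i - 1) t j = x j" if j: "j \<in> J i" for j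
    proof (cases "even (i - j)")
      case True
      have "total_map E t j = total_map E x j"
      proof (rule total_cong_nbr)
        fix k assume k: "k = j - 1 \<or> k = j + 1"
        have "odd (i - k)" using k True by auto
        then show "t k = x k" by (rule t_odd)
      qed
      then have "roof_dif f E \<gamma> \<gamma>' (i - 1) t j = total_map E x j"
        using j True t_even[OF True] zero_smult M_simps(7)[OF c(2)] by (simp add: roof_dif_def)
      \<comment> \<open>Below the top this is a component of the cocycle condition. At the top the
        differential has no such component, and membership in the kernel of the projection takes its
        place.\<close>
      moreover have "x j \<ominus>\<^bsub>cmp E j\<^esub> total_map E x j = \<zero>\<^bsub>cmp E j\<^esub>"
      proof (cases "\<gamma>' j = i")
        case True
        then show ?thesis using Tx by (simp add: roof_top_def)
      next
        case False
        then have "j \<in> J (i + 1)" using j by auto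
        then show ?thesis using dx[of j] True by (simp add: roof_dif_def)
      qed
      ultimately show ?thesis using minus_eq_zero_iff[OF mE c] by simp
    next
      case False
      have "total_map E t j = \<zero>\<^bsub>cmp E j\<^esub>"
      proof (rule total_zero_nbr)
        fix k assume k: "k = j - 1 \<or> k = j + 1"
        have "even (i - k)" using k False by auto
        then show "t k = \<zero>\<^bsub>cmp E k\<^esub>" by (rule t_even)
      qed
      then show ?thesis using j False t_odd[OF False] M_simps(7)[OF c(1)] by (simp add: roof_dif_def)
    qed
    then have "dif (roof f E \<gamma> \<gamma>') (i - 1) (family (J (i - 1)) t) = z"
      using site_map_family[where J = J and i = "i - 1" and J' = "\<lambda>i. J (i + 1)" and T = "roof_dif f E \<gamma> \<gamma>'", OF t]
      unfolding x(2) roof_def site_kdg_simps by (simp, intro family_cong) auto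
    then show "z \<in> dif (sub_kdg (roof f E \<gamma> \<gamma>') ?S) (i - 1) ` carrier (cmp (sub_kdg (roof f E \<gamma> \<gamma>') ?S) (i - 1))"
      using tK by force
  qed
qed

text \<open>The inverse of the action of \<epsilon> by -1: from a copy of the other parity up to the
  copy of matching parity. The strict inequality excludes bottom copies as targets, so that the
  contraction preserves the kernel of \<open>to_bot\<close>.\<close>

definition contraction :: "int \<Rightarrow> (int \<Rightarrow> ('b, 'x) univ) \<Rightarrow> int \<Rightarrow> ('b, 'x) univ" where
  "contraction i x j = (if even (i + 1 - j) \<and> \<gamma> j < i + 1 \<and> i + 1 \<le> \<gamma>' j then \<ominus>\<^bsub>cmp E j\<^esub> x j else \<zero>\<^bsub>cmp E j\<^esub>)"

lemma contraction_op: "lin_op B E (contraction i)"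
  unfolding contraction_def[abs_def] by (intro lin_op_intros)

lemma contraction_supported: "x \<in> fun_space E \<Longrightarrow> contraction i x \<in> supported E (J (i + 1))"
  by (rule lin_op_supported[OF contraction_op]) (auto simp: contraction_def)

text \<open>Copies of matching parity go down and come back, the others go up and come back, with
  the two signs cancelling. Bottom copies are the only ones with nowhere to go, and there
  \<open>x\<close> vanishes by assumption.\<close>

lemma contraction_eq:
  assumes x: "x \<in> supported E (J i)" and Qx: "\<And>j. \<gamma> j = i \<Longrightarrow> x j = \<zero>\<^bsub>cmp E j\<^esub>" and j: "j \<in> J i"
  shows "roof_hty E \<gamma> \<gamma>' (i + 1) (contraction i x) j \<oplus>\<^bsub>cmp E j\<^esub> contraction (i - 1) (roof_hty E \<gamma> \<gamma>' i x) j = x j"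
proof (cases "even (i - j)")
  case True
  note c = fs_closed[OF supported_fs[OF x]]
  have "total_map E (roof_bot E \<gamma> (i + 1) (contraction i x)) j = \<zero>\<^bsub>cmp E j\<^esub>"
    by (rule total_zero_nbr) (simp add: roof_bot_def contraction_def)
  then have 1: "roof_hty E \<gamma> \<gamma>' (i + 1) (contraction i x) j = \<zero>\<^bsub>cmp E j\<^esub>"
    using j True by (simp add: roof_hty_bot)
  have 2: "contraction (i - 1) (roof_hty E \<gamma> \<gamma>' i x) j = x j"
  proof (cases "\<gamma> j = i")
    case True
    then show ?thesis using Qx by (simp add: contraction_def)
  next
    case False
    then show ?thesis using j True M_simps(8)[OF c] by (simp add: contraction_def roof_hty_bot)
  qed
  show ?thesis unfolding 1 2 by (rule M_simps(5)[OF c])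
next
  case False
  note c = fs_closed[OF supported_fs[OF x]]
  have g: "\<gamma> j < i + 1" "i + 1 \<le> \<gamma>' j"
    using \<gamma>_even[of j] \<gamma>'_even[of j] False j unfolding mem_Collect_eq by presburger+
  have "roof_hty E \<gamma> \<gamma>' (i + 1) (contraction i x) j = x j"
    using j False g M_simps(8)[OF c] by (simp add: contraction_def roof_hty_bot)
  moreover have "contraction (i - 1) (roof_hty E \<gamma> \<gamma>' i x) j = \<zero>\<^bsub>cmp E j\<^esub>"
    using False by (simp add: contraction_def)
  ultimately show ?thesis using M_simps(6)[OF c] by simp
qed

text \<open>The kernel consists of all copies except the bottom ones. There \<epsilon> is
  contractible, and each degree is a direct summand of the roof over B, so
  \<open>perf_contractible\<close> applies.\<close>

lemma bot_cone_perf: "dg_cone (roof f E \<gamma> \<gamma>') (lattice_module E \<gamma>) (to_bot E \<gamma> \<gamma>') \<in> perf B f"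
proof (rule perf_cone_of_surjection[OF roof_kdg_mod lattice_kdg_mod[OF \<gamma>] bot_cocycle bot_surj])
  let ?S = "kernel_set (roof f E \<gamma> \<gamma>') (lattice_module E \<gamma>) (to_bot E \<gamma> \<gamma>')"
  let ?R = "roof f E \<gamma> \<gamma>'"
  let ?N = "sub_kdg ?R ?S"
  have N: "?N \<in> kdg_mod B f" by (rule kernel_kdg_mod[OF roof_kdg_mod lattice_kdg_mod[OF \<gamma>] bot_cocycle])
  have RJ: "cmp ?R i = direct_sum (J i) (cmp E)" for i by (simp add: roof_def)
  have S: "?S i \<subseteq> carrier (cmp ?R i)" for i by (auto simp: kernel_set_def)
  have S0: "\<zero>\<^bsub>cmp ?R i\<^esub> \<in> ?S i" for i using module_simps(2)[OF kdg_modD(1)[OF N]] by simp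
  obtain m m' where mm: "\<forall>i. i < m \<or> m' < i \<longrightarrow> carrier (cmp ?R i) = {\<zero>\<^bsub>cmp ?R i\<^esub>}"
    using roof_coh_s unfolding coh_s_def by blast
  have into: "\<psi> \<in> module_hom B M (cmp ?N i)"
    if "\<psi> \<in> module_hom B M (cmp ?R i)" "\<And>x. x \<in> carrier M \<Longrightarrow> \<psi> x \<in> ?S i" for \<psi> i and M :: "('b, ('b, 'x) univ) module"
    using that unfolding module_hom_def by auto
  have outof: "\<psi> \<in> module_hom B (cmp ?N i) M"
    if "\<psi> \<in> module_hom B (cmp ?R i) M" for \<psi> i and M :: "('b, ('b, 'x) univ) module"
    by (intro module_homI) (simp_all add: module_homD[OF that] subsetD[OF S])
  have SE: "\<exists>x. x \<in> supported E (J i) \<and> z = family (J i) x \<and> (\<forall>j. \<gamma> j = i \<longrightarrow> x j = \<zero>\<^bsub>cmp E j\<^esub>)" if "z \<in> ?S i" for z i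
  proof -
    obtain x where x: "x \<in> supported E (J i)" "z = family (J i) x" "\<forall>j. \<gamma> j = i \<longrightarrow> roof_bot E \<gamma> i x j = \<zero>\<^bsub>cmp E j\<^esub>"
      using \<open>z \<in> ?S i\<close> by (rule roof_kernelE)
    then show ?thesis by (intro exI[of _ x]) (simp add: roof_bot_def)
  qed
  have SI: "family (J i) x \<in> ?S i" if "x \<in> supported E (J i)" "\<And>j. \<gamma> j = i \<Longrightarrow> x j = \<zero>\<^bsub>cmp E j\<^esub>" for x i
    by (rule roof_kernelI[OF that(1)]) (simp add: roof_bot_def that(2))
  let ?\<sigma> = "site_map E J (\<lambda>i. J (i + 1)) contraction"
  show "?N \<in> perf B f"
  proof (rule perf_contractible[OF cring_B f_closed N])
    fix i
    show "fg_projective B (cmp ?N i)"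
    proof (rule fg_projective_retract[OF cring_B _ kdg_modD(1)[OF N]])
      show "fg_projective B (cmp ?R i)" using roof_coh_s by (simp add: coh_s_def)
      show "(\<lambda>x. x) \<in> module_hom B (cmp ?N i) (cmp ?R i)" by (rule outof[OF module_hom_id])
      \<comment> \<open>Erasing the bottom copies is a B-linear retraction onto the kernel in each
        degree. Compatibility with d plays no part in projectivity, which is a condition on single
        components.\<close>
      let ?T = "\<lambda>i x j. if \<gamma> j = i then \<zero>\<^bsub>cmp E j\<^esub> else x j"
      have T: "lin_op B E (?T i)" by (intro lin_op_intros)
      have Tsup: "?T i x \<in> supported E (J i)" if "x \<in> supported E (J i)" for x
        by (rule lin_op_supported[OF T supported_fs[OF that]]) (simp add: supported_zero[OF that])
      show "site_map E J J ?T i \<in> module_hom B (cmp ?R i) (cmp ?N i)"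
      proof (rule into)
        show "site_map E J J ?T i \<in> module_hom B (cmp ?R i) (cmp ?R i)"
          unfolding RJ by (rule site_map_hom[where J = J and i = i and J' = J and T = ?T, OF T])
        fix z assume "z \<in> carrier (cmp ?R i)"
        then obtain x where x: "x \<in> supported E (J i)" "z = family (J i) x" unfolding RJ by (rule familyE)
        show "site_map E J J ?T i z \<in> ?S i"
          unfolding x(2) site_map_family[where J = J and i = i, OF x(1)] by (rule SI[OF Tsup[OF x(1)]]) simp
      qed
      fix z assume "z \<in> carrier (cmp ?N i)"
      then have "z \<in> ?S i" by simp
      then obtain x where x: "x \<in> supported E (J i)" "z = family (J i) x" "\<forall>j. \<gamma> j = i \<longrightarrow> x j = \<zero>\<^bsub>cmp E j\<^esub>"
        using SE by blast
      show "site_map E J J ?T i z = z"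
        unfolding x(2) site_map_family[where J = J and i = i, OF x(1)] by (rule family_cong) (simp add: x(3))
    qed
    show "carrier (cmp ?N i) = {\<zero>\<^bsub>cmp ?N i\<^esub>}" if "i < m \<or> m' < i"
      using mm[rule_format, OF that] S[of i] S0[of i] by auto
    show "?\<sigma> i \<in> module_hom B (cmp ?N i) (cmp ?N (i + 1))"
    proof (rule outof[OF into])
      show "?\<sigma> i \<in> module_hom B (cmp ?R i) (cmp ?R (i + 1))"
        unfolding RJ by (rule site_map_hom[where J = J and i = i and J' = "\<lambda>i. J (i + 1)", OF contraction_op])
      fix z assume "z \<in> carrier (cmp ?R i)"
      then obtain x where x: "x \<in> supported E (J i)" "z = family (J i) x" unfolding RJ by (rule familyE)
      show "?\<sigma> i z \<in> ?S (i + 1)"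
        unfolding x(2) site_map_family[where J = J and i = i, OF x(1)]
        by (rule SI[OF contraction_supported[OF supported_fs[OF x(1)]]]) (simp add: contraction_def)
    qed
    fix z assume "z \<in> carrier (cmp ?N i)"
    then have "z \<in> ?S i" by simp
    then obtain x where x: "x \<in> supported E (J i)" "z = family (J i) x" "\<forall>j. \<gamma> j = i \<longrightarrow> x j = \<zero>\<^bsub>cmp E j\<^esub>"
      using SE by blast
    note xf = supported_fs[OF x(1)]
    have ix: "i + 1 - 1 = i" "i - 1 + 1 = i" by simp_all
    show "hty ?N (i + 1) (?\<sigma> i z) \<oplus>\<^bsub>cmp ?N i\<^esub> ?\<sigma> (i - 1) (hty ?N i z) = z"
      using contraction_eq[OF x(1)] x(3)
      unfolding x(2) sub_kdg_simps roof_def site_kdg_simps site_map_family[where J = J and i = i, OF x(1)]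
        site_map_family[where J = J and i = "i + 1", OF contraction_supported[OF xf]]
        site_map_family[where J = J and i = "i - 1", OF roof_supported(2)[OF xf]] ix
      by (simp add: family_add) (intro family_cong, simp)
  qed
qed

end

end

section \<open>The natural zigzag\<close>

text \<open>The class \<open>perf_equivs\<close> asks for a cone in \<open>perf_s\<close>, that is,
  perfect and also strictly perfect over B; this supplies the second half.\<close>

lemma dg_cone_coh_s:
  fixes E F :: "('b, ('b, 'x) univ) kdg"
  assumes B: "cring B" and E: "E \<in> coh_s B f" and F: "F \<in> coh_s B f" and \<phi>: "\<phi> \<in> cocycles B E F"
  shows "dg_cone E F \<phi> \<in> coh_s B f"
proof -
  obtain a b where ab: "\<forall>i. i < a \<or> b < i \<longrightarrow> carrier (cmp E i) = {\<zero>\<^bsub>cmp E i\<^esub>}"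
    using E unfolding coh_s_def by blast
  obtain c d where cd: "\<forall>i. i < c \<or> d < i \<longrightarrow> carrier (cmp F i) = {\<zero>\<^bsub>cmp F i\<^esub>}"
    using F unfolding coh_s_def by blast
  have fg: "fg_projective B (cmp (dg_cone E F \<phi>) i)" for i
    using E F unfolding dg_cone_simps by (intro fg_projective_direct_sum[OF B]) (auto simp: coh_s_def)
  have "carrier (cmp (dg_cone E F \<phi>) i) = {\<zero>\<^bsub>cmp (dg_cone E F \<phi>) i\<^esub>}"
    if "i < min (a - 1) c \<or> max b d < i" for i
    unfolding dg_cone_simps by (rule direct_sum_trivial) (use ab cd that in auto)
  then have "\<exists>m m'. \<forall>i. i < m \<or> m' < i \<longrightarrow>
      carrier (cmp (dg_cone E F \<phi>) i) = {\<zero>\<^bsub>cmp (dg_cone E F \<phi>) i\<^esub>}" by blast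
  then show ?thesis
    using dg_cone_kdg_mod[OF coh_s_kdg_mod[OF E] coh_s_kdg_mod[OF F] \<phi>] fg unfolding coh_s_def by blast
qed

definition inverts ::
  "('b, 'c) ring_scheme \<Rightarrow> 'b \<Rightarrow> ('b, ('b, 'x) univ) kdg \<Rightarrow> ('b, ('b, 'x) univ) kdg
    \<Rightarrow> (int \<Rightarrow> ('b, 'x) univ \<Rightarrow> ('b, 'x) univ) \<Rightarrow> bool" where
  "inverts B f X Y s \<longleftrightarrow> X \<in> coh_s B f \<and> Y \<in> coh_s B f \<and> s \<in> cocycles B X Y \<and> dg_cone X Y s \<in> perf B f"

lemma inverts_perf_equivs:
  "cring B \<Longrightarrow> inverts B f X Y s \<Longrightarrow> hclass B X Y s \<in> perf_equivs B f X Y"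
  unfolding inverts_def perf_equivs_def perf_s_def by (auto intro!: imageI dg_cone_coh_s)

text \<open>An isomorphism of dg modules is a surjection with zero kernel, so the same criterion
  covers it as the projections of a roof.\<close>

lemma bijective_inverts:
  fixes X Y :: "('b, ('b, 'x) univ) kdg"
  assumes B: "cring B" "f \<in> carrier B" and X: "X \<in> coh_s B f" and Y: "Y \<in> coh_s B f" and s: "s \<in> cocycles B X Y"
    and inj: "\<And>i. inj_on (s i) (carrier (cmp X i))"
    and surj: "\<And>i y. y \<in> carrier (cmp Y i) \<Longrightarrow> \<exists>x\<in>carrier (cmp X i). s i x = y"
  shows "inverts B f X Y s"
proof -
  note k = coh_s_kdg_mod[OF X] coh_s_kdg_mod[OF Y]
  note mX = kdg_modD(1)[OF k(1)] and mY = kdg_modD(1)[OF k(2)]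
  let ?N = "sub_kdg X (kernel_set X Y s)"
  have N: "?N \<in> kdg_mod B f" by (rule kernel_kdg_mod[OF k s])
  have ker: "x = \<zero>\<^bsub>cmp X i\<^esub>" if "x \<in> kernel_set X Y s i" for x i
  proof (rule inj_onD[OF inj])
    show "s i x = s i \<zero>\<^bsub>cmp X i\<^esub>"
      using that module_hom_simps(1)[OF cocyclesD(1)[OF k s] mX mY] by (simp add: kernel_set_def)
  qed (use that module_simps(2)[OF mX] in \<open>auto simp: kernel_set_def\<close>)
  have N_perf: "?N \<in> perf B f"
  proof (rule perf_acyclic[OF B N])
    fix i x assume "x \<in> carrier (cmp ?N i)"
    then have "x = \<zero>\<^bsub>cmp X i\<^esub>" using ker by simp
    moreover have "\<zero>\<^bsub>cmp X (i - 1)\<^esub> \<in> carrier (cmp ?N (i - 1))"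
      using module_simps(2)[OF kdg_modD(1)[OF N], of "i - 1"] by simp
    ultimately show "x \<in> dif ?N (i - 1) ` carrier (cmp ?N (i - 1))"
      using kdg_simps(1)[OF k(1), of "i - 1"] by (auto intro!: image_eqI[of _ _ "\<zero>\<^bsub>cmp X (i - 1)\<^esub>"])
  qed
  have "dg_cone X Y s \<in> perf B f"
    by (rule perf_cone_of_surjection[OF k s surj N_perf])
  then show ?thesis using X Y s by (simp add: inverts_def)
qed

abbreviation coh_cat :: "('b, 'c) ring_scheme \<Rightarrow> 'b \<Rightarrow> _" where
  "coh_cat B f \<equiv> H0_cat B (coh_s B f :: ('b, ('b, 'x) univ) kdg set)"

section \<open>Naturality squares in the localization\<close>

definition fwd where "fwd B X Y s = Fwd X Y (hclass B X Y s)"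
definition bwd where "bwd B X Y s = Bwd X Y (hclass B X Y s)"

definition nat_square ::
  "('b, 'c) ring_scheme \<Rightarrow> 'b \<Rightarrow> ('b, ('b, 'x) univ) kdg \<Rightarrow> _" where
  "nat_square B f X1 X2 Y1 Y2 u v a b \<longleftrightarrow>
     zigzag (coh_cat B f) (perf_equivs B f) X1 u X2 \<and> zigzag (coh_cat B f) (perf_equivs B f) Y1 v Y2 \<and>
     zigzag_eq (coh_cat B f) (perf_equivs B f) X1 Y2 (u @ [fwd B X2 Y2 b]) ([fwd B X1 Y1 a] @ v)"

lemma nat_square_paste:
  assumes "nat_square B f X1 X2 Y1 Y2 u v a b" "nat_square B f X2 X3 Y2 Y3 u' v' b c"
  shows "nat_square B f X1 X3 Y1 Y3 (u @ u') (v @ v') a c"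
proof -
  note 1 = assms(1)[unfolded nat_square_def] and 2 = assms(2)[unfolded nat_square_def]
  show ?thesis
    unfolding nat_square_def fwd_def
    by (intro conjI zigzag_append[OF 1[THEN conjunct1] 2[THEN conjunct1]]
        zigzag_append[OF 1[THEN conjunct2, THEN conjunct1] 2[THEN conjunct2, THEN conjunct1]]
        zigzag_eq_paste[OF 1[THEN conjunct2, THEN conjunct2, unfolded fwd_def]
          2[THEN conjunct2, THEN conjunct2, unfolded fwd_def] 1[THEN conjunct1] 2[THEN conjunct2, THEN conjunct1]])
qed

text \<open>Both horizontal maps are inverted, so one square commuting on elements serves a step of
  a zigzag in either direction.\<close>

lemma nat_squareI:
  assumes B: "cring B" and s: "inverts B f X1 X2 s" and t: "inverts B f Y1 Y2 t"
    and a: "a \<in> cocycles B X1 Y1" and b: "b \<in> cocycles B X2 Y2"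
    and comm: "\<And>i x. x \<in> carrier (cmp X1 i) \<Longrightarrow> b i (s i x) = t i (a i x)"
  shows "nat_square B f X1 X2 Y1 Y2 [fwd B X1 X2 s] [fwd B Y1 Y2 t] a b"
    and "nat_square B f X2 X1 Y2 Y1 [bwd B X1 X2 s] [bwd B Y1 Y2 t] b a"
proof -
  have obj: "X1 \<in> coh_s B f" "X2 \<in> coh_s B f" "Y1 \<in> coh_s B f" "Y2 \<in> coh_s B f"
    and st: "s \<in> cocycles B X1 X2" "t \<in> cocycles B Y1 Y2" using s t by (auto simp: inverts_def)
  note k = obj[THEN coh_s_kdg_mod]
  let ?C = "coh_cat B f"
  have z: "zigzag ?C (perf_equivs B f) X1 [fwd B X1 X2 s, fwd B X2 Y2 b] Y2"
    "zigzag ?C (perf_equivs B f) X1 [fwd B X1 Y1 a, fwd B Y1 Y2 t] Y2"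
    "zigzag ?C (perf_equivs B f) X1 [fwd B X1 X2 s] X2" "zigzag ?C (perf_equivs B f) Y1 [fwd B Y1 Y2 t] Y2"
    using obj st a b by (auto simp: H0_simps fwd_def)
  have inv: "hclass B X1 X2 s \<in> perf_equivs B f X1 X2" "hclass B Y1 Y2 t \<in> perf_equivs B f Y1 Y2"
    using inverts_perf_equivs[OF B] s t by auto
  then have zb: "zigzag ?C (perf_equivs B f) X2 [bwd B X1 X2 s] X1" "zigzag ?C (perf_equivs B f) Y2 [bwd B Y1 Y2 t] Y1"
    using obj st by (auto simp: H0_simps bwd_def)
  have "hclass B X1 Y2 (\<lambda>i x. b i (s i x)) = hclass B X1 Y2 (\<lambda>i x. t i (a i x))"
    by (rule hclass_cong[OF k(1,4) cocycles_comp[OF k(1,2,4) st(1) b] cocycles_comp[OF k(1,3,4) a st(2)] comm])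
  then have c: "Comp ?C X1 X2 Y2 (hclass B X2 Y2 b) (hclass B X1 X2 s) = Comp ?C X1 Y1 Y2 (hclass B Y1 Y2 t) (hclass B X1 Y1 a)"
    using H0_Comp[OF k(1,2,4) st(1) b] H0_Comp[OF k(1,3,4) a st(2)] by simp
  show "nat_square B f X1 X2 Y1 Y2 [fwd B X1 X2 s] [fwd B Y1 Y2 t] a b"
    unfolding nat_square_def using z(3,4) zigzag_eq_square_Fwd[OF z(1,2)[unfolded fwd_def] c]
    unfolding fwd_def by blast
  show "nat_square B f X2 X1 Y2 Y1 [bwd B X1 X2 s] [bwd B Y1 Y2 t] b a"
    unfolding nat_square_def using zb zigzag_eq_square_Bwd[OF z(1,2)[unfolded fwd_def] c inv]
    unfolding fwd_def bwd_def by blast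
qed

definition push :: "(int \<Rightarrow> 'm \<Rightarrow> 'm) \<Rightarrow> (int \<Rightarrow> 'm) \<Rightarrow> int \<Rightarrow> 'm" where
  "push \<phi> x j = \<phi> j (x j)"

text \<open>The same \<phi>_j is applied in every copy of E_j, whatever degree the copy
  occupies.\<close>

definition push_map ::
  "(int \<Rightarrow> ('b, 'x) univ \<Rightarrow> ('b, 'x) univ) \<Rightarrow> (int \<Rightarrow> int set) \<Rightarrow> int \<Rightarrow> ('b, 'x) univ \<Rightarrow> ('b, 'x) univ" where
  "push_map \<phi> K i z = family (K i) (push \<phi> (component z))"

lemma push_map_family: "push_map \<phi> K i (family (K i) x) = family (K i) (push \<phi> x)"
  by (auto simp: push_map_def family_def push_def intro!: restrict_ext)

section \<open>The folding shape and its maximum with the identity\<close>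

definition par :: "int \<Rightarrow> int" where "par j = (if even j then 0 else - 1)"
definition upper :: "int \<Rightarrow> int" where "upper j = max j (par j)"

lemma shape_id: "shape (\<lambda>j. j)" by (simp add: shape_def)

lemma shape_par: "shape par" by (simp add: shape_def par_def)

lemma upper_eq: "upper j = (if j \<ge> - 1 then j else par j)"
  by (auto simp: upper_def par_def)

text \<open>Shapes agree modulo 2, so they can cross only where they are equal. The identity and
  \<open>par\<close> are equal exactly at -1 and 0, which is where the formula
  \<open>upper_eq\<close> switches between them.\<close>

lemma shape_upper: "shape upper"
  unfolding shape_def
proof (intro allI conjI)
  fix j :: int
  show "even (upper j - j)" by (auto simp: upper_eq par_def)
  consider "j \<ge> - 1" | "j = - 2" | "j < - 2" by linarith
  then show "upper (j + 1) = upper j + 1 \<or> upper (j + 1) = upper j - 1"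
    by cases (auto simp: upper_eq par_def)
qed

lemma folded_indices_eq: "folded_indices i = {j. par j = i}"
  by (auto simp: folded_indices_def par_def)

context bounded_kdg
begin

definition single :: "int \<Rightarrow> ('b, 'x) univ \<Rightarrow> int \<Rightarrow> ('b, 'x) univ" where
  "single i x j = (if j = i then x else \<zero>\<^bsub>cmp E j\<^esub>)"

lemma single_supported: "x \<in> carrier (cmp E i) \<Longrightarrow> single i x \<in> supported E {j. j = i}"
  by (auto simp: single_def supported_def fun_space_def M_simps)

definition to_id :: "int \<Rightarrow> ('b, 'x) univ \<Rightarrow> ('b, 'x) univ" where
  "to_id i x = family {j. j = i} (single i x)"

text \<open>For the identity shape each degree is a direct sum over a single index, so the lattice
  module is \<open>E\<close> only up to this wrapping. On one component D splits into d above it and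
  h below it.\<close>

lemma to_id_inverts: "inverts B f E (lattice_module E (\<lambda>j. j)) to_id"
proof (rule bijective_inverts[OF cring_B f_closed coh lattice_coh_s[OF shape_id]])
  let ?L = "lattice_module E (\<lambda>j. j)"
  show "to_id \<in> cocycles B E ?L"
  proof (rule cocyclesI[OF lattice_kdg_mod[OF shape_id]])
    fix i
    show "to_id i \<in> module_hom B (cmp E i) (cmp ?L i)"
    proof (rule module_homI)
      fix x assume x: "x \<in> carrier (cmp E i)"
      show "to_id i x \<in> carrier (cmp ?L i)"
        using family_closed[OF supported_fs[OF single_supported[OF x]]] by (simp add: lattice_module_def to_id_def)
      show "to_id i (r \<odot>\<^bsub>cmp E i\<^esub> x) = r \<odot>\<^bsub>cmp ?L i\<^esub> to_id i x" if "r \<in> carrier B" for r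
        by (simp add: lattice_module_def to_id_def family_smult) (intro family_cong, simp add: single_def)
      show "to_id i (x \<oplus>\<^bsub>cmp E i\<^esub> y) = to_id i x \<oplus>\<^bsub>cmp ?L i\<^esub> to_id i y" for y
        by (simp add: lattice_module_def to_id_def family_add) (intro family_cong, simp add: single_def)
    qed
    fix x assume x: "x \<in> carrier (cmp E i)"
    have d: "total_map E (single i x) (i + 1) = dif E i x"
      using kdg_simps(2)[OF E, of "i + 2"] M_simps(6)[OF kdg_closed(1)[OF E x]]
      by (simp add: total_map_def single_def add.commute)
    have h: "total_map E (single i x) (i - 1) = hty E i x"
      using kdg_simps(1)[OF E, of "i - 2"] M_simps(5)[OF kdg_closed(2)[OF E x]]
      by (simp add: total_map_def single_def)
    show "to_id (i - 1) (hty E i x) = hty ?L i (to_id i x)"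
      unfolding lattice_module_def site_kdg_simps to_id_def
        site_map_family[where J = "\<lambda>i. {j. j = i}" and i = i, OF single_supported[OF x]]
      by (rule family_cong) (auto simp: single_def[of "i - 1"] h)
    show "to_id (i + 1) (dif E i x) = dif ?L i (to_id i x)"
      unfolding lattice_module_def site_kdg_simps to_id_def
        site_map_family[where J = "\<lambda>i. {j. j = i}" and i = i, OF single_supported[OF x]]
      by (rule family_cong) (auto simp: single_def[of "i + 1"] d)
  qed
  have comp: "component (to_id i x) i = x" for i x by (simp add: to_id_def family_def single_def)
  show "inj_on (to_id i) (carrier (cmp E i))" for i by (rule inj_onI) (metis comp)
  fix i y assume "y \<in> carrier (cmp ?L i)"
  then have y: "y \<in> carrier (direct_sum {j. j = i} (cmp E))" by (simp add: lattice_module_def)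
  then have c: "component y i \<in> carrier (cmp E i)" by (rule direct_sum_closed) simp
  moreover have "to_id i (component y i) = y"
    by (rule direct_sum_eqI[OF _ y])
      (use family_closed[OF supported_fs[OF single_supported[OF c]]] comp in \<open>auto simp: to_id_def\<close>)
  ultimately show "\<exists>x\<in>carrier (cmp E i). to_id i x = y" by blast
qed

lemma folded_cmp: "cmp (folded E) i = cmp (lattice_module E par) i"
  by (simp add: folded_def lattice_module_def folded_indices_eq)

text \<open>The structure maps of the two modules agree on carriers only, so the comparison in
  \<open>to_folded_inverts\<close> is the identity map as an isomorphism and not an equation between
  dg modules.\<close>

lemma folded_ops:
  assumes "z \<in> carrier (cmp (folded E) i)"
  shows "dif (folded E) i z = dif (lattice_module E par) i z" "hty (folded E) i z = hty (lattice_module E par) i z"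
proof -
  have "z \<in> carrier (direct_sum {j. par j = i} (cmp E))" using assms by (simp add: folded_def folded_indices_eq)
  then obtain x where x: "x \<in> supported E {j. par j = i}" and z: "z = family {j. par j = i} x" by (rule familyE)
  note m = site_map_family[where J = "\<lambda>i. {j. par j = i}" and i = i, OF x]
  have zero: "\<zero>\<^bsub>direct_sum (folded_indices k) (cmp E)\<^esub> = family {j. par j = k} (\<lambda>j. \<zero>\<^bsub>cmp E j\<^esub>)" for k
    by (simp add: family_zero folded_indices_eq)
  \<comment> \<open>The number \<open>- 1 - i\<close> is the other one of the two degrees -1 and 0;
    every neighbour of one of its indices lies in degree \<open>i\<close>.\<close>
  have dph: "dif_plus_hty E {j. par j = k} z = family {j. par j = k} (total_map E x)" if "k = - 1 - i" "i = - 1 \<or> i = 0" for k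
    unfolding dif_plus_hty_def family_def z total_map_def
    using that by (auto simp: par_def fun_eq_iff split: if_splits)
  show "dif (folded E) i z = dif (lattice_module E par) i z"
  proof (cases "i = - 1")
    case True
    have "{j :: int. even j} = {j. par j = i + 1}" using True by (auto simp: par_def)
    then show ?thesis unfolding folded_def kdg.select_convs lattice_module_def site_kdg_simps
      using True dph[of 0] m by (simp add: z) (intro family_cong, simp)
  next
    case False
    have "total_map E x j = \<zero>\<^bsub>cmp E j\<^esub>" if "par j = i + 1" for j
      using False that by (intro total_zero_nbr supported_zero[OF x]) (auto simp: par_def split: if_splits)
    then show ?thesis unfolding folded_def kdg.select_convs lattice_module_def site_kdg_simps
      using False m by (simp add: z zero) (intro family_cong, simp)
  qed
  show "hty (folded E) i z = hty (lattice_module E par) i z"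
  proof (cases "i = 0")
    case True
    have "{j :: int. odd j} = {j. par j = i - 1}" using True by (auto simp: par_def)
    then show ?thesis unfolding folded_def kdg.select_convs lattice_module_def site_kdg_simps
      using True dph[of "- 1"] m by (simp add: z) (intro family_cong, simp)
  next
    case False
    have "total_map E x j = \<zero>\<^bsub>cmp E j\<^esub>" if "par j = i - 1" for j
      using False that by (intro total_zero_nbr supported_zero[OF x]) (auto simp: par_def split: if_splits)
    then show ?thesis unfolding folded_def kdg.select_convs lattice_module_def site_kdg_simps
      using False m by (simp add: z zero) (intro family_cong, simp)
  qed
qed


lemma folded_kdg_mod: "folded E \<in> kdg_mod B f"
proof (rule kdg_modI)
  fix i
  let ?L = "lattice_module E par"
  note L = lattice_kdg_mod[OF shape_par]
  have dif_hom: "\<psi> \<in> module_hom B M N" if "\<psi>' \<in> module_hom B M N" "\<And>x. x \<in> carrier M \<Longrightarrow> \<psi> x = \<psi>' x" "Module.module B M"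
    for \<psi> \<psi>' and M N :: "('b, ('b, 'x) univ) module"
    using that(1,2) module_simps(3,11)[OF that(3)] by (intro module_homI) (simp_all add: module_homD)
  show "Module.module B (cmp (folded E) i)" unfolding folded_cmp by (rule kdg_modD(1)[OF L])
  show "dif (folded E) i \<in> module_hom B (cmp (folded E) i) (cmp (folded E) (i + 1))"
    unfolding folded_cmp by (rule dif_hom[OF kdg_modD(2)[OF L] folded_ops(1) kdg_modD(1)[OF L]]) (simp add: folded_cmp)
  show "hty (folded E) i \<in> module_hom B (cmp (folded E) i) (cmp (folded E) (i - 1))"
    unfolding folded_cmp by (rule dif_hom[OF kdg_modD(3)[OF L] folded_ops(2) kdg_modD(1)[OF L]]) (simp add: folded_cmp)
  fix x assume x: "x \<in> carrier (cmp (folded E) i)"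
  then have x': "x \<in> carrier (cmp ?L i)" by (simp add: folded_cmp)
  have c: "dif ?L i x \<in> carrier (cmp (folded E) (i + 1))" "hty ?L i x \<in> carrier (cmp (folded E) (i - 1))"
    using kdg_closed(1,2)[OF L x'] by (simp_all add: folded_cmp)
  show "dif (folded E) (i + 1) (dif (folded E) i x) = \<zero>\<^bsub>cmp (folded E) (i + 2)\<^esub>"
    unfolding folded_ops(1)[OF x] folded_ops(1)[OF c(1)] folded_cmp by (rule kdg_modD(4)[OF L x'])
  show "hty (folded E) (i - 1) (hty (folded E) i x) = \<zero>\<^bsub>cmp (folded E) (i - 2)\<^esub>"
    unfolding folded_ops(2)[OF x] folded_ops(2)[OF c(2)] folded_cmp by (rule kdg_modD(5)[OF L x'])
  show "dif (folded E) (i - 1) (hty (folded E) i x) \<oplus>\<^bsub>cmp (folded E) i\<^esub> hty (folded E) (i + 1) (dif (folded E) i x)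
      = f \<odot>\<^bsub>cmp (folded E) i\<^esub> x"
    unfolding folded_ops[OF x] folded_ops(2)[OF c(1)] folded_ops(1)[OF c(2)] folded_cmp by (rule kdg_modD(6)[OF L x'])
qed

lemma folded_coh_s: "folded E \<in> coh_s B f"
  using folded_kdg_mod lattice_coh_s[OF shape_par] by (simp add: coh_s_def folded_cmp)

lemma to_folded_inverts: "inverts B f (lattice_module E par) (folded E) (\<lambda>i x. x)"
proof (rule bijective_inverts[OF cring_B f_closed lattice_coh_s[OF shape_par] folded_coh_s])
  show "(\<lambda>i x. x) \<in> cocycles B (lattice_module E par) (folded E)"
    by (rule cocyclesI[OF folded_kdg_mod]) (simp_all add: folded_cmp folded_ops module_hom_id)
qed (auto simp: folded_cmp)

lemma to_bot_inverts:
  assumes "shape \<gamma>" "shape \<gamma>'" "\<And>j. \<gamma> j \<le> \<gamma>' j"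
  shows "inverts B f (roof f E \<gamma> \<gamma>') (lattice_module E \<gamma>) (to_bot E \<gamma> \<gamma>')"
  unfolding inverts_def using roof_coh_s[OF assms] lattice_coh_s[OF assms(1)] bot_cocycle[OF assms] bot_cone_perf[OF assms]
  by blast

lemma to_top_inverts:
  assumes "shape \<gamma>" "shape \<gamma>'" "\<And>j. \<gamma> j \<le> \<gamma>' j"
  shows "inverts B f (roof f E \<gamma> \<gamma>') (lattice_module E \<gamma>') (to_top E \<gamma> \<gamma>')"
  unfolding inverts_def using roof_coh_s[OF assms] lattice_coh_s[OF assms(2)] top_cocycle[OF assms] top_cone_perf[OF assms]
  by blast

lemma le_upper: "j \<le> upper j" "par j \<le> upper j"
  by (simp_all add: upper_def)

text \<open>The outer arrows are the isomorphisms with lattice modules. Between them the first roof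
  raises the identity shape to \<open>upper\<close>, and the second, read from its top to its
  bottom, lowers \<open>upper\<close> to \<open>par\<close>.\<close>

definition fold_zigzag where
  "fold_zigzag =
     [fwd B E (lattice_module E (\<lambda>j. j)) to_id] @
     [bwd B (roof f E (\<lambda>j. j) upper) (lattice_module E (\<lambda>j. j)) (to_bot E (\<lambda>j. j) upper)] @
     [fwd B (roof f E (\<lambda>j. j) upper) (lattice_module E upper) (to_top E (\<lambda>j. j) upper)] @
     [bwd B (roof f E par upper) (lattice_module E upper) (to_top E par upper)] @
     [fwd B (roof f E par upper) (lattice_module E par) (to_bot E par upper)] @
     [fwd B (lattice_module E par) (folded E) (\<lambda>i x. x)]"

end

lemma inverts_zigzag:
  assumes "cring B" "inverts B f X Y s"
  shows "zigzag (coh_cat B f) (perf_equivs B f) X [fwd B X Y s] Y"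
    and "zigzag (coh_cat B f) (perf_equivs B f) Y [bwd B X Y s] X"
    and "inverted (perf_equivs B f) (fwd B X Y s)" "inverted (perf_equivs B f) (bwd B X Y s)"
  using assms(2) inverts_perf_equivs[OF assms] by (auto simp: inverts_def fwd_def bwd_def H0_simps)

section \<open>Naturality with respect to closed morphisms\<close>

locale kdg_morphism = E: bounded_kdg B f E + F: bounded_kdg B f F
  for B :: "('b, 'c) ring_scheme" and f and E F :: "('b, ('b, 'x) univ) kdg" +
  fixes \<phi> assumes \<phi>: "\<phi> \<in> cocycles B E F"
begin

lemmas \<phi>D = cocyclesD[OF E.E F.E \<phi>]
lemmas \<phi>c = cocycles_closed[OF E.E F.E \<phi>]
lemmas \<phi>_simps = module_hom_simps[OF \<phi>D(1) E.mE F.mE] module_homD(2,3)[OF \<phi>D(1)]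

lemma push_fs: "x \<in> fun_space E \<Longrightarrow> push \<phi> x \<in> fun_space F"
  by (auto simp: fun_space_def push_def \<phi>c)

lemma push_supported: "x \<in> supported E K \<Longrightarrow> push \<phi> x \<in> supported F K"
  using push_fs by (auto simp: supported_def push_def \<phi>_simps(1))

text \<open>A closed morphism commutes with d and with h separately, hence with their sum even
  though that sum is not homogeneous.\<close>

lemma push_total:
  assumes x: "x \<in> fun_space E"
  shows "total_map F (push \<phi> x) j = \<phi> j (total_map E x j)"
  using \<phi>D(3)[OF E.fs_closed[OF x], of j "j - 1"] \<phi>D(2)[OF E.fs_closed[OF x], of j "j + 1"]
    \<phi>_simps(4)[OF E.nbr_closed[OF x]] by (simp add: total_map_def push_def)

text \<open>The formulas of the construction use only D, multiplication by f, signs and degree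
  tests, each compatible with \<phi>. Naturality therefore holds on elements before any
  localization.\<close>

definition nat_op :: "((int \<Rightarrow> ('b, 'x) univ) \<Rightarrow> int \<Rightarrow> ('b, 'x) univ) \<Rightarrow> ((int \<Rightarrow> ('b, 'x) univ) \<Rightarrow> int \<Rightarrow> ('b, 'x) univ) \<Rightarrow> bool" where
  "nat_op S T \<longleftrightarrow> (\<forall>x\<in>fun_space E. \<forall>j. T (push \<phi> x) j = \<phi> j (S x j))"

lemma nat_lattice: "nat_op (\<lambda>x j. if \<gamma> j = i then total_map E x j else \<zero>\<^bsub>cmp E j\<^esub>)
    (\<lambda>x j. if \<gamma> j = i then total_map F x j else \<zero>\<^bsub>cmp F j\<^esub>)"
  by (simp add: nat_op_def push_total \<phi>_simps(1))

lemma nat_bot: "nat_op (roof_bot E \<gamma> i) (roof_bot F \<gamma> i)"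
  by (simp add: nat_op_def roof_bot_def push_def \<phi>_simps(1))

lemma nat_top: "nat_op (roof_top E \<gamma> i) (roof_top F \<gamma> i)"
proof -
  have "push \<phi> x j \<ominus>\<^bsub>cmp F j\<^esub> total_map F (push \<phi> x) j = \<phi> j (x j \<ominus>\<^bsub>cmp E j\<^esub> total_map E x j)" if x: "x \<in> fun_space E" for x j
    using \<phi>_simps(3)[OF E.fs_closed[OF x] E.fs_closed[OF E.total_closed[OF x]]] push_total[OF x] by (simp add: push_def)
  then show ?thesis by (simp add: nat_op_def roof_top_def \<phi>_simps(1))
qed

lemma nat_roof_dif: "nat_op (roof_dif f E \<gamma> \<gamma>' i) (roof_dif f F \<gamma> \<gamma>' i)"
  unfolding nat_op_def
proof (intro ballI allI)
  fix x j assume x: "x \<in> fun_space E"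
  note c = E.fs_closed[OF x] E.fs_closed[OF E.total_closed[OF x]] E.fs_closed[OF E.smult_fs[OF x]]
  show "roof_dif f F \<gamma> \<gamma>' i (push \<phi> x) j = \<phi> j (roof_dif f E \<gamma> \<gamma>' i x j)"
    using \<phi>_simps(3)[OF c(2,3)] \<phi>_simps(3)[OF c(1,2)] \<phi>_simps(5)[OF E.f_closed c(1)] push_total[OF x] \<phi>_simps(1)
    by (simp add: roof_dif_def push_def)
qed

lemma nat_roof_hty: "nat_op (roof_hty E \<gamma> \<gamma>' i) (roof_hty F \<gamma> \<gamma>' i)"
  unfolding nat_op_def
proof (intro ballI allI)
  fix x j assume x: "x \<in> fun_space E"
  let ?Q = "\<lambda>k. if \<gamma> k = i then x k else \<zero>\<^bsub>cmp E k\<^esub>"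
  have Q: "?Q \<in> fun_space E" using x by (auto simp: fun_space_def E.M_simps)
  have "push \<phi> ?Q = (\<lambda>k. if \<gamma> k = i then push \<phi> x k else \<zero>\<^bsub>cmp F k\<^esub>)"
    by (rule ext) (simp add: push_def \<phi>_simps(1))
  then have "total_map F (\<lambda>k. if \<gamma> k = i then push \<phi> x k else \<zero>\<^bsub>cmp F k\<^esub>) j = \<phi> j (total_map E ?Q j)"
    using push_total[OF Q, of j] by simp
  then show "roof_hty F \<gamma> \<gamma>' i (push \<phi> x) j = \<phi> j (roof_hty E \<gamma> \<gamma>' i x j)"
    using \<phi>_simps(1) \<phi>_simps(2)[OF E.fs_closed[OF x]] by (simp add: roof_hty_def push_def[of \<phi> x])
qed

lemma site_map_natural:
  assumes "nat_op (S i) (T i)" and z: "z \<in> carrier (direct_sum (K i) (cmp E))"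
  shows "site_map F K K' T i (push_map \<phi> K i z) = push_map \<phi> K' i (site_map E K K' S i z)"
proof -
  obtain x where x: "x \<in> supported E (K i)" "z = family (K i) x" using z by (rule E.familyE)
  show ?thesis
    unfolding x(2) push_map_family E.site_map_family[where J = K and i = i, OF x(1)]
      F.site_map_family[where J = K and i = i, OF push_supported[OF x(1)]]
    using assms(1) E.supported_fs[OF x(1)] by (intro F.family_cong) (simp add: nat_op_def push_def)
qed

lemma push_map_hom: "push_map \<phi> K i \<in> module_hom B (direct_sum (K i) (cmp E)) (direct_sum (K i) (cmp F))"
proof (rule module_homI)
  fix z assume "z \<in> carrier (direct_sum (K i) (cmp E))"
  then obtain x where x: "x \<in> supported E (K i)" "z = family (K i) x" by (rule E.familyE)
  note xc = E.fs_closed[OF E.supported_fs[OF x(1)]]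
  show "push_map \<phi> K i z \<in> carrier (direct_sum (K i) (cmp F))"
    unfolding x(2) push_map_family by (rule F.family_closed[OF push_fs[OF E.supported_fs[OF x(1)]]])
  show "push_map \<phi> K i (r \<odot>\<^bsub>direct_sum (K i) (cmp E)\<^esub> z) = r \<odot>\<^bsub>direct_sum (K i) (cmp F)\<^esub> push_map \<phi> K i z"
    if "r \<in> carrier B" for r
    unfolding x(2) E.family_smult push_map_family F.family_smult
    by (rule F.family_cong) (simp add: push_def \<phi>_simps(5)[OF that xc])
  fix w assume "w \<in> carrier (direct_sum (K i) (cmp E))"
  then obtain y where y: "y \<in> supported E (K i)" "w = family (K i) y" by (rule E.familyE)
  note yc = E.fs_closed[OF E.supported_fs[OF y(1)]]
  show "push_map \<phi> K i (z \<oplus>\<^bsub>direct_sum (K i) (cmp E)\<^esub> w)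
      = push_map \<phi> K i z \<oplus>\<^bsub>direct_sum (K i) (cmp F)\<^esub> push_map \<phi> K i w"
    unfolding x(2) y(2) E.family_add push_map_family F.family_add
    by (rule F.family_cong) (simp add: push_def \<phi>_simps(4)[OF xc yc])
qed

lemma push_map_cocycle:
  assumes "site_kdg F K \<Delta>' H' \<in> kdg_mod B f" "\<And>i. nat_op (\<Delta> i) (\<Delta>' i)" "\<And>i. nat_op (H i) (H' i)"
  shows "push_map \<phi> K \<in> cocycles B (site_kdg E K \<Delta> H) (site_kdg F K \<Delta>' H')"
proof (rule cocyclesI[OF assms(1)])
  fix i
  show "push_map \<phi> K i \<in> module_hom B (cmp (site_kdg E K \<Delta> H) i) (cmp (site_kdg F K \<Delta>' H') i)"
    unfolding site_kdg_simps by (rule push_map_hom)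
  fix z assume "z \<in> carrier (cmp (site_kdg E K \<Delta> H) i)"
  then have z: "z \<in> carrier (direct_sum (K i) (cmp E))" by simp
  show "push_map \<phi> K (i - 1) (hty (site_kdg E K \<Delta> H) i z) = hty (site_kdg F K \<Delta>' H') i (push_map \<phi> K i z)"
    using site_map_natural[where S = H and T = H' and K = K and i = i and K' = "\<lambda>i. K (i - 1)", OF assms(3) z]
    unfolding site_kdg_simps by (simp add: push_map_def)
  show "push_map \<phi> K (i + 1) (dif (site_kdg E K \<Delta> H) i z) = dif (site_kdg F K \<Delta>' H') i (push_map \<phi> K i z)"
    using site_map_natural[where S = \<Delta> and T = \<Delta>' and K = K and i = i and K' = "\<lambda>i. K (i + 1)", OF assms(2) z]
    unfolding site_kdg_simps by (simp add: push_map_def)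
qed

lemma lattice_push: "shape \<gamma> \<Longrightarrow> push_map \<phi> (\<lambda>i. {j. \<gamma> j = i}) \<in> cocycles B (lattice_module E \<gamma>) (lattice_module F \<gamma>)"
  unfolding lattice_module_def
  by (rule push_map_cocycle[OF F.lattice_kdg_mod[unfolded lattice_module_def] nat_lattice nat_lattice])

lemma roof_push:
  assumes "shape \<gamma>" "shape \<gamma>'" "\<And>j. \<gamma> j \<le> \<gamma>' j"
  shows "push_map \<phi> (\<lambda>i. {j. \<gamma> j \<le> i \<and> i \<le> \<gamma>' j}) \<in> cocycles B (roof f E \<gamma> \<gamma>') (roof f F \<gamma> \<gamma>')"
  unfolding roof_def
  by (rule push_map_cocycle[OF F.roof_kdg_mod[OF assms, unfolded roof_def] nat_roof_dif nat_roof_hty])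

lemma folded_map_eq: "folded_map \<phi> = push_map \<phi> (\<lambda>i. {j. par j = i})"
  by (intro ext) (simp add: folded_map_def push_map_def family_def push_def folded_indices_eq)

lemma folded_map_cocycle: "folded_map \<phi> \<in> cocycles B (folded E) (folded F)"
proof (rule cocyclesI[OF F.folded_kdg_mod])
  note p = lattice_push[OF shape_par]
  note L = E.lattice_kdg_mod[OF shape_par] F.lattice_kdg_mod[OF shape_par]
  note pD = cocyclesD[OF L p] and pc = cocycles_closed[OF L p]
  fix i
  show "folded_map \<phi> i \<in> module_hom B (cmp (folded E) i) (cmp (folded F) i)"
    unfolding folded_map_eq E.folded_cmp F.folded_cmp by (rule pD(1))
  fix x assume x: "x \<in> carrier (cmp (folded E) i)"
  then have x': "x \<in> carrier (cmp (lattice_module E par) i)" by (simp add: E.folded_cmp)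
  have px: "push_map \<phi> (\<lambda>i. {j. par j = i}) i x \<in> carrier (cmp (folded F) i)" using pc[OF x'] by (simp add: F.folded_cmp)
  show "folded_map \<phi> (i - 1) (hty (folded E) i x) = hty (folded F) i (folded_map \<phi> i x)"
    unfolding folded_map_eq E.folded_ops(2)[OF x] F.folded_ops(2)[OF px] by (rule pD(2)[OF x' HOL.refl])
  show "folded_map \<phi> (i + 1) (dif (folded E) i x) = dif (folded F) i (folded_map \<phi> i x)"
    unfolding folded_map_eq E.folded_ops(1)[OF x] F.folded_ops(1)[OF px] by (rule pD(3)[OF x' HOL.refl])
qed

text \<open>One square commuting on elements for each of the six arrows, pasted side by side;
  backward arrows use the reversed form of the square.\<close>

lemma fold_zigzag_natural:
  "nat_square B f E (folded E) F (folded F) E.fold_zigzag F.fold_zigzag \<phi> (folded_map \<phi>)"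
proof -
  note up = shape_upper E.le_upper
  note B = E.cring_B
  have id: "push_map \<phi> (\<lambda>i. {j. j = i}) i (E.to_id i x) = F.to_id i (\<phi> i x)" for i x
    unfolding E.to_id_def F.to_id_def push_map_family[where K = "\<lambda>i. {j. j = i}"]
    by (rule F.family_cong) (simp add: push_def E.single_def F.single_def)
  have bot: "push_map \<phi> (\<lambda>i. {j. \<gamma> j = i}) i (to_bot E \<gamma> \<gamma>' i x)
      = to_bot F \<gamma> \<gamma>' i (push_map \<phi> (\<lambda>i. {j. \<gamma> j \<le> i \<and> i \<le> \<gamma>' j}) i x)"
    if "x \<in> carrier (cmp (roof f E \<gamma> \<gamma>') i)" for \<gamma> \<gamma>' i x
    using that by (intro site_map_natural[symmetric] nat_bot) (simp add: roof_def)
  have top: "push_map \<phi> (\<lambda>i. {j. \<gamma>' j = i}) i (to_top E \<gamma> \<gamma>' i x)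
      = to_top F \<gamma> \<gamma>' i (push_map \<phi> (\<lambda>i. {j. \<gamma> j \<le> i \<and> i \<le> \<gamma>' j}) i x)"
    if "x \<in> carrier (cmp (roof f E \<gamma> \<gamma>') i)" for \<gamma> \<gamma>' i x
    using that by (intro site_map_natural[symmetric] nat_top) (simp add: roof_def)
  show ?thesis
    unfolding E.fold_zigzag_def F.fold_zigzag_def
    by (intro nat_square_paste)
      (rule nat_squareI(1)[OF B E.to_id_inverts F.to_id_inverts \<phi> lattice_push[OF shape_id] id]
        nat_squareI(2)[OF B E.to_bot_inverts[OF shape_id up(1,2)] F.to_bot_inverts[OF shape_id up(1,2)]
          roof_push[OF shape_id up(1,2)] lattice_push[OF shape_id] bot]
        nat_squareI(1)[OF B E.to_top_inverts[OF shape_id up(1,2)] F.to_top_inverts[OF shape_id up(1,2)]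
          roof_push[OF shape_id up(1,2)] lattice_push[OF shape_upper] top]
        nat_squareI(2)[OF B E.to_top_inverts[OF shape_par up(1,3)] F.to_top_inverts[OF shape_par up(1,3)]
          roof_push[OF shape_par up(1,3)] lattice_push[OF shape_upper] top]
        nat_squareI(1)[OF B E.to_bot_inverts[OF shape_par up(1,3)] F.to_bot_inverts[OF shape_par up(1,3)]
          roof_push[OF shape_par up(1,3)] lattice_push[OF shape_par] bot]
        nat_squareI(1)[OF B E.to_folded_inverts F.to_folded_inverts lattice_push[OF shape_par] folded_map_cocycle];
       simp add: folded_map_eq)+
qed

end

section \<open>The natural equivalence in the singularity category\<close>

context bounded_kdg
begin

lemma fold_zigzag:
  "zigzag (coh_cat B f) (perf_equivs B f) E fold_zigzag (folded E)"
  "\<forall>s\<in>set fold_zigzag. inverted (perf_equivs B f) s"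
proof -
  note up = shape_upper le_upper
  note z = inverts_zigzag[OF cring_B]
  note i = to_id_inverts to_bot_inverts[OF shape_id up(1,2)] to_top_inverts[OF shape_id up(1,2)]
    to_top_inverts[OF shape_par up(1,3)] to_bot_inverts[OF shape_par up(1,3)] to_folded_inverts
  show "zigzag (coh_cat B f) (perf_equivs B f) E fold_zigzag (folded E)"
    unfolding fold_zigzag_def
    by (rule zigzag_append[OF z(1)[OF i(1)] zigzag_append[OF z(2)[OF i(2)] zigzag_append[OF z(1)[OF i(3)]
        zigzag_append[OF z(2)[OF i(4)] zigzag_append[OF z(1)[OF i(5)] z(1)[OF i(6)]]]]]])
  show "\<forall>s\<in>set fold_zigzag. inverted (perf_equivs B f) s"
    unfolding fold_zigzag_def using i[THEN z(3)] i[THEN z(4)] by simp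
qed

end

theorem theorem3p8:
  fixes A :: "'a ring" and B :: "('a, 'b) module" and f :: 'b
  assumes "regular_local_ring A" and "krull_dim A < \<infinity>"
    and "affine_LG_model A B f"
  shows "\<exists>\<eta> :: ('b, ('b, 'x) univ) kdg \<Rightarrow> _.
     (\<forall>E \<in> coh_s B f. folded E \<in> coh_s B f \<and>
        is_isomorphism (sing B f) (sing_obj B f E) (sing_obj B f (folded E)) (\<eta> E)) \<and>
     (\<forall>E \<in> coh_s B f. \<forall>F \<in> coh_s B f. \<forall>\<phi> \<in> cocycles B E F.
        folded_map \<phi> \<in> cocycles B (folded E) (folded F) \<and>
        Comp (sing B f) (sing_obj B f E) (sing_obj B f (folded E)) (sing_obj B f (folded F))
          (sing_map B f (folded E) (folded F) (folded_map \<phi>)) (\<eta> E) =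
        Comp (sing B f) (sing_obj B f E) (sing_obj B f F) (sing_obj B f (folded F))
          (\<eta> F) (sing_map B f E F \<phi>))"
proof -
  have "cring B" "f \<in> carrier B"
    using assms(3) algebra.M_cring[of A B] by (auto simp: affine_LG_model_def)
  then have loc: "bounded_kdg B f E" if "E \<in> coh_s B f" for E :: "('b, ('b, 'x) univ) kdg"
    using that by (simp add: bounded_kdg_def)
  define \<eta> where "\<eta> E = Collect (zigzag_eq (coh_cat B f) (perf_equivs B f) E (folded E) (bounded_kdg.fold_zigzag B f E))"
    for E :: "('b, ('b, 'x) univ) kdg"
  have "folded E \<in> coh_s B f \<and> is_isomorphism (sing B f) (sing_obj B f E) (sing_obj B f (folded E)) (\<eta> E)"
    if "E \<in> coh_s B f" for E :: "('b, ('b, 'x) univ) kdg"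
  proof -
    interpret bounded_kdg B f E by (rule loc[OF that])
    show ?thesis
      unfolding sing_def verdier_quotient_def sing_obj_def \<eta>_def
      using folded_coh_s karoubi_localization_iso[OF fold_zigzag(1) zigzag_flip[OF fold_zigzag]] by blast
  qed
  moreover have "folded_map \<phi> \<in> cocycles B (folded E) (folded F) \<and>
        Comp (sing B f) (sing_obj B f E) (sing_obj B f (folded E)) (sing_obj B f (folded F))
          (sing_map B f (folded E) (folded F) (folded_map \<phi>)) (\<eta> E) =
        Comp (sing B f) (sing_obj B f E) (sing_obj B f F) (sing_obj B f (folded F))
          (\<eta> F) (sing_map B f E F \<phi>)"
    if E: "E \<in> coh_s B f" and F: "F \<in> coh_s B f" and \<phi>: "\<phi> \<in> cocycles B E F" for E F :: "('b, ('b, 'x) univ) kdg" and \<phi>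
  proof -
    interpret kdg_morphism B f E F \<phi>
      using loc[OF E] loc[OF F] \<phi> by (simp add: kdg_morphism_def kdg_morphism_axioms_def)
    have z: "zigzag (coh_cat B f) (perf_equivs B f) (folded E) [fwd B (folded E) (folded F) (folded_map \<phi>)] (folded F)"
      "zigzag (coh_cat B f) (perf_equivs B f) E [fwd B E F \<phi>] F"
      using E.folded_coh_s F.folded_coh_s folded_map_cocycle E F \<phi> by (auto simp: fwd_def H0_simps)
    \<comment> \<open>All objects in question carry their identity as idempotent, and composition in
      the idempotent completion is that of the underlying category. The naturality equation thus
      becomes one between classes of zigzags.\<close>
    have k: "Comp (sing B f) (sing_obj B f X) (sing_obj B f Y) (sing_obj B f Z) = Comp (verdier_quotient B f) X Y Z"
      for X Y Z :: "('b, ('b, 'x) univ) kdg"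
      by (simp add: sing_def sing_obj_def karoubi_def)
    have m: "sing_map B f X Y \<psi> = Collect (zigzag_eq (coh_cat B f) (perf_equivs B f) X Y [fwd B X Y \<psi>])"
      for X Y :: "('b, ('b, 'x) univ) kdg" and \<psi>
      by (simp add: sing_map_def loc_map_def fwd_def)
    note eq = fold_zigzag_natural[unfolded nat_square_def, THEN conjunct2, THEN conjunct2]
    show ?thesis
      unfolding k m \<eta>_def verdier_quotient_def
        localization_Comp[OF E.fold_zigzag(1) z(1)] localization_Comp[OF z(2) F.fold_zigzag(1)]
      using folded_map_cocycle zigzag_eq_class[OF eq] by blast
  qed
  ultimately show ?thesis by blast
qed

end
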